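(* Fix $r\in(1,\infty)$ and a $w$-moderate weight $m$, and assume: (a) the right convolution operator $RC_K:f\mapsto f*K$ is well-defined (hence bounded) on $L_{r,m}(G)$; (b) there is a unit neighbourhood $U_0\subset G$ such that for each unit neighbourhood $U\subset U_0$ there is a constant $C_U>0$ with $\|\mathrm{osc}^\rho_U f\|_{L_{r,m}}\le C_U\|f\|_{L_{r,m}}$ for all $f\in\mathcal M_{r,m}$; (c) for every $\varepsilon>0$ there is a unit neighbourhood $U_\varepsilon\subset U_0$ with $C_U\le\varepsilon$ for all unit neighbourhoods $U\subset U_\varepsilon$. Let $U\subset U_0^{-1}$ be a compact unit neighbourhood with $\|RC_K\|_{L_{r,m}\to L_{r,m}}\cdot C_{U^{-1}}<1$, let $X=(x_i)_{i\in I}$ be a relatively separated family in $G$ for which there exists a $U$-BUPU with localizing family $X$, and let $(m_X)_i=m(x_i)$. Then the sampling operator $\mathrm{Samp}_{X,\mathrm{Co}}:\mathrm{Co}(L_{r,m})\to\ell_{r,m_X}(I)$, $f\mapsto(\langle f,\pi(x_i)u\rangle_{\mathcal S_w})_{i\in I}=(V_ef(x_i))_{i\in I}$, is well-defined and bounded, and there is a bounded linear operator $R_{\mathrm{Co}}:\ell_{r,m_X}(I)\to\mathrm{Co}(L_{r,m})$ with $R_{\mathrm{Co}}\circ\mathrm{Samp}_{X,\mathrm{Co}}=\mathrm{id}_{\mathrm{Co}(L_{r,m})}$. Moreover, $R_{\mathrm{Co}}$ can be chosen so that its action does not depend on $(r,m)$: if the hypotheses hold for $(r_1,m_1)$ and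 $(r_2,m_2)$ (with the same $X$ and BUPU), the corresponding operators $R_1,R_2$ satisfy $R_1c=R_2c$ for all $c\in\ell_{r_1,m_{1,X}}(I)\cap\ell_{r_2,m_{2,X}}(I)$.
   Context: Setting. $G$ is a locally compact, second countable group with left Haar measure ($|E|$ the Haar measure of $E$), identity $e$, modular function $\Delta$. $(f*g)(x)=\int_G f(y)g(y^{-1}x)\,dy$, $\lambda(x)f(y)=f(x^{-1}y)$. $w:G\to(0,\infty)$ is a continuous weight with $w(xy)\le w(x)w(y)$, $w(x)=w(x^{-1})$. $L_{p,v}(G)$ is the space of measurable $f$ with $\|f\|_{L_{p,v}}=\|vf\|_{L_p}<\infty$; $\ell_{p,\theta}(I)=\{c:(\theta_ic_i)\in\ell_p(I)\}$. A continuous $m:G\to(0,\infty)$ is $w$-moderate if $m(xy)\le w(x)m(y)$ and $m(xy)\le m(x)w(y)$. $\pi$ is a strongly continuous unitary representation on a separable Hilbert space $\mathcal H$ with $u\in\mathcal H$ such that $Vv(x)=\langle v,\pi(x)u\rangle_{\mathcal H}$ is an isometry $\mathcal H\to L_2(G)$; $K(x)=\langle u,\pi(x)u\rangle_{\mathcal H}$; standing assumption $K\in L_{p,w}(G)$ for all $p\in(1,\infty)$. $\mathcal S_w=\{v\in\mathcal H:Vv\in L_{p,w}\ \forall p\in(1,\infty)\}$ (Fréchet, seminorms $\|Vv\|_{L_{p,w}}$), $\mathcal S_w'$ its anti-dual, $\mathcal H\hookrightarrow\mathcal S_w'$, $V_eT(x)=\langle T,\pi(x)u\rangle_{\mathcal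 S_w}$; $\mathrm{Co}(L_{r,m})=\{T\in\mathcal S_w':V_eT\in L_{r,m}\}$ with norm $\|V_eT\|_{L_{r,m}}$; $\mathcal M_{r,m}=\{f\in L_{r,m}:f*K=f\}$. Right oscillation: $\mathrm{osc}^\rho_Uf(x)=\sup_{u\in U}|f(xu)-f(x)|$. A family $X=(x_i)_{i\in I}$ is relatively separated if for every compact unit neighbourhood $Q$ there is $N$ with $\sum_{i\in I}\chi_{x_iQ}(x)\le N$ for all $x\in G$. For a compact unit neighbourhood $U$, a $U$-BUPU with localizing family $X$ is a family $(\psi_i)_{i\in I}$ of measurable functions $\psi_i:G\to[0,1]$, with $X$ relatively separated, $\psi_i\equiv0$ on $G\setminus x_iU$, and $\sum_i\psi_i\equiv1$. *)

theory Defs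
  imports "HOL-Analysis.Analysis"
begin

text \<open>Conventions. The group G is a type 'g of class group_add (NOT assumed commutative):
  the group product x y is written x + y, the inverse x^-1 is -x, the identity e is 0.
  The Hilbert space H is a type 'h of class ab_group_add with complex scalar multiplication
  sc and inner product ip (linear in the first, conjugate linear in the second argument).\<close>

definition ennpow :: "ennreal \<Rightarrow> real \<Rightarrow> ennreal" where
  "ennpow a t = (if a = \<infinity> then \<infinity> else ennreal (enn2real a powr t))"

definition wnorm :: "'g measure \<Rightarrow> real \<Rightarrow> ('g \<Rightarrow> real) \<Rightarrow> ('g \<Rightarrow> ennreal) \<Rightarrow> ennreal" where
  "wnorm \<mu> p v g = ennpow (\<integral>\<^sup>+ x. ennpow (ennreal (v x) * g x) p \<partial>\<mu>) (1 / p)"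

definition Lnorm :: "'g measure \<Rightarrow> real \<Rightarrow> ('g \<Rightarrow> real) \<Rightarrow> ('g \<Rightarrow> complex) \<Rightarrow> ennreal" where
  "Lnorm \<mu> p v f = wnorm \<mu> p v (\<lambda>x. ennreal (cmod (f x)))"

definition Lspace :: "'g measure \<Rightarrow> real \<Rightarrow> ('g \<Rightarrow> real) \<Rightarrow> ('g \<Rightarrow> complex) set" where
  "Lspace \<mu> p v = {f. f \<in> borel_measurable \<mu> \<and> Lnorm \<mu> p v f < \<infinity>}"

definition lnorm :: "real \<Rightarrow> ('i \<Rightarrow> real) \<Rightarrow> ('i \<Rightarrow> complex) \<Rightarrow> ennreal" where
  "lnorm p \<theta> c = ennpow (\<integral>\<^sup>+ i. ennpow (ennreal (\<theta> i) * ennreal (cmod (c i))) p \<partial>count_space UNIV) (1 / p)"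

definition lspace :: "real \<Rightarrow> ('i \<Rightarrow> real) \<Rightarrow> ('i \<Rightarrow> complex) set" where
  "lspace p \<theta> = {c. lnorm p \<theta> c < \<infinity>}"

definition unit_nbhd :: "'g::{group_add,topological_space} set \<Rightarrow> bool" where
  "unit_nbhd U \<longleftrightarrow> 0 \<in> interior U"

definition lcsc_group :: "'g::{group_add,t2_space,second_countable_topology} itself \<Rightarrow> bool" where
  "lcsc_group _ \<longleftrightarrow>
     continuous_on UNIV (\<lambda>p::'g \<times> 'g. fst p + snd p) \<and>
     continuous_on UNIV (uminus :: 'g \<Rightarrow> 'g) \<and>
     (\<forall>x::'g. \<exists>K. compact K \<and> x \<in> interior K)"

text \<open>A left Haar measure: a left-invariant Borel measure, finite on compacts, positive on
  nonempty open sets (on a second countable LCH group such a measure is Radon).\<close>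
definition haar_measure :: "'g::{group_add,topological_space} measure \<Rightarrow> bool" where
  "haar_measure \<mu> \<longleftrightarrow>
     space \<mu> = UNIV \<and> sets \<mu> = sets borel \<and>
     (\<forall>x A. A \<in> sets borel \<longrightarrow> emeasure \<mu> ((\<lambda>y. x + y) ` A) = emeasure \<mu> A) \<and>
     (\<forall>K. compact K \<longrightarrow> emeasure \<mu> K < \<infinity>) \<and>
     (\<forall>W. open W \<and> W \<noteq> {} \<longrightarrow> emeasure \<mu> W > 0)"

definition weight :: "('g::{group_add,topological_space} \<Rightarrow> real) \<Rightarrow> bool" where
  "weight w \<longleftrightarrow> continuous_on UNIV w \<and> (\<forall>x. w x > 0) \<and>
     (\<forall>x y. w (x + y) \<le> w x * w y) \<and> (\<forall>x. w (- x) = w x)"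

definition moderate :: "('g::{group_add,topological_space} \<Rightarrow> real) \<Rightarrow> ('g \<Rightarrow> real) \<Rightarrow> bool" where
  "moderate w m \<longleftrightarrow> continuous_on UNIV m \<and> (\<forall>x. m x > 0) \<and>
     (\<forall>x y. m (x + y) \<le> w x * m y) \<and> (\<forall>x y. m (x + y) \<le> m x * w y)"

definition hnorm :: "('h \<Rightarrow> 'h \<Rightarrow> complex) \<Rightarrow> 'h \<Rightarrow> real" where
  "hnorm ip x = sqrt (Re (ip x x))"

definition hilbert_space :: "(complex \<Rightarrow> 'h::ab_group_add \<Rightarrow> 'h) \<Rightarrow> ('h \<Rightarrow> 'h \<Rightarrow> complex) \<Rightarrow> bool" where
  "hilbert_space sc ip \<longleftrightarrow>
     vector_space sc \<and>
     (\<forall>x y z. ip (x + y) z = ip x z + ip y z) \<and>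
     (\<forall>a x y. ip (sc a x) y = a * ip x y) \<and>
     (\<forall>x y. ip y x = cnj (ip x y)) \<and>
     (\<forall>x. Im (ip x x) = 0 \<and> Re (ip x x) \<ge> 0) \<and>
     (\<forall>x. ip x x = 0 \<longrightarrow> x = 0) \<and>
     (\<forall>s::nat \<Rightarrow> 'h. (\<forall>\<epsilon>>0. \<exists>N. \<forall>n\<ge>N. \<forall>k\<ge>N. hnorm ip (s n - s k) < \<epsilon>) \<longrightarrow>
         (\<exists>l. (\<lambda>n. hnorm ip (s n - l)) \<longlonglongrightarrow> 0)) \<and>
     (\<exists>D. countable D \<and> (\<forall>x \<epsilon>. \<epsilon> > 0 \<longrightarrow> (\<exists>d\<in>D. hnorm ip (x - d) < \<epsilon>)))"

definition unitary_rep :: "(complex \<Rightarrow> 'h::ab_group_add \<Rightarrow> 'h) \<Rightarrow> ('h \<Rightarrow> 'h \<Rightarrow> complex)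
     \<Rightarrow> ('g::{group_add,topological_space} \<Rightarrow> 'h \<Rightarrow> 'h) \<Rightarrow> bool" where
  "unitary_rep sc ip \<pi> \<longleftrightarrow>
     (\<forall>x. (\<forall>v s. \<pi> x (v + s) = \<pi> x v + \<pi> x s) \<and> (\<forall>a v. \<pi> x (sc a v) = sc a (\<pi> x v)) \<and>
          (\<forall>v s. ip (\<pi> x v) (\<pi> x s) = ip v s) \<and> surj (\<pi> x)) \<and>
     (\<forall>x y. \<pi> (x + y) = \<pi> x \<circ> \<pi> y) \<and> \<pi> 0 = id \<and>
     (\<forall>v x \<epsilon>. \<epsilon> > 0 \<longrightarrow> (\<exists>N. open N \<and> x \<in> N \<and> (\<forall>y\<in>N. hnorm ip (\<pi> y v - \<pi> x v) < \<epsilon>)))"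

definition voice :: "('h \<Rightarrow> 'h \<Rightarrow> complex) \<Rightarrow> ('g \<Rightarrow> 'h \<Rightarrow> 'h) \<Rightarrow> 'h \<Rightarrow> 'h \<Rightarrow> 'g \<Rightarrow> complex" where
  "voice ip \<pi> u v x = ip v (\<pi> x u)"

definition admissible :: "'g measure \<Rightarrow> ('h \<Rightarrow> 'h \<Rightarrow> complex) \<Rightarrow> ('g \<Rightarrow> 'h \<Rightarrow> 'h) \<Rightarrow> 'h \<Rightarrow> bool" where
  "admissible \<mu> ip \<pi> u \<longleftrightarrow>
     (\<forall>v. voice ip \<pi> u v \<in> borel_measurable \<mu> \<and>
          (\<integral>\<^sup>+ x. ennreal (cmod (voice ip \<pi> u v x)) ^ 2 \<partial>\<mu>) = ennreal (Re (ip v v)))"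

definition Sw :: "'g measure \<Rightarrow> ('h \<Rightarrow> 'h \<Rightarrow> complex) \<Rightarrow> ('g \<Rightarrow> 'h \<Rightarrow> 'h) \<Rightarrow> 'h \<Rightarrow> ('g \<Rightarrow> real) \<Rightarrow> 'h set" where
  "Sw \<mu> ip \<pi> u w = {v. \<forall>p>1. voice ip \<pi> u v \<in> Lspace \<mu> p w}"

text \<open>Continuous conjugate-linear functionals on the Frechet space S_w (seminorms
  ||V v||_{L_{p,w}}, p > 1). They are represented as functions on H vanishing off S_w,
  so that equality of functionals is equality of functions.\<close>
definition antidual :: "'g measure \<Rightarrow> (complex \<Rightarrow> 'h::ab_group_add \<Rightarrow> 'h) \<Rightarrow> ('h \<Rightarrow> 'h \<Rightarrow> complex)
     \<Rightarrow> ('g \<Rightarrow> 'h \<Rightarrow> 'h) \<Rightarrow> 'h \<Rightarrow> ('g \<Rightarrow> real) \<Rightarrow> ('h \<Rightarrow> complex) set" where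
  "antidual \<mu> sc ip \<pi> u w =
    {T. (\<forall>v\<in>Sw \<mu> ip \<pi> u w. \<forall>s\<in>Sw \<mu> ip \<pi> u w. T (v + s) = T v + T s) \<and>
        (\<forall>a. \<forall>v\<in>Sw \<mu> ip \<pi> u w. T (sc a v) = cnj a * T v) \<and>
        (\<forall>v. v \<notin> Sw \<mu> ip \<pi> u w \<longrightarrow> T v = 0) \<and>
        (\<exists>P C. finite P \<and> P \<subseteq> {1<..} \<and>
           (\<forall>v\<in>Sw \<mu> ip \<pi> u w. ennreal (cmod (T v)) \<le>
               ennreal C * (\<Sum>p\<in>P. Lnorm \<mu> p w (voice ip \<pi> u v))))}"

definition Ve :: "('g \<Rightarrow> 'h \<Rightarrow> 'h) \<Rightarrow> 'h \<Rightarrow> ('h \<Rightarrow> complex) \<Rightarrow> 'g \<Rightarrow> complex" where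
  "Ve \<pi> u T x = T (\<pi> x u)"

definition Co :: "'g measure \<Rightarrow> (complex \<Rightarrow> 'h::ab_group_add \<Rightarrow> 'h) \<Rightarrow> ('h \<Rightarrow> 'h \<Rightarrow> complex)
     \<Rightarrow> ('g \<Rightarrow> 'h \<Rightarrow> 'h) \<Rightarrow> 'h \<Rightarrow> ('g \<Rightarrow> real) \<Rightarrow> real \<Rightarrow> ('g \<Rightarrow> real) \<Rightarrow> ('h \<Rightarrow> complex) set" where
  "Co \<mu> sc ip \<pi> u w r m = {T \<in> antidual \<mu> sc ip \<pi> u w. Ve \<pi> u T \<in> Lspace \<mu> r m}"

definition Conorm :: "'g measure \<Rightarrow> ('g \<Rightarrow> 'h \<Rightarrow> 'h) \<Rightarrow> 'h \<Rightarrow> real \<Rightarrow> ('g \<Rightarrow> real) \<Rightarrow> ('h \<Rightarrow> complex) \<Rightarrow> ennreal" where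
  "Conorm \<mu> \<pi> u r m T = Lnorm \<mu> r m (Ve \<pi> u T)"

definition conv :: "'g::group_add measure \<Rightarrow> ('g \<Rightarrow> complex) \<Rightarrow> ('g \<Rightarrow> complex) \<Rightarrow> 'g \<Rightarrow> complex" where
  "conv \<mu> f g x = (\<integral> y. f y * g (- y + x) \<partial>\<mu>)"

definition Mspace :: "'g::group_add measure \<Rightarrow> ('g \<Rightarrow> complex) \<Rightarrow> real \<Rightarrow> ('g \<Rightarrow> real) \<Rightarrow> ('g \<Rightarrow> complex) set" where
  "Mspace \<mu> K r m = {f \<in> Lspace \<mu> r m. \<forall>x. conv \<mu> f K x = f x}"

definition osc :: "'g::group_add set \<Rightarrow> ('g \<Rightarrow> complex) \<Rightarrow> 'g \<Rightarrow> ennreal" where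
  "osc U f x = (SUP u\<in>U. ennreal (cmod (f (x + u) - f x)))"

definition rc_opnorm :: "'g::group_add measure \<Rightarrow> ('g \<Rightarrow> complex) \<Rightarrow> real \<Rightarrow> ('g \<Rightarrow> real) \<Rightarrow> ennreal" where
  "rc_opnorm \<mu> K r m =
     (SUP f\<in>{f \<in> Lspace \<mu> r m. Lnorm \<mu> r m f \<noteq> 0}. Lnorm \<mu> r m (conv \<mu> f K) / Lnorm \<mu> r m f)"

definition rel_separated :: "('i \<Rightarrow> 'g::{group_add,topological_space}) \<Rightarrow> bool" where
  "rel_separated X \<longleftrightarrow>
     (\<forall>Q. compact Q \<and> unit_nbhd Q \<longrightarrow>
        (\<exists>N::nat. \<forall>x. finite {i. x \<in> (\<lambda>q. X i + q) ` Q} \<and> card {i. x \<in> (\<lambda>q. X i + q) ` Q} \<le> N))"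

definition bupu :: "'g::{group_add,topological_space} set \<Rightarrow> ('i \<Rightarrow> 'g) \<Rightarrow> ('i \<Rightarrow> 'g \<Rightarrow> real) \<Rightarrow> bool" where
  "bupu U X \<psi> \<longleftrightarrow>
     rel_separated X \<and>
     (\<forall>i. \<psi> i \<in> borel_measurable borel) \<and>
     (\<forall>i y. 0 \<le> \<psi> i y \<and> \<psi> i y \<le> 1) \<and>
     (\<forall>i y. y \<notin> (\<lambda>q. X i + q) ` U \<longrightarrow> \<psi> i y = 0) \<and>
     (\<forall>y. ((\<lambda>i. \<psi> i y) has_sum 1) UNIV)"

definition sampling_hyps :: "'g::{group_add,topological_space} measure \<Rightarrow> ('g \<Rightarrow> complex) \<Rightarrow> ('g \<Rightarrow> real)
     \<Rightarrow> ('i \<Rightarrow> 'g) \<Rightarrow> ('i \<Rightarrow> 'g \<Rightarrow> real) \<Rightarrow> real \<Rightarrow> ('g \<Rightarrow> real) \<Rightarrow> bool" where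
  "sampling_hyps \<mu> K w X \<psi> r m \<longleftrightarrow>
     1 < r \<and> moderate w m \<and>
     (\<forall>f\<in>Lspace \<mu> r m. (\<forall>x. integrable \<mu> (\<lambda>y. f y * K (- y + x))) \<and> conv \<mu> f K \<in> Lspace \<mu> r m) \<and>
     (\<exists>U0 (C :: 'g set \<Rightarrow> real) U.
        unit_nbhd U0 \<and>
        (\<forall>V. unit_nbhd V \<and> V \<subseteq> U0 \<longrightarrow> C V > 0 \<and>
            (\<forall>f\<in>Mspace \<mu> K r m. wnorm \<mu> r m (osc V f) \<le> ennreal (C V) * Lnorm \<mu> r m f)) \<and>
        (\<forall>\<epsilon>>0. \<exists>U\<epsilon>. unit_nbhd U\<epsilon> \<and> U\<epsilon> \<subseteq> U0 \<and>
            (\<forall>V. unit_nbhd V \<and> V \<subseteq> U\<epsilon> \<longrightarrow> C V \<le> \<epsilon>)) \<and>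
        compact U \<and> unit_nbhd U \<and> U \<subseteq> uminus ` U0 \<and>
        rc_opnorm \<mu> K r m * ennreal (C (uminus ` U)) < 1 \<and>
        bupu U X \<psi>)"

end

theory Submission
  imports Defs
begin

text \<open>Every \<open>T\<close> in the coorbit space satisfies \<open>T v = \<integral> V\<^sub>e T \<cdot> cnj (V v)\<close> on \<open>S\<^sub>w\<close>, so it is
  determined by \<open>V\<^sub>e T\<close>, and \<open>V\<^sub>e T\<close> is reproduced by convolution with \<open>K\<close>. Since \<open>K\<close> is not assumed
  integrable, this rests on Young's inequality (\<open>\<bar>V v\<bar> * \<bar>K\<bar>\<close> lies in every \<open>L\<^bsub>p,w\<^esub>\<close> with \<open>p > 1\<close>) and on
  Riemann sums over compact sets, which converge in \<open>S\<^sub>w\<close> because translation is continuous in \<open>L\<^bsub>p,w\<^esub>\<close>.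

  On the reproducing space, \<open>f\<close> differs from \<open>\<Sum>\<^sub>i f(x\<^sub>i) \<psi>\<^sub>i\<close> by at most its right oscillation over
  \<open>U\<^sup>-\<^sup>1\<close>, so \<open>f \<mapsto> f - (\<Sum>\<^sub>i f(x\<^sub>i) \<psi>\<^sub>i) * K\<close> is a contraction there. The
  reconstruction is the resulting Neumann series applied to \<open>(\<Sum>\<^sub>i c\<^sub>i \<psi>\<^sub>i) * K\<close>; point evaluations are
  bounded, so the series converges pointwise.\<close>

section \<open>\<open>L\<^sub>p\<close> seminorms of extended nonnegative functions\<close>

text \<open>A functional in the antidual is controlled only by finitely many seminorms, so moving
  \<open>T\<close> under the reproducing integral is a claim about convergence in those seminorms;
  this is the hard step. Once it is done, convolution with \<open>K\<close> is \<open>Ve\<close>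
  after \<open>functional\<close>, and the idempotence of this convolution, the continuity of
  reproduced functions and the injectivity of \<open>Ve\<close> all follow through functionals.

  The group may be non-unimodular. The inversion that convolution produces is absorbed by the
  symmetry of \<open>cmod K\<close> and of \<open>w\<close>. Giving both factors in Young's
  inequality the exponent q with 1 + 1/p = 2/q keeps q above 1 whenever p is, so the range of
  exponents granted for \<open>K\<close> is enough.

  Synthesis leaves the reproducing space and convolution returns to it. As \<open>f\<close> equals
  its own convolution with \<open>K\<close>, that convolution can be taken over the whole difference
  between \<open>f\<close> and its synthesis. The contraction factor is therefore the norm of the
  convolution times the oscillation constant of U^{-1}.\<close>

lemma ennpow_top [simp]: "ennpow \<infinity> t = \<infinity>" "ennpow top t = top"
  by (auto simp: ennpow_def)

lemma ennpow_ennreal: "0 \<le> a \<Longrightarrow> ennpow (ennreal a) t = ennreal (a powr t)"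
  by (auto simp: ennpow_def)

lemma ennpow_0 [simp]: "ennpow 0 t = 0"
  by (simp add: ennpow_def)

lemma ennpow_1 [simp]: "ennpow 1 t = 1"
  by (simp add: ennpow_def)

lemma ennpow_one [simp]: "ennpow a 1 = a"
  by (cases a) (auto simp: ennpow_ennreal)

lemma ennpow_mono: "a \<le> b \<Longrightarrow> 0 \<le> t \<Longrightarrow> ennpow a t \<le> ennpow b t"
  by (cases a; cases b) (auto simp: ennpow_ennreal powr_mono2 ennreal_leI top_unique)

lemma ennpow_eq_0_iff [simp]: "ennpow a t = 0 \<longleftrightarrow> a = 0"
  by (cases a) (auto simp: ennpow_ennreal)

lemma ennpow_eq_top_iff [simp]: "ennpow a t = top \<longleftrightarrow> a = top"
  by (cases a) (auto simp: ennpow_ennreal)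

lemma ennpow_less_top_iff: "ennpow a t < \<infinity> \<longleftrightarrow> a < \<infinity>"
  by (simp add: less_top[symmetric])

lemma ennpow_mult: "ennpow (a * b) t = ennpow a t * ennpow b t"
  by (cases a; cases b) 
     (auto simp: ennpow_ennreal ennreal_mult[symmetric] powr_mult ennreal_mult_eq_top_iff
        ennreal_top_mult ennreal_mult_top)

lemma ennpow_ennpow: "ennpow (ennpow a s) t = ennpow a (s * t)"
  by (cases a) (auto simp: ennpow_ennreal powr_powr)

lemma measurable_ennpow [measurable]:
  assumes [measurable]: "f \<in> borel_measurable M"
  shows "(\<lambda>x. ennpow (f x) t) \<in> borel_measurable M"
  unfolding ennpow_def infinity_ennreal_def by measurable

text \<open>Common form of \<open>wnorm\<close> (the weight absorbed into the function) and of
  \<open>lnorm\<close> (counting measure), so that each inequality is proved once for both. With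
  values in \<open>ennreal\<close>, infinite norms need no separate language.\<close>

definition pnorm :: "'a measure \<Rightarrow> real \<Rightarrow> ('a \<Rightarrow> ennreal) \<Rightarrow> ennreal" where
  "pnorm M p \<phi> = ennpow (\<integral>\<^sup>+ x. ennpow (\<phi> x) p \<partial>M) (1 / p)"

lemma wnorm_eq_pnorm: "wnorm M p v g = pnorm M p (\<lambda>x. ennreal (v x) * g x)"
  by (simp add: wnorm_def pnorm_def)

lemma lnorm_eq_pnorm:
  "lnorm p \<theta> c = pnorm (count_space UNIV) p (\<lambda>i. ennreal (\<theta> i) * ennreal (cmod (c i)))"
  by (simp add: lnorm_def pnorm_def)

lemma pnorm_power: "0 < p \<Longrightarrow> ennpow (pnorm M p \<phi>) p = (\<integral>\<^sup>+ x. ennpow (\<phi> x) p \<partial>M)"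
  by (simp add: pnorm_def ennpow_ennpow)

lemma pnorm_mono:
  "0 < p \<Longrightarrow> (\<And>x. x \<in> space M \<Longrightarrow> \<phi> x \<le> \<psi> x) \<Longrightarrow> pnorm M p \<phi> \<le> pnorm M p \<psi>"
  unfolding pnorm_def by (intro ennpow_mono nn_integral_mono) auto

lemma pnorm_less_top_iff:
  "0 < p \<Longrightarrow> pnorm M p \<phi> < \<infinity> \<longleftrightarrow> (\<integral>\<^sup>+ x. ennpow (\<phi> x) p \<partial>M) < \<infinity>"
  unfolding pnorm_def by (rule ennpow_less_top_iff)

lemma ennpow_le_cancel: "0 < t \<Longrightarrow> ennpow a t \<le> ennpow b t \<longleftrightarrow> a \<le> b"
  using ennpow_mono[of a b t] ennpow_mono[of "ennpow a t" "ennpow b t" "1 / t"]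
  by (auto simp: ennpow_ennpow)

lemma pnorm_le_iff:
  "0 < p \<Longrightarrow> pnorm M p \<phi> \<le> B \<longleftrightarrow> (\<integral>\<^sup>+ x. ennpow (\<phi> x) p \<partial>M) \<le> ennpow B p"
  using ennpow_le_cancel[of p "pnorm M p \<phi>" B] by (simp add: pnorm_power)

lemma pnorm_cmult:
  assumes "0 < p" "\<phi> \<in> borel_measurable M"
  shows "pnorm M p (\<lambda>x. c * \<phi> x) = c * pnorm M p \<phi>"
  using assms by (simp add: pnorm_def ennpow_mult nn_integral_cmult ennpow_ennpow)

lemma pnorm_0 [simp]: "pnorm M p (\<lambda>x. 0) = 0"
  by (simp add: pnorm_def)

section \<open>Hoelder's and Minkowski's inequalities by normalisation\<close>

lemma nn_integral_scaled_ennpow_le_1: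
  assumes "\<phi> \<in> borel_measurable M" "0 < p" "0 < a" "pnorm M p \<phi> \<le> ennreal a"
  shows "(\<integral>\<^sup>+ x. ennpow (ennreal (1 / a) * \<phi> x) p \<partial>M) \<le> 1"
proof -
  have "pnorm M p (\<lambda>x. ennreal (1 / a) * \<phi> x) \<le> 1"
    using assms mult_left_mono[OF assms(4), of "ennreal (1/a)"]
    by (simp add: pnorm_cmult ennreal_mult[symmetric])
  then show ?thesis using assms by (simp add: pnorm_le_iff)
qed

lemma ennreal_Young:
  fixes x y :: ennreal
  assumes "1 < p" "1 < q" "1 / p + 1 / q = 1"
  shows "x * y \<le> ennreal (1 / p) * ennpow x p + ennreal (1 / q) * ennpow y q"
proof (cases "x = top \<or> y = top")
  case True
  then show ?thesis
  proof
    assume "x = top" then show ?thesis using assms by (simp add: ennreal_mult_top)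
  next
    assume "y = top" then show ?thesis using assms by (simp add: ennreal_mult_top)
  qed
next
  case False
  then obtain a b where [simp]: "x = ennreal a" "0 \<le> a" "y = ennreal b" "0 \<le> b"
    by (cases x; cases y) auto
  have "a * b \<le> a powr p / p + b powr q / q"
    by (rule Youngs_inequality) (use assms in \<open>auto simp: field_simps\<close>)
  then show ?thesis using assms
    by (simp add: ennpow_ennreal ennreal_mult[symmetric] ennreal_plus[symmetric] del: ennreal_plus)
qed

text \<open>Pointwise Young inequality after dividing by \<open>A + e\<close> and
  \<open>B + e\<close>. The slack \<open>e\<close> keeps both divisors positive when a norm vanishes
  and is then sent to 0.\<close>

lemma Holder_pnorm:
  assumes [measurable]: "\<phi> \<in> borel_measurable M" "\<psi> \<in> borel_measurable M"
    and pq: "1 < p" "1 < q" "1 / p + 1 / q = 1"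
    and fin: "pnorm M p \<phi> < \<infinity>" "pnorm M q \<psi> < \<infinity>"
  shows "(\<integral>\<^sup>+ x. \<phi> x * \<psi> x \<partial>M) \<le> pnorm M p \<phi> * pnorm M q \<psi>"
proof -
  obtain A B where A: "pnorm M p \<phi> = ennreal A" "0 \<le> A" and B: "pnorm M q \<psi> = ennreal B" "0 \<le> B"
    using fin by (cases "pnorm M p \<phi>"; cases "pnorm M q \<psi>") auto
  let ?I = "\<integral>\<^sup>+ x. \<phi> x * \<psi> x \<partial>M"
  have *: "?I \<le> ennreal ((A + e) * (B + e))" if "0 < e" for e
  proof -
    let ?a = "A + e" and ?b = "B + e"
    have ab: "0 < ?a" "0 < ?b" using A B that by auto
    have "ennreal (1 / ?a) * ennreal (1 / ?b) * ?I
      = (\<integral>\<^sup>+ x. (ennreal (1 / ?a) * \<phi> x) * (ennreal (1 / ?b) * \<psi> x) \<partial>M)"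
      by (simp add: nn_integral_cmult[symmetric] mult_ac)
    also have "\<dots> \<le> (\<integral>\<^sup>+ x. ennreal (1 / p) * ennpow (ennreal (1 / ?a) * \<phi> x) p
         + ennreal (1 / q) * ennpow (ennreal (1 / ?b) * \<psi> x) q \<partial>M)"
      by (intro nn_integral_mono ennreal_Young pq)
    also have "\<dots> = ennreal (1 / p) * (\<integral>\<^sup>+ x. ennpow (ennreal (1 / ?a) * \<phi> x) p \<partial>M)
         + ennreal (1 / q) * (\<integral>\<^sup>+ x. ennpow (ennreal (1 / ?b) * \<psi> x) q \<partial>M)"
      by (simp add: nn_integral_add nn_integral_cmult)
    also have "\<dots> \<le> ennreal (1 / p) * 1 + ennreal (1 / q) * 1"
      using pq ab A B that by (intro add_mono mult_left_mono nn_integral_scaled_ennpow_le_1)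
        (auto intro!: ennreal_leI)
    also have "\<dots> = 1" using pq by (simp add: ennreal_plus[symmetric] del: ennreal_plus)
    finally have le1: "ennreal (1 / ?a) * ennreal (1 / ?b) * ?I \<le> 1" .
    have "?I = ennreal (?a * ?b) * (ennreal (1 / ?a) * ennreal (1 / ?b) * ?I)"
    proof -
      have "ennreal (?a * ?b) * (ennreal (1 / ?a) * ennreal (1 / ?b)) = ennreal ((?a * ?b) * (1/?a * (1/?b)))"
        using ab by (simp add: ennreal_mult[symmetric] del: ennreal_1)
      also have "\<dots> = 1" using ab by simp
      finally show ?thesis by (simp add: mult.assoc[symmetric])
    qed
    also have "\<dots> \<le> ennreal (?a * ?b) * 1" by (intro mult_left_mono le1) auto
    finally show ?thesis by simp
  qed
  have "((\<lambda>n. ennreal ((A + 1 / real (Suc n)) * (B + 1 / real (Suc n)))) \<longlongrightarrow> ennreal ((A + 0) * (B + 0))) sequentially"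
    by (intro tendsto_intros tendsto_ennrealI LIMSEQ_Suc[OF lim_1_over_n])
  then have "?I \<le> ennreal ((A + 0) * (B + 0))"
    by (rule tendsto_lowerbound) (auto intro!: * always_eventually)
  then show ?thesis using A B by (simp add: ennreal_mult)
qed

lemma powr_convex_nonneg:
  fixes x y :: real
  assumes "1 \<le> p" "0 \<le> l" "l \<le> 1" "0 \<le> x" "0 \<le> y"
  shows "((1 - l) * x + l * y) powr p \<le> (1 - l) * x powr p + l * y powr p"
proof -
  have scale: "(c * z) powr p \<le> c * z powr p" if "0 \<le> c" "c \<le> 1" "0 \<le> z" for c z :: real
  proof -
    have "c powr p \<le> c powr 1" using that assms using powr_mono'[of 1 p c] by (cases "c = 0") auto
    then show ?thesis using that by (auto simp: powr_mult intro!: mult_right_mono)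
  qed
  show ?thesis
  proof (cases "x = 0 \<or> y = 0")
    \<comment> \<open>Convexity is applied only between positive points. At an endpoint 0 the claim
      reduces to \<open>c powr p <= c\<close> for \<open>c\<close> in [0,1].\<close>
    case True
    then show ?thesis using scale[of l y] scale[of "1 - l" x] assms by auto
  next
    case False
    have "((1 - l) *\<^sub>R x + l *\<^sub>R y) powr p \<le> (1 - l) * x powr p + l * y powr p"
      using assms False by (intro convex_onD[OF powr_convex]) auto
    then show ?thesis by simp
  qed
qed

text \<open>The left argument is the convex combination of \<open>x / a\<close> and
  \<open>y / b\<close> with weights \<open>a / (a + b)\<close> and \<open>b / (a + b)\<close>, the
  form in which Minkowski's inequality uses convexity.\<close>

lemma ennpow_convex:
  assumes "1 < p" "0 < a" "0 < b"
  shows "ennpow (ennreal (1 / (a + b)) * (x + y)) p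
    \<le> ennreal (a / (a + b)) * ennpow (ennreal (1 / a) * x) p
     + ennreal (b / (a + b)) * ennpow (ennreal (1 / b) * y) p"
proof (cases "x = top \<or> y = top")
  case True
  have "ennreal (a / (a + b)) \<noteq> 0" "ennreal (b / (a + b)) \<noteq> 0" "ennreal (1 / a) \<noteq> 0" "ennreal (1 / b) \<noteq> 0"
    using assms by (auto simp: ennreal_eq_0_iff not_le)
  then show ?thesis using True by (auto simp: ennreal_mult_top)
next
  case False
  then obtain s t where st [simp]: "x = ennreal s" "0 \<le> s" "y = ennreal t" "0 \<le> t"
    by (cases x; cases y) auto
  have "((1 - b / (a + b)) * (s / a) + (b / (a + b)) * (t / b)) powr p \<le>
     (1 - b / (a + b)) * ((s / a) powr p) + (b / (a + b)) * ((t / b) powr p)"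
    using assms by (intro powr_convex_nonneg) auto
  moreover have "1 - b / (a + b) = a / (a + b)" using assms by (simp add: field_simps)
  moreover have "(a / (a + b)) * (s / a) + (b / (a + b)) * (t / b) = (s + t) / (a + b)"
    using assms by (simp add: add_divide_distrib)
  ultimately show ?thesis using assms
    by (simp add: ennpow_ennreal ennreal_mult[symmetric] ennreal_plus[symmetric] del: ennreal_plus)
qed

text \<open>After rescaling by slightly enlarged norms both functions have p-th power integral at
  most 1, and by convexity so has the rescaled sum. Each norm receives half of the slack
  \<open>e\<close>.\<close>

lemma Minkowski_pnorm:
  assumes [measurable]: "\<phi> \<in> borel_measurable M" "\<psi> \<in> borel_measurable M" and p: "1 < p"
  shows "pnorm M p (\<lambda>x. \<phi> x + \<psi> x) \<le> pnorm M p \<phi> + pnorm M p \<psi>"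
proof (cases "pnorm M p \<phi> = top \<or> pnorm M p \<psi> = top")
  case True then show ?thesis by auto
next
  case False
  then obtain A B where A: "pnorm M p \<phi> = ennreal A" "0 \<le> A" and B: "pnorm M p \<psi> = ennreal B" "0 \<le> B"
    by (cases "pnorm M p \<phi>"; cases "pnorm M p \<psi>") auto
  show ?thesis
  proof (rule ennreal_le_epsilon)
    fix e :: real assume e: "0 < e"
    let ?a = "A + e / 2" and ?b = "B + e / 2"
    have ab: "0 < ?a" "0 < ?b" using A B e by auto
    have "(\<integral>\<^sup>+ x. ennpow (ennreal (1 / (?a + ?b)) * (\<phi> x + \<psi> x)) p \<partial>M)
      \<le> (\<integral>\<^sup>+ x. ennreal (?a / (?a + ?b)) * ennpow (ennreal (1 / ?a) * \<phi> x) p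
         + ennreal (?b / (?a + ?b)) * ennpow (ennreal (1 / ?b) * \<psi> x) p \<partial>M)"
      by (intro nn_integral_mono ennpow_convex p ab)
    also have "\<dots> = ennreal (?a / (?a + ?b)) * (\<integral>\<^sup>+ x. ennpow (ennreal (1 / ?a) * \<phi> x) p \<partial>M)
         + ennreal (?b / (?a + ?b)) * (\<integral>\<^sup>+ x. ennpow (ennreal (1 / ?b) * \<psi> x) p \<partial>M)"
      by (simp add: nn_integral_add nn_integral_cmult)
    also have "\<dots> \<le> ennreal (?a / (?a + ?b)) * 1 + ennreal (?b / (?a + ?b)) * 1"
      using p ab A B e by (intro add_mono mult_left_mono nn_integral_scaled_ennpow_le_1)
        (auto intro!: ennreal_leI)
    also have "\<dots> = ennreal (?a / (?a + ?b) + ?b / (?a + ?b))" using ab by (subst ennreal_plus) auto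
    also have "\<dots> = 1" using ab by (simp add: add_divide_distrib[symmetric])
    finally have "pnorm M p (\<lambda>x. ennreal (1 / (?a + ?b)) * (\<phi> x + \<psi> x)) \<le> 1"
      using p by (simp add: pnorm_le_iff)
    then have le: "ennreal (1 / (?a + ?b)) * pnorm M p (\<lambda>x. \<phi> x + \<psi> x) \<le> 1"
      using p by (simp add: pnorm_cmult)
    have "pnorm M p (\<lambda>x. \<phi> x + \<psi> x) = ennreal (?a + ?b) * (ennreal (1 / (?a + ?b)) * pnorm M p (\<lambda>x. \<phi> x + \<psi> x))"
      using ab by (simp add: mult.assoc[symmetric] ennreal_mult[symmetric] del: ennreal_plus)
    also have "\<dots> \<le> ennreal (?a + ?b) * 1" by (intro mult_left_mono le) auto
    also have "\<dots> = pnorm M p \<phi> + pnorm M p \<psi> + ennreal e"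
      using A B e by (simp add: ennreal_plus[symmetric] del: ennreal_plus)
    finally show "pnorm M p (\<lambda>x. \<phi> x + \<psi> x) \<le> pnorm M p \<phi> + pnorm M p \<psi> + ennreal e" .
  qed
qed

section \<open>Fatou and dominated convergence for \<open>pnorm\<close>\<close>

lemma Fatou_pnorm:
  fixes f :: "nat \<Rightarrow> 'a \<Rightarrow> real"
  assumes [measurable]: "\<And>n. f n \<in> borel_measurable M" and p: "0 < p"
    and lim: "\<And>x. x \<in> space M \<Longrightarrow> (\<lambda>n. f n x) \<longlonglongrightarrow> g x"
    and nn: "\<And>n x. 0 \<le> f n x"
    and le: "\<And>n. pnorm M p (\<lambda>x. ennreal (f n x)) \<le> B"
  shows "pnorm M p (\<lambda>x. ennreal (g x)) \<le> B"
proof -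
  have "(\<integral>\<^sup>+ x. ennpow (ennreal (g x)) p \<partial>M) = (\<integral>\<^sup>+ x. liminf (\<lambda>n. ennreal (f n x powr p)) \<partial>M)"
  proof (rule nn_integral_cong)
    fix x assume x: "x \<in> space M"
    have g: "0 \<le> g x" using LIMSEQ_le_const[OF lim[OF x]] nn by blast
    have "(\<lambda>n. ennreal (f n x powr p)) \<longlonglongrightarrow> ennreal (g x powr p)"
      using p nn by (intro tendsto_ennrealI tendsto_powr' lim x tendsto_const) auto
    then have "liminf (\<lambda>n. ennreal (f n x powr p)) = ennreal (g x powr p)"
      by (intro lim_imp_Liminf) auto
    then show "ennpow (ennreal (g x)) p = liminf (\<lambda>n. ennreal (f n x powr p))"
      using g by (simp add: ennpow_ennreal)
  qed
  also have "\<dots> \<le> liminf (\<lambda>n. \<integral>\<^sup>+ x. ennreal (f n x powr p) \<partial>M)"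
    by (rule nn_integral_liminf) measurable
  also have "\<dots> \<le> ennpow B p"
  proof -
    have "(\<integral>\<^sup>+ x. ennreal (f n x powr p) \<partial>M) \<le> ennpow B p" for n
      using le[of n] p nn by (simp add: pnorm_le_iff ennpow_ennreal)
    then show ?thesis by (intro Liminf_le) (auto intro: always_eventually)
  qed
  finally show ?thesis using p by (simp add: pnorm_le_iff)
qed

lemma dominated_pnorm_tendsto_0:
  fixes f :: "nat \<Rightarrow> 'a \<Rightarrow> real"
  assumes [measurable]: "\<And>n. f n \<in> borel_measurable M" "g \<in> borel_measurable M" and p: "0 < p"
    and lim: "\<And>x. x \<in> space M \<Longrightarrow> (\<lambda>n. f n x) \<longlonglongrightarrow> 0"
    and nn: "\<And>n x. 0 \<le> f n x"
    and dom: "\<And>n x. x \<in> space M \<Longrightarrow> f n x \<le> g x"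
    and fin: "pnorm M p (\<lambda>x. ennreal (g x)) < \<infinity>"
  shows "(\<lambda>n. pnorm M p (\<lambda>x. ennreal (f n x))) \<longlonglongrightarrow> 0"
proof -
  have "(\<lambda>n. \<integral>\<^sup>+ x. ennreal (f n x powr p) \<partial>M) \<longlonglongrightarrow> (\<integral>\<^sup>+ x. ennreal 0 \<partial>M)"
  proof (rule nn_integral_dominated_convergence[where w = "\<lambda>x. ennpow (ennreal (g x)) p"])
    show "(\<integral>\<^sup>+ x. ennpow (ennreal (g x)) p \<partial>M) < \<infinity>" using fin by (subst pnorm_less_top_iff[OF p, symmetric])
    show "AE x in M. ennreal (f n x powr p) \<le> ennpow (ennreal (g x)) p" for n
    proof (rule AE_I2)
      fix x assume x: "x \<in> space M"
      have "ennpow (ennreal (f n x)) p \<le> ennpow (ennreal (g x)) p"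
        using p dom[OF x] by (intro ennpow_mono ennreal_leI) auto
      then show "ennreal (f n x powr p) \<le> ennpow (ennreal (g x)) p" using nn by (simp add: ennpow_ennreal)
    qed
    show "AE x in M. (\<lambda>n. ennreal (f n x powr p)) \<longlonglongrightarrow> ennreal 0"
    proof (rule AE_I2)
      fix x assume x: "x \<in> space M"
      have "(\<lambda>n. f n x powr p) \<longlonglongrightarrow> 0 powr p"
        using p nn by (intro tendsto_powr' lim x tendsto_const) auto
      then show "(\<lambda>n. ennreal (f n x powr p)) \<longlonglongrightarrow> ennreal 0"
        by (intro tendsto_ennrealI) simp
    qed
  qed auto
  then have *: "(\<lambda>n. \<integral>\<^sup>+ x. ennpow (ennreal (f n x)) p \<partial>M) \<longlonglongrightarrow> 0"
    using nn by (simp add: ennpow_ennreal)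
  \<comment> \<open>The outer root is removed by comparison with \<open>ennpow a p\<close>, which
    uses only that powers are monotone.\<close>
  show ?thesis
  proof (rule order_tendstoI)
    fix a :: ennreal assume a: "0 < a"
    then have "0 < ennpow a p" by (simp add: zero_less_iff_neq_zero)
    from order_tendstoD(2)[OF * this]
    show "\<forall>\<^sub>F n in sequentially. pnorm M p (\<lambda>x. ennreal (f n x)) < a"
    proof eventually_elim
      case (elim n)
      then have "\<not> ennpow a p \<le> ennpow (pnorm M p (\<lambda>x. ennreal (f n x))) p" using p by (simp add: pnorm_power not_le)
      then show ?case using p by (simp add: ennpow_le_cancel not_le)
    qed
  qed auto
qed

lemma ennpow_add: "ennpow a s * ennpow a t = ennpow a (s + t)"
  by (cases a) (auto simp: ennpow_ennreal ennreal_mult[symmetric] powr_add)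

text \<open>Because (a b)^(q/2) is at most max(a, b)^q. In Young's inequality it bounds a mixed term
  by separate integrals of the two factors.\<close>

lemma ennpow_mult_half_le: "0 < q \<Longrightarrow> ennpow (a * b) (q / 2) \<le> ennpow a q + ennpow b q"
proof -
  assume q: "0 < q"
  have *: "ennpow (a * b) (q / 2) \<le> ennpow b q" if "a \<le> b" for a b
  proof -
    have "ennpow (a * b) (q / 2) \<le> ennpow (b * b) (q / 2)"
      using q that by (intro ennpow_mono mult_right_mono) auto
    also have "\<dots> = ennpow b q" by (simp add: ennpow_mult ennpow_add)
    finally show ?thesis .
  qed
  show ?thesis
    using *[of a b] *[of b a] by (cases "a \<le> b") (auto simp: mult.commute add_increasing add_increasing2)
qed

lemma Lnorm_eq_pnorm: "(\<And>x. 0 \<le> v x) \<Longrightarrow> Lnorm \<mu> p v f = pnorm \<mu> p (\<lambda>x. ennreal (v x * cmod (f x)))"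
  by (simp add: Lnorm_def wnorm_eq_pnorm ennreal_mult)

text \<open>If the cap is active, \<open>b <= c * x = c * y + c * (x - y)\<close>, and
  \<open>c * y\<close> lies below the cap. It separates a part with a fixed majorant from an
  excess.\<close>

lemma min_add_excess:
  fixes a b c x y :: real
  assumes "b \<le> c * x" "y \<le> x" "0 \<le> y" "0 \<le> c"
  shows "b \<le> min b (2 * c * y) + c * (x - y)"
proof -
  have "0 \<le> c * y" "c * y \<le> c * x" using assms by (auto intro: mult_left_mono)
  moreover have "min b (2 * c * y) = b \<or> min b (2 * c * y) = 2 * (c * y)"
    by (auto simp: min_def)
  ultimately show ?thesis using assms(1) unfolding right_diff_distrib by linarith
qed

section \<open>Haar measure, convolution and translation\<close>

locale haar_group =
  fixes \<mu> :: "'g::{group_add,t2_space,second_countable_topology} measure"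
  assumes lcsc: "lcsc_group TYPE('g)" and haar: "haar_measure \<mu>"
begin

lemma space_haar [simp]: "space \<mu> = UNIV"
  using haar by (simp add: haar_measure_def)

lemma sets_haar [measurable_cong, simp]: "sets \<mu> = sets borel"
  using haar by (simp add: haar_measure_def)

lemma measurable_haar: "measurable \<mu> N = measurable borel N"
  by (rule measurable_cong_sets) auto

lemma continuous_group_add:
  fixes f g :: "'a::topological_space \<Rightarrow> 'g"
  assumes "continuous_on S f" "continuous_on S g"
  shows "continuous_on S (\<lambda>x. f x + g x)"
proof -
  have "continuous_on UNIV (\<lambda>p::'g \<times> 'g. fst p + snd p)" using lcsc by (simp add: lcsc_group_def)
  from continuous_on_compose2[OF this continuous_on_Pair[OF assms]] show ?thesis by simp
qed

lemma continuous_group_minus: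
  fixes f :: "'a::topological_space \<Rightarrow> 'g"
  assumes "continuous_on S f"
  shows "continuous_on S (\<lambda>x. - f x)"
proof -
  have "continuous_on UNIV (uminus :: 'g \<Rightarrow> 'g)" using lcsc by (simp add: lcsc_group_def)
  from continuous_on_compose2[OF this assms] show ?thesis by simp
qed

lemma measurable_group_add [measurable]:
  fixes f g :: "'a \<Rightarrow> 'g"
  assumes "f \<in> borel_measurable M" "g \<in> borel_measurable M"
  shows "(\<lambda>x. f x + g x) \<in> borel_measurable M"
  by (rule borel_measurable_continuous_Pair[OF assms])
     (intro continuous_group_add continuous_on_fst continuous_on_snd continuous_on_id)

lemma measurable_group_minus [measurable]:
  fixes f :: "'a \<Rightarrow> 'g"
  assumes "f \<in> borel_measurable M"
  shows "(\<lambda>x. - f x) \<in> borel_measurable M"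
  using assms by (rule measurable_compose)
    (intro borel_measurable_continuous_onI continuous_group_minus continuous_on_id)

section \<open>Left invariance at the level of integrals\<close>

lemma distr_translate: "distr \<mu> \<mu> (\<lambda>y. a + y) = \<mu>"
proof (rule measure_eqI)
  fix A assume "A \<in> sets (distr \<mu> \<mu> (\<lambda>y. a + y))"
  then have A: "A \<in> sets borel" by simp
  have "(\<lambda>y. a + y) -` A = (\<lambda>y. - a + y) ` A"
    by (force simp: image_iff intro: bexI[of _ "a + _"])
  moreover have "emeasure \<mu> ((\<lambda>y. - a + y) ` A) = emeasure \<mu> A"
    using haar A by (simp add: haar_measure_def)
  ultimately show "emeasure (distr \<mu> \<mu> (\<lambda>y. a + y)) A = emeasure \<mu> A"
    using A by (subst emeasure_distr) (auto simp: measurable_haar)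
qed simp

lemma nn_integral_translate:
  assumes "f \<in> borel_measurable borel"
  shows "(\<integral>\<^sup>+ y. f (a + y) \<partial>\<mu>) = (\<integral>\<^sup>+ y. f y \<partial>\<mu>)"
  using nn_integral_distr[of "\<lambda>y. a + y" \<mu> \<mu> f] assms
  by (simp add: distr_translate measurable_haar)

lemma integrable_translate:
  fixes f :: "'g \<Rightarrow> 'b::{banach,second_countable_topology}"
  assumes "f \<in> borel_measurable borel"
  shows "integrable \<mu> (\<lambda>y. f (a + y)) \<longleftrightarrow> integrable \<mu> f"
  using integrable_distr_eq[of "\<lambda>y. a + y" \<mu> \<mu> f] assms
  by (simp add: distr_translate measurable_haar)

lemma integral_translate:
  fixes f :: "'g \<Rightarrow> 'b::{banach,second_countable_topology}"
  assumes "f \<in> borel_measurable borel"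
  shows "(\<integral> y. f (a + y) \<partial>\<mu>) = (\<integral> y. f y \<partial>\<mu>)"
  using integral_distr[of "\<lambda>y. a + y" \<mu> \<mu> f] assms
  by (simp add: distr_translate measurable_haar)

lemma pnorm_translate:
  assumes [measurable]: "\<phi> \<in> borel_measurable borel"
  shows "pnorm \<mu> p (\<lambda>z. \<phi> (a + z)) = pnorm \<mu> p \<phi>"
  unfolding pnorm_def
  by (subst nn_integral_translate[of "\<lambda>z. ennpow (\<phi> z) p"]) auto

lemma emeasure_compact_finite: "compact B \<Longrightarrow> emeasure \<mu> B < \<infinity>"
  using haar by (simp add: haar_measure_def)

text \<open>Lindelof reduces the cover by interiors of compact neighbourhoods to a countable one,
  and finite unions make it increasing. It gives sigma-finiteness here and the truncated integrals
  later.\<close>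

lemma compact_exhaustion:
  obtains B :: "nat \<Rightarrow> 'g set" where "\<And>n. compact (B n)" "incseq B" "(\<Union>n. B n) = UNIV"
proof -
  have "\<forall>x::'g. \<exists>K. compact K \<and> x \<in> interior K" using lcsc by (simp add: lcsc_group_def)
  then obtain N :: "'g \<Rightarrow> 'g set" where N: "\<And>x. compact (N x)" "\<And>x. x \<in> interior (N x)" by metis
  obtain D where D: "D \<subseteq> range (\<lambda>x. interior (N x))" "countable D" "\<Union>D = \<Union>(range (\<lambda>x. interior (N x)))"
    using Lindelof[of "range (\<lambda>x. interior (N x))"] by auto
  have U: "\<Union>D = UNIV" using D(3) N(2) by auto
  then have "D \<noteq> {}" by auto
  have "\<forall>d\<in>D. \<exists>K. compact K \<and> d \<subseteq> K"
  proof
    fix d assume "d \<in> D"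
    then obtain x where "d = interior (N x)" using D(1) by blast
    then show "\<exists>K. compact K \<and> d \<subseteq> K" using N(1) interior_subset by blast
  qed
  then obtain k where k: "\<And>d. d \<in> D \<Longrightarrow> compact (k d)" "\<And>d. d \<in> D \<Longrightarrow> d \<subseteq> k d" by metis
  define B where "B n = (\<Union>i\<le>n. k (from_nat_into D i))" for n
  show ?thesis
  proof
    show "compact (B n)" for n
      unfolding B_def using k from_nat_into[OF \<open>D \<noteq> {}\<close>] by (intro compact_UN) auto
    show "incseq B" unfolding B_def by (intro monoI UN_mono) auto
    show "(\<Union>n. B n) = UNIV"
    proof (intro set_eqI iffI UNIV_I)
      fix x :: 'g
      obtain d where d: "d \<in> D" "x \<in> d" using U UNIV_I[of x] by blast
      then obtain i where "from_nat_into D i = d" using from_nat_into_surj[OF D(2)] by metis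
      then show "x \<in> (\<Union>n. B n)" using k(2)[OF d(1)] d(2) by (auto simp: B_def)
    qed
  qed
qed

sublocale sigma_finite_measure \<mu>
proof
  obtain B :: "nat \<Rightarrow> 'g set" where B: "\<And>n. compact (B n)" "incseq B" "(\<Union>n. B n) = UNIV"
    using compact_exhaustion by blast
  show "\<exists>A. countable A \<and> A \<subseteq> sets \<mu> \<and> \<Union>A = space \<mu> \<and> (\<forall>a\<in>A. emeasure \<mu> a \<noteq> \<infinity>)"
    using B emeasure_compact_finite by (intro exI[of _ "range B"]) (auto simp: borel_compact less_top)
qed

sublocale pair_sigma_finite \<mu> \<mu> ..

text \<open>Hoelder is applied to the splitting of \<open>h y * k (- y + z)\<close> into its powers
  \<open>q / p\<close> and \<open>1 - q / p\<close>. The first factor is integrated over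
  \<open>z\<close> by Tonelli; the second is bounded uniformly in \<open>z\<close>. There
  \<open>sym\<close> turns \<open>k (- y + z)\<close> into the left translate
  \<open>k (- z + y)\<close>, where a modular function would otherwise appear.\<close>

lemma Young_convolution:
  fixes h k :: "'g \<Rightarrow> ennreal"
  assumes [measurable]: "h \<in> borel_measurable borel" "k \<in> borel_measurable borel"
    and sym: "\<And>x. k (- x) = k x"
    and p: "1 < p" and q: "q = 2 * p / (p + 1)"
    and fin: "pnorm \<mu> q h < \<infinity>" "pnorm \<mu> q k < \<infinity>"
  shows "pnorm \<mu> p (\<lambda>z. \<integral>\<^sup>+ y. h y * k (- y + z) \<partial>\<mu>) < \<infinity>"
proof -
  have q1: "1 < q" using p by (auto simp: q field_simps)
  define p' where "p' = p / (p - 1)"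
  have pp': "1 < p'" "1 / p + 1 / p' = 1" using p by (auto simp: p'_def field_simps)
  \<comment> \<open>With the common exponent \<open>q\<close> the second Hoelder factor carries
    exactly the power \<open>q / 2\<close>, to which \<open>ennpow_mult_half_le\<close>
    applies.\<close>
  have e1: "(1 - q / p) * p' = q / 2"
  proof -
    have "q / p = 2 / (p + 1)" using p by (simp add: q)
    then have "1 - q / p = (p - 1) / (p + 1)" using p by (simp add: field_simps)
    then have "(1 - q / p) * p' = p / (p + 1)" using p by (simp add: p'_def)
    also have "\<dots> = q / 2" using p by (simp add: q field_simps)
    finally show ?thesis .
  qed
  define Ih where "Ih = (\<integral>\<^sup>+ y. ennpow (h y) q \<partial>\<mu>)"
  define Ik where "Ik = (\<integral>\<^sup>+ y. ennpow (k y) q \<partial>\<mu>)"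
  have Ifin: "Ih < \<infinity>" "Ik < \<infinity>"
    using fin pnorm_less_top_iff[of q \<mu>] q1 by (auto simp: Ih_def Ik_def)
  \<comment> \<open>The summand 1 keeps \<open>c\<close> nonzero, so that the bound below is
    infinite, as it should be, where \<open>F z = top\<close>.\<close>
  define c where "c = ennpow (Ih + Ik + 1) (1 / p')"
  have c0: "c \<noteq> 0" by (simp add: c_def)
  have cfin: "c < \<infinity>" using Ifin by (simp add: c_def less_top[symmetric])
  define F where "F z = (\<integral>\<^sup>+ y. ennpow (h y * k (- y + z)) q \<partial>\<mu>)" for z
  have [measurable]: "F \<in> borel_measurable borel"
    unfolding F_def measurable_haar[symmetric] by measurable
  have "pnorm \<mu> p' (\<lambda>y. ennpow (h y * k (- y + z)) (1 - q / p)) \<le> c" for z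
  proof -
    have "(\<integral>\<^sup>+ y. ennpow (h y * k (- y + z)) (q / 2) \<partial>\<mu>)
      \<le> (\<integral>\<^sup>+ y. ennpow (h y) q + ennpow (k (- z + y)) q \<partial>\<mu>)"
    proof (rule nn_integral_mono)
      fix y
      have "k (- y + z) = k (- z + y)" using sym[of "- z + y"] by (simp add: minus_add)
      then show "ennpow (h y * k (- y + z)) (q / 2) \<le> ennpow (h y) q + ennpow (k (- z + y)) q"
        using ennpow_mult_half_le[of q "h y" "k (- z + y)"] q1 by simp
    qed
    also have "\<dots> = Ih + Ik"
      unfolding Ih_def Ik_def
      by (subst nn_integral_add) (auto simp: nn_integral_translate[of "\<lambda>y. ennpow (k y) q"])
    also have "\<dots> \<le> ennpow c p'"
      using pp' by (simp add: c_def ennpow_ennpow)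
    finally show ?thesis
      using pp' by (simp add: pnorm_le_iff ennpow_ennpow e1)
  qed note c_bound = this
  have pt: "ennpow (\<integral>\<^sup>+ y. h y * k (- y + z) \<partial>\<mu>) p \<le> F z * ennpow c p" for z
  proof (cases "F z = top")
    case True
    then show ?thesis using c0 by (simp add: ennreal_top_mult)
  next
    case False
    have pF: "pnorm \<mu> p (\<lambda>y. ennpow (h y * k (- y + z)) (q / p)) = ennpow (F z) (1 / p)"
      using p by (simp add: pnorm_def ennpow_ennpow F_def)
    have "(\<integral>\<^sup>+ y. h y * k (- y + z) \<partial>\<mu>)
      = (\<integral>\<^sup>+ y. ennpow (h y * k (- y + z)) (q / p) * ennpow (h y * k (- y + z)) (1 - q / p) \<partial>\<mu>)"
      by (simp add: ennpow_add)
    also have "\<dots> \<le> pnorm \<mu> p (\<lambda>y. ennpow (h y * k (- y + z)) (q / p))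
        * pnorm \<mu> p' (\<lambda>y. ennpow (h y * k (- y + z)) (1 - q / p))"
    proof (rule Holder_pnorm)
      show "pnorm \<mu> p (\<lambda>y. ennpow (h y * k (- y + z)) (q / p)) < \<infinity>"
        using False unfolding pF by (simp add: less_top[symmetric])
      show "pnorm \<mu> p' (\<lambda>y. ennpow (h y * k (- y + z)) (1 - q / p)) < \<infinity>"
        using c_bound[of z] cfin by (rule le_less_trans)
    qed (use p pp' in auto)
    also have "\<dots> \<le> ennpow (F z) (1 / p) * c"
      unfolding pF by (intro mult_left_mono c_bound) auto
    finally have "ennpow (\<integral>\<^sup>+ y. h y * k (- y + z) \<partial>\<mu>) p \<le> ennpow (ennpow (F z) (1 / p) * c) p"
      using p by (intro ennpow_mono) auto
    then show ?thesis using p by (simp add: ennpow_mult ennpow_ennpow)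
  qed
  have "(\<integral>\<^sup>+ z. F z \<partial>\<mu>) = (\<integral>\<^sup>+ y. (\<integral>\<^sup>+ z. ennpow (h y) q * ennpow (k (- y + z)) q \<partial>\<mu>) \<partial>\<mu>)"
    unfolding F_def ennpow_mult by (rule Fubini') measurable
  also have "\<dots> = (\<integral>\<^sup>+ y. ennpow (h y) q * Ik \<partial>\<mu>)"
    by (simp add: nn_integral_cmult nn_integral_translate[of "\<lambda>y. ennpow (k y) q"] Ik_def)
  also have "\<dots> = Ih * Ik" by (simp add: nn_integral_multc Ih_def)
  finally have IF: "(\<integral>\<^sup>+ z. F z \<partial>\<mu>) = Ih * Ik" .
  have "(\<integral>\<^sup>+ z. ennpow (\<integral>\<^sup>+ y. h y * k (- y + z) \<partial>\<mu>) p \<partial>\<mu>) \<le> (\<integral>\<^sup>+ z. F z * ennpow c p \<partial>\<mu>)"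
    by (intro nn_integral_mono pt)
  also have "\<dots> = Ih * Ik * ennpow c p" by (simp add: nn_integral_multc IF)
  also have "\<dots> < \<infinity>" using Ifin cfin by (simp add: less_top[symmetric] ennreal_mult_eq_top_iff)
  finally show ?thesis using p by (subst pnorm_less_top_iff) auto
qed

end

locale weighted_haar_group = haar_group \<mu> for \<mu> :: "'g::{group_add,t2_space,second_countable_topology} measure" +
  fixes w :: "'g \<Rightarrow> real"
  assumes weight: "weight w"
begin

lemma w_cont: "continuous_on S w" and w_pos: "0 < w x" and w_add: "w (x + y) \<le> w x * w y"
  and w_minus [simp]: "w (- x) = w x"
  using weight by (auto simp: weight_def intro: continuous_on_subset)

lemma w_nonneg [simp]: "0 \<le> w x" using w_pos[of x] by simp

lemma w_measurable [measurable]: "w \<in> borel_measurable borel"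
  by (intro borel_measurable_continuous_onI w_cont)

text \<open>Invariance moves the translation onto the weight, and submultiplicativity splits off
  \<open>w y\<close>. This is what makes \<open>S\<close> invariant under \<pi>.\<close>

lemma pnorm_translate_weight_le:
  assumes [measurable]: "g \<in> borel_measurable borel" and p: "0 < p"
  shows "pnorm \<mu> p (\<lambda>z. ennreal (w z) * g (- y + z)) \<le> ennreal (w y) * pnorm \<mu> p (\<lambda>z. ennreal (w z) * g z)"
proof -
  have "pnorm \<mu> p (\<lambda>z. ennreal (w z) * g (- y + z)) = pnorm \<mu> p (\<lambda>z. ennreal (w (y + z)) * g (- y + (y + z)))"
    by (rule pnorm_translate[symmetric]) measurable
  also have "\<dots> \<le> pnorm \<mu> p (\<lambda>z. ennreal (w y) * (ennreal (w z) * g z))"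
    using p w_add by (intro pnorm_mono) 
      (auto simp: mult.assoc[symmetric] ennreal_mult[symmetric] intro!: mult_right_mono ennreal_leI)
  also have "\<dots> = ennreal (w y) * pnorm \<mu> p (\<lambda>z. ennreal (w z) * g z)"
    using p by (intro pnorm_cmult) (auto simp: measurable_haar)
  finally show ?thesis .
qed

text \<open>The weight is distributed by \<open>w z <= w y * w (- y + z)\<close>. Symmetry of
  \<open>w\<close> keeps the weighted modulus of \<open>k\<close> symmetric, so the unweighted
  inequality applies.\<close>

lemma Young_weighted:
  fixes h k :: "'g \<Rightarrow> complex"
  assumes [measurable]: "h \<in> borel_measurable borel" "k \<in> borel_measurable borel"
    and sym: "\<And>x. cmod (k (- x)) = cmod (k x)"
    and h: "\<And>q. 1 < q \<Longrightarrow> Lnorm \<mu> q w h < \<infinity>" and k: "\<And>q. 1 < q \<Longrightarrow> Lnorm \<mu> q w k < \<infinity>"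
    and p: "1 < p"
  shows "pnorm \<mu> p (\<lambda>z. ennreal (w z) * (\<integral>\<^sup>+ y. ennreal (cmod (h y) * cmod (k (- y + z))) \<partial>\<mu>)) < \<infinity>"
proof -
  have "pnorm \<mu> p (\<lambda>z. ennreal (w z) * (\<integral>\<^sup>+ y. ennreal (cmod (h y) * cmod (k (- y + z))) \<partial>\<mu>))
    \<le> pnorm \<mu> p (\<lambda>z. \<integral>\<^sup>+ y. ennreal (w y * cmod (h y)) * ennreal (w (- y + z) * cmod (k (- y + z))) \<partial>\<mu>)"
  proof (rule pnorm_mono)
    fix z
    have "ennreal (w z) * (\<integral>\<^sup>+ y. ennreal (cmod (h y) * cmod (k (- y + z))) \<partial>\<mu>)
       = (\<integral>\<^sup>+ y. ennreal (w z * (cmod (h y) * cmod (k (- y + z)))) \<partial>\<mu>)"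
      by (subst nn_integral_cmult[symmetric]) (auto simp: ennreal_mult[symmetric] measurable_haar)
    also have "\<dots> \<le> (\<integral>\<^sup>+ y. ennreal (w y * cmod (h y)) * ennreal (w (- y + z) * cmod (k (- y + z))) \<partial>\<mu>)"
    proof (rule nn_integral_mono)
      fix y
      have "w z \<le> w y * w (- y + z)" using w_add[of y "- y + z"] by simp
      then have "w z * (cmod (h y) * cmod (k (- y + z))) \<le> (w y * w (- y + z)) * (cmod (h y) * cmod (k (- y + z)))"
        by (intro mult_right_mono) auto
      then show "ennreal (w z * (cmod (h y) * cmod (k (- y + z))))
        \<le> ennreal (w y * cmod (h y)) * ennreal (w (- y + z) * cmod (k (- y + z)))"
        by (simp add: ennreal_mult[symmetric] ennreal_leI mult_ac)
    qed
    finally show "ennreal (w z) * (\<integral>\<^sup>+ y. ennreal (cmod (h y) * cmod (k (- y + z))) \<partial>\<mu>) \<le> \<dots>" .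
  qed (use p in simp)
  also have "\<dots> < \<infinity>"
  proof (rule Young_convolution[OF _ _ _ p refl])
    have "1 < 2 * p / (p + 1)" using p by (simp add: field_simps)
    then show "pnorm \<mu> (2 * p / (p + 1)) (\<lambda>y. ennreal (w y * cmod (h y))) < \<infinity>"
      "pnorm \<mu> (2 * p / (p + 1)) (\<lambda>y. ennreal (w y * cmod (k y))) < \<infinity>"
      using h k by (simp_all add: Lnorm_eq_pnorm)
  qed (auto simp: sym)
  finally show ?thesis .
qed

text \<open>As \<open>k\<close> is continuous, its translates converge pointwise, and their weighted
  norms converge too. A Scheffe argument upgrades this to convergence in norm.\<close>

lemma tendsto_pnorm_translate:
  fixes k :: "'g \<Rightarrow> complex"
  assumes cont: "continuous_on UNIV k" and p: "1 < p" and fin: "Lnorm \<mu> p w k < \<infinity>"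
  shows "((\<lambda>q. pnorm \<mu> p (\<lambda>z. ennreal (w z * cmod (k (- q + z) - k z)))) \<longlongrightarrow> 0) (nhds 0)"
proof -
  have [measurable]: "k \<in> borel_measurable borel" by (intro borel_measurable_continuous_onI cont)
  let ?a = "\<lambda>q z. (w z * cmod (k (- q + z))) powr p"
  let ?b = "\<lambda>q z. (w z * cmod (k (- q + z) - k z)) powr p"
  have a0: "integrable \<mu> (?a 0)"
    using fin p by (intro integrableI_nonneg)
      (auto simp: measurable_haar Lnorm_eq_pnorm ennpow_ennreal pnorm_less_top_iff[unfolded infinity_ennreal_def])
  \<comment> \<open>Dominated convergence works along sequences, and these decide limits at 0 since
    the topology is second countable.\<close>
  have seq: "(\<lambda>n. \<integral>\<^sup>+ z. ennreal (?b (s n) z) \<partial>\<mu>) \<longlonglongrightarrow> 0" if s: "s \<longlonglongrightarrow> 0" for s :: "nat \<Rightarrow> 'g"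
  proof -
    have ws: "(\<lambda>n. w (s n + z)) \<longlonglongrightarrow> w (0 + z)" for z
    proof -
      have "continuous_on UNIV (\<lambda>q. w (q + z))"
        by (rule continuous_on_compose2[OF w_cont[of UNIV]])
          (auto intro!: continuous_group_add continuous_on_id continuous_on_const)
      from continuous_on_tendsto_compose[OF this s] show ?thesis by simp
    qed
    have ks: "(\<lambda>n. k (- s n + z)) \<longlonglongrightarrow> k (- 0 + z)" for z
    proof -
      have "continuous_on UNIV (\<lambda>q. k (- q + z))"
        by (rule continuous_on_compose2[OF cont])
          (auto intro!: continuous_group_add continuous_group_minus continuous_on_id continuous_on_const)
      from continuous_on_tendsto_compose[OF this s] show ?thesis by simp
    qed
    have "(\<lambda>n. w (s n)) \<longlonglongrightarrow> w 0" using ws[of 0] by simp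
    then have "Bseq (\<lambda>n. w (s n))" by (intro convergent_imp_Bseq convergentI)
    then obtain B where B: "0 < B" "\<And>n. w (s n) \<le> B" by (auto simp: Bseq_def)
    \<comment> \<open>Substituting \<open>s n + z\<close> for \<open>z\<close> moves the translation
      from \<open>k\<close> to the weight, where the bound \<open>B\<close> on
      \<open>w (s n)\<close> yields a fixed majorant.\<close>
    let ?c = "\<lambda>n z. (w (s n + z) * cmod (k z)) powr p"
    have a_c: "?a (s n) (s n + z) = ?c n z" for n z by simp
    have c_dom: "norm (?c n z) \<le> B powr p * ?a 0 z" for n z
    proof -
      have "w (s n + z) * cmod (k z) \<le> (B * w z) * cmod (k z)"
        using order_trans[OF w_add[of "s n" z] mult_right_mono[OF B(2)[of n]]] by (intro mult_right_mono) auto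
      then have "?c n z \<le> ((B * w z) * cmod (k z)) powr p" using p by (intro powr_mono2) auto
      then show ?thesis using B by (simp add: powr_mult mult_ac)
    qed
    have c_int: "integrable \<mu> (?c n)" for n
    proof (rule Bochner_Integration.integrable_bound[OF integrable_mult_right[OF a0, of "B powr p"]])
      show "AE z in \<mu>. norm (?c n z) \<le> norm (B powr p * ?a 0 z)"
        by (rule AE_I2, rule order_trans[OF c_dom]) simp
    qed (simp add: measurable_haar)
    have a_int: "integrable \<mu> (?a (s n))" for n
      using integrable_translate[of "?a (s n)" "s n"] c_int[of n] by simp
    have a_eq: "(\<integral>z. ?a (s n) z \<partial>\<mu>) = (\<integral>z. ?c n z \<partial>\<mu>)" for n
      using integral_translate[of "?a (s n)" "s n"] by simp
    have c_lim: "(\<lambda>n. \<integral>z. ?c n z \<partial>\<mu>) \<longlonglongrightarrow> (\<integral>z. ?a 0 z \<partial>\<mu>)"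
    proof (rule integral_dominated_convergence[where w = "\<lambda>z. B powr p * ?a 0 z"])
      show "AE z in \<mu>. (\<lambda>n. ?c n z) \<longlonglongrightarrow> ?a 0 z"
        using p ws by (intro AE_I2 tendsto_powr' tendsto_intros) auto
    qed (use a0 c_dom in \<open>auto simp: measurable_haar\<close>)
    \<comment> \<open>\<open>?a (s n) - ?m n\<close> is the positive part of
      \<open>?a (s n) - ?a 0\<close>. Its integral vanishes in the limit because the integrals of
      both terms tend to that of \<open>?a 0\<close>.\<close>
    let ?m = "\<lambda>n z. min (?a (s n) z) (?a 0 z)"
    have m_lim: "(\<lambda>n. \<integral>z. ?m n z \<partial>\<mu>) \<longlonglongrightarrow> (\<integral>z. min (?a 0 z) (?a 0 z) \<partial>\<mu>)"
    proof (rule integral_dominated_convergence[where w = "?a 0"])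
      show "AE z in \<mu>. (\<lambda>n. ?m n z) \<longlonglongrightarrow> min (?a 0 z) (?a 0 z)"
        using p ks by (intro AE_I2 tendsto_powr' tendsto_min tendsto_intros) auto
    qed (use a0 in \<open>auto simp: measurable_haar\<close>)
    have d_lim: "(\<lambda>n. \<integral>z. ?a (s n) z - ?m n z \<partial>\<mu>) \<longlonglongrightarrow> 0"
    proof -
      have "integrable \<mu> (?m n)" for n using a_int a0 by (rule integrable_min)
      then have "(\<integral>z. ?a (s n) z - ?m n z \<partial>\<mu>) = (\<integral>z. ?c n z \<partial>\<mu>) - (\<integral>z. ?m n z \<partial>\<mu>)" for n
        using a_int by (simp add: a_eq)
      then show ?thesis using tendsto_diff[OF c_lim m_lim] by simp
    qed
    let ?t = "\<lambda>n z. min (?b (s n) z) (2 * 2 powr p * ?a 0 z)"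
    have t_lim: "(\<lambda>n. \<integral>z. ?t n z \<partial>\<mu>) \<longlonglongrightarrow> (\<integral>z. 0 \<partial>\<mu>)"
    proof (rule integral_dominated_convergence[where w = "\<lambda>z. 2 * 2 powr p * ?a 0 z"])
      show "AE z in \<mu>. (\<lambda>n. ?t n z) \<longlonglongrightarrow> 0"
      proof (rule AE_I2)
        fix z
        have "(\<lambda>n. ?b (s n) z) \<longlonglongrightarrow> (w z * cmod (k (- 0 + z) - k z)) powr p"
          using p ks by (intro tendsto_powr' tendsto_intros) auto
        then have "(\<lambda>n. ?t n z) \<longlonglongrightarrow> min ((w z * cmod (k (- 0 + z) - k z)) powr p) (2 * 2 powr p * ?a 0 z)"
          by (rule tendsto_min[OF _ tendsto_const])
        then show "(\<lambda>n. ?t n z) \<longlonglongrightarrow> 0" by (simp add: min_def split: if_splits)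
      qed
    qed (use a0 in \<open>auto simp: measurable_haar\<close>)
    have "(\<lambda>n. (\<integral>z. ?t n z \<partial>\<mu>) + 2 powr p * (\<integral>z. ?a (s n) z - ?m n z \<partial>\<mu>)) \<longlonglongrightarrow> (\<integral>z. 0 \<partial>\<mu>) + 2 powr p * 0"
      by (intro tendsto_intros t_lim d_lim)
    then have lim: "(\<lambda>n. ennreal ((\<integral>z. ?t n z \<partial>\<mu>) + 2 powr p * (\<integral>z. ?a (s n) z - ?m n z \<partial>\<mu>))) \<longlonglongrightarrow> 0"
      by (intro tendsto_eq_rhs[OF tendsto_ennrealI]) auto
    \<comment> \<open>dominated convergence handles the part of \<open>?b\<close> below the fixed majorant;
       the excess is controlled by the positive part of \<open>?a (s n) - ?a 0\<close>\<close>
    have b_le: "?b (s n) z \<le> ?t n z + 2 powr p * (?a (s n) z - ?m n z)" for n z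
    proof -
      let ?x = "w z * cmod (k (- s n + z))" and ?y = "w z * cmod (k z)"
      have "w z * cmod (k (- s n + z) - k z) \<le> w z * (cmod (k (- s n + z)) + cmod (k z))"
        by (intro mult_left_mono norm_triangle_ineq4) simp
      also have "\<dots> \<le> 2 * max ?x ?y" by (simp add: distrib_left max_def)
      finally have "?b (s n) z \<le> (2 * max ?x ?y) powr p" using p by (intro powr_mono2) auto
      also have "\<dots> = 2 powr p * max (?x powr p) (?y powr p)"
      proof -
        have "max ?x ?y powr p = max (?x powr p) (?y powr p)"
        proof (cases "?x \<le> ?y")
          case True
          then have "?x powr p \<le> ?y powr p" using p by (intro powr_mono2) auto
          then show ?thesis using True by (simp only: max_absorb2)
        next
          case False
          then have "?y powr p \<le> ?x powr p" using p by (intro powr_mono2) auto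
          then show ?thesis using False by (simp only: max_absorb1 not_le less_imp_le)
        qed
        moreover have "(2 * max ?x ?y) powr p = 2 powr p * max ?x ?y powr p"
          by (rule powr_mult)
        ultimately show ?thesis by simp
      qed
      finally have 1: "?b (s n) z \<le> 2 powr p * max (?x powr p) (?y powr p)" .
      show ?thesis
      proof (cases "?x powr p \<le> ?y powr p")
        case True
        then have "?b (s n) z \<le> 2 powr p * ?y powr p" using 1 by (simp add: max_def)
        also have "\<dots> \<le> 2 * 2 powr p * ?y powr p" by simp
        finally show ?thesis using True by simp
      next
        case False
        then have "?b (s n) z \<le> 2 powr p * ?x powr p" and "?m n z = ?y powr p"
          using 1 by (simp_all add: max_def)
        moreover have "?b (s n) z \<le> min (?b (s n) z) (2 * 2 powr p * ?y powr p) + 2 powr p * (?x powr p - ?y powr p)"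
          using False calculation(1) by (intro min_add_excess) auto
        ultimately show ?thesis by simp
      qed
    qed
    have "(\<integral>\<^sup>+ z. ennreal (?b (s n) z) \<partial>\<mu>) \<le> ennreal ((\<integral>z. ?t n z \<partial>\<mu>) + 2 powr p * (\<integral>z. ?a (s n) z - ?m n z \<partial>\<mu>))" for n
    proof -
      have i1: "integrable \<mu> (?t n)"
      proof (rule Bochner_Integration.integrable_bound[OF integrable_mult_right[OF a0, of "2 * 2 powr p"]])
        show "AE z in \<mu>. norm (?t n z) \<le> norm (2 * 2 powr p * ?a 0 z)"
        proof (rule AE_I2)
          fix z
          have "0 \<le> ?t n z" by (intro min.boundedI) simp_all
          moreover have "0 \<le> 2 * 2 powr p * ?a 0 z" by simp
          ultimately show "norm (?t n z) \<le> norm (2 * 2 powr p * ?a 0 z)"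
            by (simp only: real_norm_def abs_of_nonneg min.cobounded2)
        qed
      qed (simp add: measurable_haar)
      have i2: "integrable \<mu> (\<lambda>z. ?a (s n) z - ?m n z)"
        using a_int a0 by (intro Bochner_Integration.integrable_diff integrable_min)
      have "(\<integral>\<^sup>+ z. ennreal (?b (s n) z) \<partial>\<mu>) \<le> (\<integral>\<^sup>+ z. ennreal (?t n z + 2 powr p * (?a (s n) z - ?m n z)) \<partial>\<mu>)"
        by (intro nn_integral_mono ennreal_leI b_le)
      also have "\<dots> = ennreal (\<integral>z. ?t n z + 2 powr p * (?a (s n) z - ?m n z) \<partial>\<mu>)"
        using i1 i2 by (intro nn_integral_eq_integral) auto
      finally show ?thesis using i1 i2 by simp
    qed
    then show ?thesis
      by (intro tendsto_sandwich[OF _ _ tendsto_const lim]) auto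
  qed
  have "(\<lambda>n. pnorm \<mu> p (\<lambda>z. ennreal (w z * cmod (k (- s n + z) - k z)))) \<longlonglongrightarrow> 0"
    if s: "s \<longlonglongrightarrow> 0" for s :: "nat \<Rightarrow> 'g"
  proof (rule order_tendstoI)
    fix a :: ennreal assume a: "0 < a"
    then have "0 < ennpow a p" by (simp add: zero_less_iff_neq_zero)
    from order_tendstoD(2)[OF seq[OF s] this]
    show "\<forall>\<^sub>F n in sequentially. pnorm \<mu> p (\<lambda>z. ennreal (w z * cmod (k (- s n + z) - k z))) < a"
    proof eventually_elim
      case (elim n)
      then have "\<not> ennpow a p \<le> ennpow (pnorm \<mu> p (\<lambda>z. ennreal (w z * cmod (k (- s n + z) - k z)))) p"
        using p by (simp add: pnorm_power not_le ennpow_ennreal)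
      then show ?case using p by (simp add: ennpow_le_cancel not_le)
    qed
  qed auto
  then have lim: "\<forall>\<^sub>F n in sequentially. pnorm \<mu> p (\<lambda>z. ennreal (w z * cmod (k (- s n + z) - k z))) < a"
    if "s \<longlonglongrightarrow> 0" "0 < a" for s :: "nat \<Rightarrow> 'g" and a
    using that order_tendstoD(2) by blast
  show ?thesis
  proof (rule order_tendstoI)
    fix a :: ennreal assume "0 < a"
    then have "eventually (\<lambda>q. pnorm \<mu> p (\<lambda>z. ennreal (w z * cmod (k (- q + z) - k z))) < a)
      (inf (nhds 0) (principal UNIV))"
      by (intro sequentially_imp_eventually_nhds_within) (use lim in blast)
    then show "\<forall>\<^sub>F q in nhds 0. pnorm \<mu> p (\<lambda>z. ennreal (w z * cmod (k (- q + z) - k z))) < a"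
      by simp
  qed auto
qed

end

section \<open>Calculus of \<open>Lnorm\<close> and integrals over sets of finite measure\<close>

lemma borel_measurable_cnj [measurable]:
  "f \<in> borel_measurable M \<Longrightarrow> (\<lambda>x. cnj (f x)) \<in> borel_measurable M"
  by (rule measurable_compose[OF _ borel_measurable_continuous_onI[OF continuous_on_cnj[OF continuous_on_id]]])

lemma Lnorm_cmult:
  assumes "0 < p" "f \<in> borel_measurable M" "v \<in> borel_measurable M"
  shows "Lnorm M p v (\<lambda>x. a * f x) = ennreal (cmod a) * Lnorm M p v f"
  using pnorm_cmult[of p "\<lambda>x. ennreal (v x) * ennreal (cmod (f x))" M "ennreal (cmod a)"] assms
  by (simp add: Lnorm_def wnorm_eq_pnorm norm_mult ennreal_mult mult_ac)

lemma Lnorm_add_le: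
  assumes [measurable]: "f \<in> borel_measurable M" "g \<in> borel_measurable M" "v \<in> borel_measurable M"
    and p: "1 < p"
  shows "Lnorm M p v (\<lambda>x. f x + g x) \<le> Lnorm M p v f + Lnorm M p v g"
proof -
  have "Lnorm M p v (\<lambda>x. f x + g x)
    \<le> pnorm M p (\<lambda>x. ennreal (v x) * ennreal (cmod (f x)) + ennreal (v x) * ennreal (cmod (g x)))"
    unfolding Lnorm_def wnorm_eq_pnorm using p
    by (intro pnorm_mono) (auto simp: distrib_left[symmetric] ennreal_plus[symmetric] norm_triangle_ineq
        simp del: ennreal_plus intro!: mult_left_mono ennreal_leI)
  also have "\<dots> \<le> Lnorm M p v f + Lnorm M p v g"
    unfolding Lnorm_def wnorm_eq_pnorm using p by (intro Minkowski_pnorm) auto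
  finally show ?thesis .
qed

lemma Lnorm_minus [simp]: "Lnorm M p v (\<lambda>x. - f x) = Lnorm M p v f"
  by (simp add: Lnorm_def)

lemma Lnorm_diff_le:
  assumes "f \<in> borel_measurable M" "g \<in> borel_measurable M" "v \<in> borel_measurable M" "1 < p"
  shows "Lnorm M p v (\<lambda>x. f x - g x) \<le> Lnorm M p v f + Lnorm M p v g"
  using Lnorm_add_le[of f M "\<lambda>x. - g x" v p] assms by simp

text \<open>Hoelder against the indicator of \<open>B\<close>. The null case is separate: an
  infinite norm would then meet \<open>top * 0 = 0\<close> on the right, so the left side must be
  shown to vanish.\<close>

lemma nn_integral_indicator_le_pnorm:
  assumes [measurable]: "\<phi> \<in> borel_measurable M" "B \<in> sets M" and p: "1 < p"
    and fin: "emeasure M B < \<infinity>"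
  shows "(\<integral>\<^sup>+ x. \<phi> x * indicator B x \<partial>M) \<le> pnorm M p \<phi> * ennpow (emeasure M B) (1 - 1 / p)"
proof (cases "emeasure M B = 0")
  case True
  then have "AE x in M. x \<notin> B" by (intro AE_not_in) (auto simp: null_sets_def)
  then have "(\<integral>\<^sup>+ x. \<phi> x * indicator B x \<partial>M) = (\<integral>\<^sup>+ x. 0 \<partial>M)"
    by (intro nn_integral_cong_AE) auto
  then show ?thesis by simp
next
  case False
  define q where "q = p / (p - 1)"
  have q: "1 < q" "1 / p + 1 / q = 1" "1 / q = 1 - 1 / p" "0 < q" using p by (auto simp: q_def field_simps)
  have B: "pnorm M q (indicator B) = ennpow (emeasure M B) (1 - 1 / p)"
  proof -
    have "ennpow (indicator B x) q = (indicator B x :: ennreal)" for x by (simp add: indicator_def)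
    then show ?thesis by (simp add: pnorm_def q)
  qed
  show ?thesis
  proof (cases "pnorm M p \<phi> = \<infinity>")
    case True
    then show ?thesis using False by (simp add: ennreal_top_mult)
  next
    case fin': False
    have "pnorm M q (indicator B) < \<infinity>" using fin by (simp add: B less_top[symmetric])
    then show ?thesis
      using Holder_pnorm[of \<phi> M "indicator B" p q] fin' p q by (simp add: B less_top)
  qed
qed

context haar_group begin

text \<open>Hoelder on the support \<open>B\<close> bounds the p-th power of the inner integral by
  the integral of p-th powers, and Fubini does the rest. The powers \<open>p - 1\<close> and 1 of
  the measure of \<open>B\<close> combine to \<open>p\<close>.\<close>

lemma Minkowski_integral_bounded_support:
  fixes \<Phi> :: "'g \<Rightarrow> 'g \<Rightarrow> ennreal"
  assumes meas [measurable]: "(\<lambda>(y, z). \<Phi> y z) \<in> borel_measurable (\<mu> \<Otimes>\<^sub>M \<mu>)" "B \<in> sets borel"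
    and p: "1 < p" and fin: "emeasure \<mu> B < \<infinity>"
    and supp: "\<And>y z. y \<notin> B \<Longrightarrow> \<Phi> y z = 0"
    and le: "\<And>y. y \<in> B \<Longrightarrow> pnorm \<mu> p (\<Phi> y) \<le> A"
  shows "pnorm \<mu> p (\<lambda>z. \<integral>\<^sup>+ y. \<Phi> y z \<partial>\<mu>) \<le> emeasure \<mu> B * A"
proof -
  have pt: "ennpow (\<integral>\<^sup>+ y. \<Phi> y z \<partial>\<mu>) p
    \<le> (\<integral>\<^sup>+ y. ennpow (\<Phi> y z) p \<partial>\<mu>) * ennpow (emeasure \<mu> B) (p - 1)" for z
  proof -
    have "(\<integral>\<^sup>+ y. \<Phi> y z \<partial>\<mu>) = (\<integral>\<^sup>+ y. \<Phi> y z * indicator B y \<partial>\<mu>)"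
      by (intro nn_integral_cong) (auto simp: indicator_def supp)
    also have "\<dots> \<le> pnorm \<mu> p (\<lambda>y. \<Phi> y z) * ennpow (emeasure \<mu> B) (1 - 1 / p)"
      using p fin by (intro nn_integral_indicator_le_pnorm) (auto simp: measurable_haar)
    finally have "ennpow (\<integral>\<^sup>+ y. \<Phi> y z \<partial>\<mu>) p \<le> ennpow \<dots> p" using p by (intro ennpow_mono) auto
    also have "\<dots> = (\<integral>\<^sup>+ y. ennpow (\<Phi> y z) p \<partial>\<mu>) * ennpow (emeasure \<mu> B) (p - 1)"
    proof -
      have "(1 - 1 / p) * p = p - 1" using p by (simp add: left_diff_distrib)
      then show ?thesis using p by (simp add: ennpow_mult ennpow_ennpow pnorm_power)
    qed
    finally show ?thesis .
  qed
  have "(\<integral>\<^sup>+ z. ennpow (\<integral>\<^sup>+ y. \<Phi> y z \<partial>\<mu>) p \<partial>\<mu>)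
    \<le> (\<integral>\<^sup>+ z. (\<integral>\<^sup>+ y. ennpow (\<Phi> y z) p \<partial>\<mu>) * ennpow (emeasure \<mu> B) (p - 1) \<partial>\<mu>)"
    by (intro nn_integral_mono pt)
  also have "\<dots> = (\<integral>\<^sup>+ z. (\<integral>\<^sup>+ y. ennpow (\<Phi> y z) p \<partial>\<mu>) \<partial>\<mu>) * ennpow (emeasure \<mu> B) (p - 1)"
    by (rule nn_integral_multc) measurable
  also have "(\<integral>\<^sup>+ z. (\<integral>\<^sup>+ y. ennpow (\<Phi> y z) p \<partial>\<mu>) \<partial>\<mu>) = (\<integral>\<^sup>+ y. (\<integral>\<^sup>+ z. ennpow (\<Phi> y z) p \<partial>\<mu>) \<partial>\<mu>)"
    by (rule Fubini') measurable
  also have "\<dots> \<le> (\<integral>\<^sup>+ y. ennpow A p * indicator B y \<partial>\<mu>)"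
  proof (rule nn_integral_mono)
    fix y
    have "(\<integral>\<^sup>+ z. ennpow (\<Phi> y z) p \<partial>\<mu>) = ennpow (pnorm \<mu> p (\<Phi> y)) p" using p by (simp add: pnorm_power)
    also have "\<dots> \<le> ennpow A p * indicator B y"
    proof (cases "y \<in> B")
      case True then show ?thesis using le p by (simp add: ennpow_mono)
    next
      case False
      then have "\<Phi> y = (\<lambda>z. 0)" by (auto simp: supp)
      then show ?thesis using False by simp
    qed
    finally show "(\<integral>\<^sup>+ z. ennpow (\<Phi> y z) p \<partial>\<mu>) \<le> ennpow A p * indicator B y" .
  qed
  also have "\<dots> = ennpow A p * ennpow (emeasure \<mu> B) 1"
    by (simp add: nn_integral_cmult_indicator)
  finally have "(\<integral>\<^sup>+ z. ennpow (\<integral>\<^sup>+ y. \<Phi> y z \<partial>\<mu>) p \<partial>\<mu>) \<le> ennpow A p * (ennpow (emeasure \<mu> B) 1 * ennpow (emeasure \<mu> B) (p - 1))"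
    by (simp add: mult_right_mono mult.assoc)
  also have "\<dots> = ennpow (emeasure \<mu> B * A) p"
    unfolding ennpow_add by (simp add: ennpow_mult mult.commute)
  finally show ?thesis using p by (subst pnorm_le_iff) auto
qed

end

context weighted_haar_group begin

section \<open>Moderate weights and the pairing of L_{r,m} with L_{r',w}\<close>

lemma moderate_cont: "moderate w m \<Longrightarrow> continuous_on S m"
  by (auto simp: moderate_def intro: continuous_on_subset)

lemma moderate_pos: "moderate w m \<Longrightarrow> 0 < m x"
  by (auto simp: moderate_def)

lemma moderate_add: "moderate w m \<Longrightarrow> m (x + y) \<le> m x * w y"
  by (auto simp: moderate_def)

lemma moderate_measurable: "moderate w m \<Longrightarrow> m \<in> borel_measurable borel"
  by (intro borel_measurable_continuous_onI moderate_cont)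

text \<open>Moderateness at \<open>- y\<close> gives \<open>m 0 <= m y * w y\<close>, which shares
  the weights between the two factors before Hoelder. Keeping \<open>m 0\<close> on the left avoids
  a division in \<open>ennreal\<close>.\<close>

lemma pairing_le:
  assumes [measurable]: "f \<in> borel_measurable borel" "g \<in> borel_measurable borel"
    and m: "moderate w m" and r: "1 < r"
    and f: "Lnorm \<mu> r m f < \<infinity>" and g: "Lnorm \<mu> (r / (r - 1)) w g < \<infinity>"
  shows "ennreal (m 0) * (\<integral>\<^sup>+ y. ennreal (cmod (f y * g y)) \<partial>\<mu>) \<le> Lnorm \<mu> r m f * Lnorm \<mu> (r / (r - 1)) w g"
proof -
  have [measurable]: "m \<in> borel_measurable borel" using m by (rule moderate_measurable)
  have mn: "0 \<le> m x" for x using moderate_pos[OF m, of x] by simp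
  have "ennreal (m 0) * (\<integral>\<^sup>+ y. ennreal (cmod (f y * g y)) \<partial>\<mu>) = (\<integral>\<^sup>+ y. ennreal (m 0 * cmod (f y * g y)) \<partial>\<mu>)"
    using mn by (subst nn_integral_cmult[symmetric]) (auto simp: measurable_haar ennreal_mult)
  also have "\<dots> \<le> (\<integral>\<^sup>+ y. ennreal (m y * cmod (f y)) * ennreal (w y * cmod (g y)) \<partial>\<mu>)"
  proof (rule nn_integral_mono)
    fix y
    have "m 0 \<le> m y * w y" using moderate_add[OF m, of y "- y"] by simp
    then have "m 0 * cmod (f y * g y) \<le> (m y * w y) * cmod (f y * g y)" by (intro mult_right_mono) auto
    then show "ennreal (m 0 * cmod (f y * g y)) \<le> ennreal (m y * cmod (f y)) * ennreal (w y * cmod (g y))"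
      using mn by (simp add: ennreal_mult[symmetric] norm_mult mult_ac ennreal_leI)
  qed
  also have "\<dots> \<le> Lnorm \<mu> r m f * Lnorm \<mu> (r / (r - 1)) w g"
    unfolding Lnorm_eq_pnorm[of m, OF mn] Lnorm_eq_pnorm[of w, OF w_nonneg]
  proof (rule Holder_pnorm)
    show "1 < r / (r - 1)" "1 / r + 1 / (r / (r - 1)) = 1" using r by (auto simp: field_simps)
  qed (use r f g mn in \<open>auto simp: Lnorm_eq_pnorm measurable_haar\<close>)
  finally show ?thesis .
qed

lemma integrable_pairing:
  assumes [measurable]: "f \<in> borel_measurable borel" "g \<in> borel_measurable borel"
    and m: "moderate w m" and r: "1 < r"
    and f: "Lnorm \<mu> r m f < \<infinity>" and g: "Lnorm \<mu> (r / (r - 1)) w g < \<infinity>"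
  shows "integrable \<mu> (\<lambda>y. f y * g y)"
    and "ennreal (m 0 * cmod (\<integral> y. f y * g y \<partial>\<mu>)) \<le> Lnorm \<mu> r m f * Lnorm \<mu> (r / (r - 1)) w g"
proof -
  have m0: "0 < m 0" by (rule moderate_pos[OF m])
  have "Lnorm \<mu> r m f * Lnorm \<mu> (r / (r - 1)) w g < \<infinity>" using f g by (simp add: ennreal_mult_less_top)
  then have "ennreal (m 0) * (\<integral>\<^sup>+ y. ennreal (cmod (f y * g y)) \<partial>\<mu>) < \<infinity>"
    using pairing_le[OF assms] by (rule le_less_trans[rotated])
  then have fin: "(\<integral>\<^sup>+ y. ennreal (cmod (f y * g y)) \<partial>\<mu>) < \<infinity>"
    using m0 by (auto simp: ennreal_mult_less_top)
  then show int: "integrable \<mu> (\<lambda>y. f y * g y)"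
    by (intro integrableI_bounded) (auto simp: measurable_haar)
  have "ennreal (cmod (\<integral> y. f y * g y \<partial>\<mu>)) \<le> (\<integral>\<^sup>+ y. ennreal (cmod (f y * g y)) \<partial>\<mu>)"
    by (rule integral_norm_bound_ennreal[OF int])
  then have "ennreal (m 0 * cmod (\<integral> y. f y * g y \<partial>\<mu>)) \<le> ennreal (m 0) * (\<integral>\<^sup>+ y. ennreal (cmod (f y * g y)) \<partial>\<mu>)"
    using m0 by (simp add: ennreal_mult mult_left_mono)
  then show "ennreal (m 0 * cmod (\<integral> y. f y * g y \<partial>\<mu>)) \<le> Lnorm \<mu> r m f * Lnorm \<mu> (r / (r - 1)) w g"
    using pairing_le[OF assms] by (rule order_trans)
qed

end

section \<open>The voice transform\<close>

locale coorbit = weighted_haar_group \<mu> w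
  for \<mu> :: "'g::{group_add,t2_space,second_countable_topology} measure" and w +
  fixes sc :: "complex \<Rightarrow> 'h::ab_group_add \<Rightarrow> 'h" and ip :: "'h \<Rightarrow> 'h \<Rightarrow> complex"
    and \<pi> :: "'g \<Rightarrow> 'h \<Rightarrow> 'h" and u :: 'h
  assumes hilbert: "hilbert_space sc ip" and rep: "unitary_rep sc ip \<pi>"
    and adm: "admissible \<mu> ip \<pi> u"
    and kernel: "\<forall>p>1. voice ip \<pi> u u \<in> Lspace \<mu> p w"
begin

abbreviation "V \<equiv> voice ip \<pi> u"
abbreviation "K \<equiv> voice ip \<pi> u u"
abbreviation "S \<equiv> Sw \<mu> ip \<pi> u w"

section \<open>Inner product calculus and Cauchy-Schwarz\<close>

lemma ip_add_left: "ip (x + y) z = ip x z + ip y z"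
  by (rule hilbert[unfolded hilbert_space_def, THEN conjunct2, THEN conjunct1, rule_format])

lemma ip_scale_left: "ip (sc a x) y = a * ip x y"
  by (rule hilbert[unfolded hilbert_space_def, THEN conjunct2, THEN conjunct2, THEN conjunct1, rule_format])

lemma ip_cnj: "ip y x = cnj (ip x y)"
  by (rule hilbert[unfolded hilbert_space_def, THEN conjunct2, THEN conjunct2, THEN conjunct2,
        THEN conjunct1, rule_format])

lemma ip_self_Im: "Im (ip x x) = 0" and ip_self_Re: "0 \<le> Re (ip x x)"
  using hilbert[unfolded hilbert_space_def, THEN conjunct2, THEN conjunct2, THEN conjunct2,
      THEN conjunct2, THEN conjunct1, rule_format, of x] by simp_all

lemma ip_self_eq_0: "ip x x = 0 \<Longrightarrow> x = 0"
  by (rule hilbert[unfolded hilbert_space_def, THEN conjunct2, THEN conjunct2, THEN conjunct2,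
        THEN conjunct2, THEN conjunct2, THEN conjunct1, rule_format])

lemma ip_add_right: "ip z (x + y) = ip z x + ip z y"
  by (subst (1 2 3) ip_cnj) (simp add: ip_add_left)

lemma ip_scale_right: "ip y (sc a x) = cnj a * ip y x"
  by (subst (1 2) ip_cnj) (simp add: ip_scale_left)

lemma ip_zero_left [simp]: "ip 0 z = 0"
  using ip_add_left[of 0 0 z] by simp

lemma ip_zero_right [simp]: "ip z 0 = 0"
  using ip_add_right[of z 0 0] by simp

lemma ip_minus_left [simp]: "ip (- x) z = - ip x z"
  using ip_add_left[of x "- x" z] by (simp add: eq_neg_iff_add_eq_0 add.commute)

lemma ip_minus_right [simp]: "ip z (- x) = - ip z x"
  using ip_add_right[of z x "- x"] by (simp add: eq_neg_iff_add_eq_0 add.commute)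

lemma ip_diff_left: "ip (x - y) z = ip x z - ip y z"
  using ip_add_left[of x "- y" z] by simp

lemma ip_diff_right: "ip z (x - y) = ip z x - ip z y"
  using ip_add_right[of z x "- y"] by simp

lemma ip_self: "ip x x = of_real ((hnorm ip x)\<^sup>2)"
  using ip_self_Im[of x] ip_self_Re[of x] by (simp add: hnorm_def complex_eq_iff)

lemma hnorm_nonneg [simp]: "0 \<le> hnorm ip x"
  by (simp add: hnorm_def ip_self_Re)

lemma Cauchy_Schwarz_ip: "cmod (ip x y) \<le> hnorm ip x * hnorm ip y"
proof (cases "ip y y = 0")
  case True
  then have "y = 0" by (rule ip_self_eq_0)
  then show ?thesis by simp
next
  case False
  define N where "N = (hnorm ip y)\<^sup>2"
  have N: "ip y y = of_real N" by (simp add: N_def ip_self)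
  have N0: "N > 0" using False N by (simp add: N_def order_less_le)
  define a where "a = ip x y / of_real N"
  have "ip (x - sc a y) (x - sc a y) = ip x x - cnj a * ip x y - a * ip y x + a * cnj a * ip y y"
    by (simp add: ip_diff_left ip_diff_right ip_scale_left ip_scale_right algebra_simps)
  also have "\<dots> = ip x x - of_real ((cmod (ip x y))\<^sup>2 / N)"
  proof -
    have "cnj a * ip x y = of_real ((cmod (ip x y))\<^sup>2 / N)" "a * ip y x = of_real ((cmod (ip x y))\<^sup>2 / N)"
      "a * cnj a * ip y y = of_real ((cmod (ip x y))\<^sup>2 / N)"
      using N0 by (simp_all add: a_def N ip_cnj[of x y] complex_norm_square mult.commute field_simps
          del: of_real_power)
    then show ?thesis by simp
  qed
  also have "\<dots> = of_real ((hnorm ip x)\<^sup>2 - (cmod (ip x y))\<^sup>2 / N)" by (simp add: ip_self)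
  finally have "0 \<le> (hnorm ip x)\<^sup>2 - (cmod (ip x y))\<^sup>2 / N"
    using ip_self_Re[of "x - sc a y"] by simp
  then have "(cmod (ip x y))\<^sup>2 \<le> (hnorm ip x * hnorm ip y)\<^sup>2"
    using N0 by (simp add: field_simps N_def power_mult_distrib)
  then show ?thesis by (rule power2_le_imp_le) simp
qed

section \<open>The representation and its matrix coefficients\<close>

lemma rep_ip: "ip (\<pi> x v) (\<pi> x s) = ip v s"
  using rep[unfolded unitary_rep_def, THEN conjunct1, rule_format, of x] by simp_all

lemma rep_mult: "\<pi> (x + y) v = \<pi> x (\<pi> y v)"
proof -
  have "\<pi> (x + y) = \<pi> x \<circ> \<pi> y" by (rule rep[unfolded unitary_rep_def, THEN conjunct2, THEN conjunct1, rule_format])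
  then show ?thesis by simp
qed

lemma rep_zero: "\<pi> 0 v = v"
proof -
  have "\<pi> 0 = id"
    by (rule rep[unfolded unitary_rep_def, THEN conjunct2, THEN conjunct2, THEN conjunct1])
  then show ?thesis by simp
qed

lemma rep_continuous: "\<epsilon> > 0 \<Longrightarrow> \<exists>N. open N \<and> x \<in> N \<and> (\<forall>y\<in>N. hnorm ip (\<pi> y v - \<pi> x v) < \<epsilon>)"
  by (rule rep[unfolded unitary_rep_def, THEN conjunct2, THEN conjunct2, THEN conjunct2, rule_format])

lemma V_add: "V (v + s) x = V v x + V s x"
  and V_scale: "V (sc a v) x = a * V v x"
  and V_diff: "V (v - s) x = V v x - V s x"
  and V_zero [simp]: "V 0 x = 0"
  by (simp_all add: voice_def ip_add_left ip_scale_left ip_diff_left)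

text \<open>By unitarity \<open>V\<close> intertwines \<pi> with left translation; in particular
  \<open>V (\<pi> y u)\<close> is the translate of \<open>K\<close> by \<open>y\<close>.\<close>

lemma V_rep: "V (\<pi> y v) x = V v (- y + x)"
proof -
  have "\<pi> x u = \<pi> y (\<pi> (- y + x) u)" by (simp add: rep_mult[symmetric])
  then show ?thesis by (simp add: voice_def rep_ip)
qed

lemma V_sum: "V (\<Sum>i\<in>A. f i) x = (\<Sum>i\<in>A. V (f i) x)"
  by (induction A rule: infinite_finite_induct) (auto simp: V_add)

text \<open>This symmetry makes \<open>cmod K\<close> invariant under inversion, which is the
  hypothesis \<open>sym\<close> of the convolution inequality.\<close>

lemma K_minus: "K (- x) = cnj (K x)"
proof -
  have "K (- x) = ip (\<pi> x u) (\<pi> x (\<pi> (- x) u))" by (simp add: voice_def rep_ip)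
  then show ?thesis by (simp add: rep_mult[symmetric] rep_zero voice_def ip_cnj[of "\<pi> x u" u])
qed

text \<open>Brings \<open>cnj (V (\<pi> x u) y)\<close> into the form of the kernel in
  \<open>conv\<close>, whose argument is \<open>- y + x\<close>.\<close>

lemma K_flip: "cnj (K (- x + y)) = K (- y + x)"
  using K_minus[of "- x + y"] by (simp add: minus_add)

lemma V_bounded: "cmod (V v x) \<le> hnorm ip v * hnorm ip u"
  using Cauchy_Schwarz_ip[of v "\<pi> x u"] by (simp add: voice_def hnorm_def rep_ip)

lemma V_continuous: "continuous_on A (V v)"
proof -
  have "(V v \<longlongrightarrow> V v x) (at x)" for x
  proof (rule tendstoI)
    fix e :: real assume e: "0 < e"
    have c: "0 < hnorm ip v + 1" by (simp add: add_nonneg_pos)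
    obtain N where N: "open N" "x \<in> N" "\<And>y. y \<in> N \<Longrightarrow> hnorm ip (\<pi> y u - \<pi> x u) < e / (hnorm ip v + 1)"
      using rep_continuous[of "e / (hnorm ip v + 1)" x u] e c by auto
    have "dist (V v y) (V v x) < e" if "y \<in> N" for y
    proof -
      have "dist (V v y) (V v x) = cmod (ip v (\<pi> y u - \<pi> x u))"
        by (simp add: dist_norm voice_def ip_diff_right)
      also have "\<dots> \<le> hnorm ip v * hnorm ip (\<pi> y u - \<pi> x u)" by (rule Cauchy_Schwarz_ip)
      also have "\<dots> \<le> (hnorm ip v + 1) * hnorm ip (\<pi> y u - \<pi> x u)" by (intro mult_right_mono) auto
      also have "\<dots> < (hnorm ip v + 1) * (e / (hnorm ip v + 1))" using N(3)[OF that] c by (intro mult_strict_left_mono)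
      also have "\<dots> = e" using c by simp
      finally show ?thesis .
    qed
    then show "\<forall>\<^sub>F y in at x. dist (V v y) (V v x) < e"
      unfolding eventually_at_topological using N by blast
  qed
  then have "continuous_on UNIV (V v)" by (simp add: continuous_on_def)
  then show ?thesis by (rule continuous_on_subset) simp
qed

lemma V_measurable [measurable]: "V v \<in> borel_measurable borel"
  by (intro borel_measurable_continuous_onI V_continuous)

section \<open>From the isometry to the reproducing identity\<close>

lemma integrable_V_square: "integrable \<mu> (\<lambda>x. (cmod (V v x))\<^sup>2)"
  and integral_V_square: "(\<integral> x. (cmod (V v x))\<^sup>2 \<partial>\<mu>) = Re (ip v v)"
proof -
  have *: "(\<integral>\<^sup>+ x. ennreal ((cmod (V v x))\<^sup>2) \<partial>\<mu>) = ennreal (Re (ip v v))"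
    using adm by (simp add: admissible_def ennreal_power)
  then show "integrable \<mu> (\<lambda>x. (cmod (V v x))\<^sup>2)"
    by (intro integrableI_nonneg) (auto simp: measurable_haar)
  then show "(\<integral> x. (cmod (V v x))\<^sup>2 \<partial>\<mu>) = Re (ip v v)"
    using * by (simp add: nn_integral_eq_integral ip_self_Re)
qed

lemma integrable_V_V: "integrable \<mu> (\<lambda>x. V v x * cnj (V s x))"
proof (rule Bochner_Integration.integrable_bound)
  show "integrable \<mu> (\<lambda>x. (cmod (V v x))\<^sup>2 + (cmod (V s x))\<^sup>2)"
    by (intro Bochner_Integration.integrable_add integrable_V_square)
  show "AE x in \<mu>. norm (V v x * cnj (V s x)) \<le> norm ((cmod (V v x))\<^sup>2 + (cmod (V s x))\<^sup>2)"
  proof (rule AE_I2)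
    fix x
    have "2 * (cmod (V v x) * cmod (V s x)) \<le> (cmod (V v x))\<^sup>2 + (cmod (V s x))\<^sup>2"
      using sum_squares_bound[of "cmod (V v x)" "cmod (V s x)"] by (simp add: mult_ac)
    moreover have "0 \<le> cmod (V v x) * cmod (V s x)" by simp
    ultimately show "norm (V v x * cnj (V s x)) \<le> norm ((cmod (V v x))\<^sup>2 + (cmod (V s x))\<^sup>2)"
      unfolding norm_mult complex_mod_cnj real_norm_def by linarith
  qed
qed (simp add: measurable_haar)

text \<open>Polarisation: expand the squared modulus of \<open>V (v + s)\<close> and apply the
  isometry to \<open>v\<close>, \<open>s\<close> and \<open>v + s\<close>.\<close>

lemma Re_integral_V_V: "Re (\<integral> x. V v x * cnj (V s x) \<partial>\<mu>) = Re (ip v s)"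
proof -
  have pt: "(cmod (V (v + s) x))\<^sup>2 = (cmod (V v x))\<^sup>2 + (cmod (V s x))\<^sup>2 + 2 * Re (V v x * cnj (V s x))" for x
    unfolding V_add cmod_power2 by (simp add: power2_eq_square algebra_simps)
  have "Re (ip (v + s) (v + s)) = (\<integral> x. (cmod (V (v + s) x))\<^sup>2 \<partial>\<mu>)" by (rule integral_V_square[symmetric])
  also have "\<dots> = Re (ip v v) + Re (ip s s) + 2 * Re (\<integral> x. V v x * cnj (V s x) \<partial>\<mu>)"
  proof -
    have "integrable \<mu> (\<lambda>x. 2 * Re (V v x * cnj (V s x)))"
      by (intro integrable_mult_right integrable_Re integrable_V_V)
    moreover have "(\<integral> x. 2 * Re (V v x * cnj (V s x)) \<partial>\<mu>) = 2 * Re (\<integral> x. V v x * cnj (V s x) \<partial>\<mu>)"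
      by (subst integral_mult_right_zero) (simp only: integral_Re[OF integrable_V_V])
    ultimately show ?thesis
      unfolding pt
      by (simp only: Bochner_Integration.integral_add Bochner_Integration.integrable_add
          integrable_V_square integral_V_square)
  qed
  also have "Re (ip (v + s) (v + s)) = Re (ip v v) + Re (ip s s) + 2 * Re (ip v s)"
    using ip_cnj[of v s] by (simp add: ip_add_left ip_add_right)
  finally show ?thesis by simp
qed

lemma integral_V_V: "(\<integral> x. V v x * cnj (V s x) \<partial>\<mu>) = ip v s"
proof (rule complex_eqI)
  show "Re (\<integral> x. V v x * cnj (V s x) \<partial>\<mu>) = Re (ip v s)" by (rule Re_integral_V_V)
  \<comment> \<open>Multiplication by \<open>- \<i>\<close> turns an imaginary part into a real
    part.\<close>
  have "Re (\<integral> x. - \<i> * (V v x * cnj (V s x)) \<partial>\<mu>) = Re (- \<i> * ip v s)"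
    using Re_integral_V_V[of "sc (- \<i>) v" s] by (simp add: V_scale ip_scale_left mult.assoc)
  then show "Im (\<integral> x. V v x * cnj (V s x) \<partial>\<mu>) = Im (ip v s)" by simp
qed

text \<open>The polarised isometry against \<open>\<pi> x u\<close>, whose conjugated voice
  transform is the convolution kernel.\<close>

lemma V_reproducing:
  shows "integrable \<mu> (\<lambda>y. V v y * K (- y + x))" and "(\<integral> y. V v y * K (- y + x) \<partial>\<mu>) = V v x"
  using integrable_V_V[of v "\<pi> x u"] integral_V_V[of v "\<pi> x u"]
  by (simp_all add: V_rep K_flip voice_def[of ip \<pi> u v x])

section \<open>The test space and its invariance\<close>

lemma S_iff: "v \<in> S \<longleftrightarrow> (\<forall>p>1. Lnorm \<mu> p w (V v) < \<infinity>)"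
  by (auto simp: Sw_def Lspace_def measurable_haar)

lemma S_fin: "v \<in> S \<Longrightarrow> 1 < p \<Longrightarrow> Lnorm \<mu> p w (V v) < \<infinity>"
  by (simp add: S_iff)

lemma K_fin: "1 < p \<Longrightarrow> Lnorm \<mu> p w K < \<infinity>"
  using kernel by (auto simp: Lspace_def)

lemma S_add: "v \<in> S \<Longrightarrow> s \<in> S \<Longrightarrow> v + s \<in> S"
  unfolding S_iff
proof safe
  fix p :: real assume a: "\<forall>p>1. Lnorm \<mu> p w (V v) < \<infinity>" "\<forall>p>1. Lnorm \<mu> p w (V s) < \<infinity>" "1 < p"
  have "Lnorm \<mu> p w (V (v + s)) = Lnorm \<mu> p w (\<lambda>x. V v x + V s x)" by (simp add: V_add[abs_def])
  also have "\<dots> \<le> Lnorm \<mu> p w (V v) + Lnorm \<mu> p w (V s)"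
    using a(3) by (intro Lnorm_add_le) (auto simp: measurable_haar)
  also have "\<dots> < \<infinity>" using a by auto
  finally show "Lnorm \<mu> p w (V (v + s)) < \<infinity>" .
qed

lemma S_scale: "v \<in> S \<Longrightarrow> sc a v \<in> S"
  unfolding S_iff using Lnorm_cmult[of _ "V v" \<mu> w a]
  by (auto simp: V_scale[abs_def] measurable_haar ennreal_mult_less_top)

lemma S_zero: "0 \<in> S"
  unfolding S_iff by (simp add: Lnorm_def wnorm_eq_pnorm)

lemma S_diff: "v \<in> S \<Longrightarrow> s \<in> S \<Longrightarrow> v - s \<in> S"
proof -
  assume a: "v \<in> S" "s \<in> S"
  have "V (- s) = V (sc (- 1) s)" by (rule ext) (simp add: voice_def ip_scale_left)
  then have "- s \<in> S" using S_scale[OF a(2), of "- 1"] by (simp add: S_iff)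
  from S_add[OF a(1) this] show ?thesis by simp
qed

lemma S_sum: "(\<And>i. i \<in> A \<Longrightarrow> f i \<in> S) \<Longrightarrow> (\<Sum>i\<in>A. f i) \<in> S"
  by (induction A rule: infinite_finite_induct) (auto intro: S_zero S_add)

lemma S_rep: "v \<in> S \<Longrightarrow> \<pi> y v \<in> S"
  unfolding S_iff
proof safe
  fix p :: real assume a: "\<forall>p>1. Lnorm \<mu> p w (V v) < \<infinity>" "1 < p"
  have "Lnorm \<mu> p w (V (\<pi> y v)) = pnorm \<mu> p (\<lambda>z. ennreal (w z) * ennreal (cmod (V v (- y + z))))"
    by (simp add: Lnorm_def wnorm_eq_pnorm V_rep)
  also have "\<dots> \<le> ennreal (w y) * pnorm \<mu> p (\<lambda>z. ennreal (w z) * ennreal (cmod (V v z)))"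
    using a(2) by (intro pnorm_translate_weight_le[of "\<lambda>z. ennreal (cmod (V v z))"]) auto
  also have "\<dots> = ennreal (w y) * Lnorm \<mu> p w (V v)" by (simp add: Lnorm_def wnorm_eq_pnorm)
  also have "\<dots> < \<infinity>" using a by (simp add: ennreal_mult_less_top)
  finally show "Lnorm \<mu> p w (V (\<pi> y v)) < \<infinity>" .
qed

lemma S_u: "u \<in> S"
  using K_fin by (simp add: S_iff)

lemma S_rep_u: "\<pi> y u \<in> S"
  by (intro S_rep S_u)

end

section \<open>The reproducing formula on the coorbit space\<close>

lemma norm_set_integral_le_measure:
  fixes f :: "'a \<Rightarrow> complex"
  assumes int: "set_integrable M A f" and A: "A \<in> sets M" "emeasure M A < \<infinity>"
    and le: "\<And>x. x \<in> A \<Longrightarrow> cmod (f x) \<le> c"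
  shows "cmod (LINT x:A|M. f x) \<le> c * measure M A"
proof (cases "A = {}")
  case False
  then have c: "0 \<le> c" using le norm_ge_zero order_trans by blast
  have "ennreal (cmod (LINT x:A|M. f x)) \<le> (\<integral>\<^sup>+ x. ennreal (cmod (indicator A x *\<^sub>R f x)) \<partial>M)"
    unfolding set_lebesgue_integral_def
    by (rule integral_norm_bound_ennreal[OF int[unfolded set_integrable_def]])
  also have "\<dots> \<le> (\<integral>\<^sup>+ x. ennreal c * indicator A x \<partial>M)"
    by (intro nn_integral_mono) (auto simp: indicator_def le intro!: ennreal_leI)
  also have "\<dots> = ennreal (c * measure M A)"
    using A c by (simp add: nn_integral_cmult_indicator emeasure_eq_ennreal_measure less_top ennreal_mult)
  finally show ?thesis using c by (simp add: ennreal_le_iff)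
qed (simp add: set_lebesgue_integral_def)

context haar_group begin

text \<open>A finite subcover by the sets of those \<open>y\<close> with \<open>- y + x\<close> in
  \<open>W\<close>, made disjoint. The displacement \<open>- y + x\<close> is what controls
  increments of translates of \<open>K\<close>, so a single \<open>W\<close> serves all of
  \<open>B\<close>.\<close>

lemma compact_partition:
  assumes B: "compact B" and W: "open W" "(0::'g) \<in> W"
  obtains N :: nat and x :: "nat \<Rightarrow> 'g" and E :: "nat \<Rightarrow> 'g set"
  where "disjoint_family_on E {..<N}" "\<And>i. E i \<in> sets borel" "(\<Union>i<N. E i) = B"
    "\<And>i y. i < N \<Longrightarrow> y \<in> E i \<Longrightarrow> - y + x i \<in> W"
proof -
  define H where "H x = (\<lambda>y. - y + x) -` W" for x :: 'g
  have oH: "open (H x)" for x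
    unfolding H_def using W(1)
    by (rule open_vimage) (intro continuous_group_add continuous_group_minus continuous_on_id continuous_on_const)
  have xH: "x \<in> H x" for x using W(2) by (simp add: H_def)
  obtain F where F: "F \<subseteq> B" "finite F" "B \<subseteq> (\<Union>c\<in>F. H c)"
    using compactE_image[OF B, of B H] oH xH by (metis UN_I subsetI)
  obtain xs where xs: "set xs = F" using finite_list[OF F(2)] by blast
  define N where "N = length xs"
  define A where "A i = (if i < N then B \<inter> H (xs ! i) else {})" for i
  have "(\<Union>i<N. A i) = B"
  proof
    show "B \<subseteq> (\<Union>i<N. A i)"
    proof
      fix y assume y: "y \<in> B"
      then obtain c where "c \<in> set xs" "y \<in> H c" using F(3) xs by blast
      then obtain i where "i < N" "y \<in> H (xs ! i)" by (auto simp: in_set_conv_nth N_def)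
      then show "y \<in> (\<Union>i<N. A i)" using y by (auto simp: A_def)
    qed
  qed (auto simp: A_def)
  then have 1: "(\<Union>i<N. disjointed A i) = B"
    using finite_UN_disjointed_eq[of A N] by (simp add: atLeast0LessThan)
  have Am: "A i \<in> sets borel" for i
    using borel_compact[OF B] borel_open[OF oH] by (simp add: A_def sets.Int)
  have 2: "disjointed A i \<in> sets borel" for i
    using Am by (auto simp: disjointed_def)
  have 3: "disjoint_family_on (disjointed A) {..<N}"
    using disjoint_family_disjointed by (rule disjoint_family_on_mono[rotated]) simp
  have 4: "- y + xs ! i \<in> W" if "i < N" "y \<in> disjointed A i" for i y
    using that disjointed_subset[of A i] by (auto simp: A_def H_def)
  show ?thesis by (rule that[OF 3 2 1 4])
qed

end

context coorbit begin

section \<open>Functionals on the test space and increments of \<open>K\<close>\<close>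

lemma antidual_add: "T \<in> antidual \<mu> sc ip \<pi> u w \<Longrightarrow> v \<in> S \<Longrightarrow> s \<in> S \<Longrightarrow> T (v + s) = T v + T s"
  and antidual_scale: "T \<in> antidual \<mu> sc ip \<pi> u w \<Longrightarrow> v \<in> S \<Longrightarrow> T (sc a v) = cnj a * T v"
  and antidual_off: "T \<in> antidual \<mu> sc ip \<pi> u w \<Longrightarrow> v \<notin> S \<Longrightarrow> T v = 0"
  by (simp_all add: antidual_def)

lemma antidual_diff: "T \<in> antidual \<mu> sc ip \<pi> u w \<Longrightarrow> v \<in> S \<Longrightarrow> s \<in> S \<Longrightarrow> T (v - s) = T v - T s"
  using antidual_add[of T "v - s" s] S_diff[of v s] by simp

lemma antidual_sum:
  assumes T: "T \<in> antidual \<mu> sc ip \<pi> u w"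
  shows "(\<And>i. i \<in> A \<Longrightarrow> f i \<in> S) \<Longrightarrow> T (\<Sum>i\<in>A. f i) = (\<Sum>i\<in>A. T (f i))"
proof (induction A rule: infinite_finite_induct)
  case (insert x A)
  then show ?case using antidual_add[OF T] S_sum[of A f] by simp
qed (use antidual_add[OF T S_zero S_zero] in auto)

lemma antidual_bound:
  assumes "T \<in> antidual \<mu> sc ip \<pi> u w"
  obtains P C where "finite P" "P \<subseteq> {1<..}" "0 \<le> C"
    "\<And>v. v \<in> S \<Longrightarrow> ennreal (cmod (T v)) \<le> ennreal C * (\<Sum>p\<in>P. Lnorm \<mu> p w (V v))"
proof -
  obtain P C where "finite P" "P \<subseteq> {1<..}"
    "\<forall>v\<in>S. ennreal (cmod (T v)) \<le> ennreal C * (\<Sum>p\<in>P. Lnorm \<mu> p w (V v))"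
    using assms unfolding antidual_def by blast
  moreover have "ennreal C = ennreal (max C 0)" by (simp add: max_def ennreal_neg)
  ultimately show ?thesis using that[of P "max C 0"] by auto
qed

text \<open>The modulus of continuity of left translation of \<open>K\<close> in L_{p,w}. It governs
  both the Riemann sums and the continuity of reproduced functions.\<close>

definition K_modulus :: "real \<Rightarrow> 'g \<Rightarrow> ennreal" where
  "K_modulus p q = pnorm \<mu> p (\<lambda>z. ennreal (w z * cmod (K (- q + z) - K z)))"

lemma K_modulus_tendsto: "1 < p \<Longrightarrow> (K_modulus p \<longlongrightarrow> 0) (nhds 0)"
  unfolding K_modulus_def[abs_def] by (rule tendsto_pnorm_translate[OF V_continuous _ K_fin])

text \<open>Factoring out the translation by \<open>y\<close> costs \<open>w y\<close> and leaves an
  increment at the identity. On a compact set \<open>w y\<close> is bounded, which makes the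
  estimate uniform there.\<close>

lemma Lnorm_K_diff_le:
  assumes p: "1 < p"
  shows "Lnorm \<mu> p w (\<lambda>z. K (- x + z) - K (- y + z)) \<le> ennreal (w y) * K_modulus p (- y + x)"
proof -
  have "K (- x + z) = K (- (- y + x) + (- y + z))" for z by (simp add: minus_add add.assoc[symmetric] del: minus_add_distrib)
  then have "Lnorm \<mu> p w (\<lambda>z. K (- x + z) - K (- y + z))
    = pnorm \<mu> p (\<lambda>z. ennreal (w z) * (\<lambda>z. ennreal (cmod (K (- (- y + x) + z) - K z))) (- y + z))"
    by (simp add: Lnorm_def wnorm_eq_pnorm)
  also have "\<dots> \<le> ennreal (w y) * pnorm \<mu> p (\<lambda>z. ennreal (w z) * ennreal (cmod (K (- (- y + x) + z) - K z)))"
    using p by (intro pnorm_translate_weight_le) auto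
  finally show ?thesis by (simp add: K_modulus_def ennreal_mult)
qed

lemma Lnorm_V_rep_diff_le:
  assumes p: "1 < p"
  shows "Lnorm \<mu> p w (V (\<pi> x u - \<pi> y u)) \<le> ennreal (w y) * K_modulus p (- y + x)"
  using Lnorm_K_diff_le[OF p, of x y] by (simp add: V_diff[abs_def] V_rep)

text \<open>Since \<open>K\<close> need not be integrable, \<open>\<integral> V v y \<cdot> \<pi> y u dy\<close> need not converge absolutely
  in \<open>S\<^sub>w\<close>; on a compact set it is nevertheless a limit of Riemann sums.\<close>

lemma Riemann_sum_approximation:
  assumes T: "T \<in> antidual \<mu> sc ip \<pi> u w"
    and P: "finite P" "P \<subseteq> {1<..}" and C: "0 \<le> C"
    and bound: "\<And>v. v \<in> S \<Longrightarrow> ennreal (cmod (T v)) \<le> ennreal C * (\<Sum>p\<in>P. Lnorm \<mu> p w (V v))"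
    and v: "v \<in> S" and B: "compact B" and e: "0 < e"
    and int: "integrable \<mu> (\<lambda>y. T (\<pi> y u) * cnj (V v y))"
  shows "\<exists>s\<in>S. (\<forall>p\<in>P. Lnorm \<mu> p w (\<lambda>z. V s z - (LINT y:B|\<mu>. V v y * K (- y + z))) \<le> ennreal e)
    \<and> cmod (T s - (LINT y:B|\<mu>. T (\<pi> y u) * cnj (V v y))) \<le> e"
proof -
  define b where "b = hnorm ip v * hnorm ip u"
  have b: "0 \<le> b" "\<And>y. cmod (V v y) \<le> b" by (simp_all add: b_def V_bounded)
  define \<beta> where "\<beta> = measure \<mu> B"
  have Bfin: "emeasure \<mu> B < \<infinity>" using B by (rule emeasure_compact_finite)
  have \<beta>: "0 \<le> \<beta>" "emeasure \<mu> B = ennreal \<beta>"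
    using Bfin by (simp_all add: \<beta>_def emeasure_eq_ennreal_measure less_top)
  obtain M where M: "0 \<le> M" "\<And>y. y \<in> B \<Longrightarrow> w y \<le> M"
  proof -
    have "bounded (w ` B)" by (intro compact_imp_bounded compact_continuous_image w_cont B)
    then obtain a where "\<And>y. y \<in> B \<Longrightarrow> norm (w y) \<le> a" by (auto simp: bounded_iff)
    then show ?thesis using that[of "max a 0"] by fastforce
  qed
  \<comment> \<open>A common bound on the seminorms in \<open>P\<close> is amplified by
    \<open>T\<close> by at most this factor.\<close>
  define D where "D = real (card P) * C"
  have D: "0 \<le> D" using C by (simp add: D_def)
  \<comment> \<open>Covers the error in the seminorms (factor 1) and the error after
    \<open>T\<close> (factor \<open>D\<close>) when \<open>\<delta>\<close> is 1. The summand 1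
    makes it positive, since the other factors may vanish.\<close>
  define \<kappa> where "\<kappa> = \<beta> * (b * (M * (1 + D))) + 1"
  have \<kappa>: "0 < \<kappa>" using \<beta> b M D by (auto simp: \<kappa>_def intro!: add_nonneg_pos mult_nonneg_nonneg)
  define \<delta> where "\<delta> = e / \<kappa>"
  have \<delta>: "0 < \<delta>" using e \<kappa> by (simp add: \<delta>_def)
  have small: "\<beta> * (b * (M * \<delta>)) * t \<le> e" if "0 \<le> t" "t \<le> 1 + D" for t
  proof -
    have "\<beta> * (b * (M * t)) \<le> \<kappa>" unfolding \<kappa>_def
      using \<beta> b M D that by (intro order_trans[OF mult_left_mono[OF mult_left_mono[OF mult_left_mono[OF that(2)]]]]) auto
    then have "\<beta> * (b * (M * t)) * \<delta> \<le> \<kappa> * \<delta>" using \<delta> by (intro mult_right_mono) auto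
    then show ?thesis using \<kappa> by (simp add: \<delta>_def mult_ac)
  qed
  have "\<forall>\<^sub>F q in nhds 0. \<forall>p\<in>P. K_modulus p q < ennreal \<delta>"
    using P \<delta> by (intro eventually_ball_finite ballI order_tendstoD(2)[OF K_modulus_tendsto]) auto
  then obtain W where W: "open W" "0 \<in> W" "\<And>q p. q \<in> W \<Longrightarrow> p \<in> P \<Longrightarrow> K_modulus p q < ennreal \<delta>"
    by (auto simp: eventually_nhds)
  obtain N :: nat and x :: "nat \<Rightarrow> 'g" and E :: "nat \<Rightarrow> 'g set" where E: "disjoint_family_on E {..<N}" "\<And>i. E i \<in> sets borel" "(\<Union>i<N. E i) = B"
    "\<And>i y. i < N \<Longrightarrow> y \<in> E i \<Longrightarrow> - y + x i \<in> W"
    by (rule compact_partition[OF B W(1,2)], rule that)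
  have [measurable]: "E i \<in> sets borel" for i by (rule E(2))
  have EB: "E i \<subseteq> B" if "i < N" for i using E(3) that by blast
  have Efin: "emeasure \<mu> (E i) < \<infinity>" if "i < N" for i
    using le_less_trans[OF emeasure_mono[OF EB[OF that]] Bfin] borel_compact[OF B] by simp
  have close: "Lnorm \<mu> p w (\<lambda>z. K (- x i + z) - K (- y + z)) \<le> ennreal (M * \<delta>)"
    if "i < N" "y \<in> E i" "p \<in> P" for i y p
  proof -
    have "y \<in> B" "1 < p" using that EB P by auto
    then have "ennreal (w y) * K_modulus p (- y + x i) \<le> ennreal M * ennreal \<delta>"
      using M(2) W(3)[OF E(4)[OF that(1,2)] that(3)] by (intro mult_mono ennreal_leI) auto
    then show ?thesis using Lnorm_K_diff_le[OF \<open>1 < p\<close>, of "x i" y] M(1) \<delta> 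
      by (simp add: ennreal_mult order_trans)
  qed
  have close_T: "cmod (T (\<pi> (x i) u) - T (\<pi> y u)) \<le> M * \<delta> * D" if "i < N" "y \<in> E i" for i y
  proof -
    have "ennreal (cmod (T (\<pi> (x i) u) - T (\<pi> y u))) = ennreal (cmod (T (\<pi> (x i) u - \<pi> y u)))"
      using antidual_diff[OF T S_rep_u S_rep_u] by simp
    also have "\<dots> \<le> ennreal C * (\<Sum>p\<in>P. Lnorm \<mu> p w (V (\<pi> (x i) u - \<pi> y u)))"
      by (intro bound S_diff S_rep_u)
    also have "\<dots> \<le> ennreal C * (\<Sum>p\<in>P. ennreal (M * \<delta>))"
      using close[OF that] by (intro mult_left_mono sum_mono) (simp_all add: V_diff[abs_def] V_rep)
    also have "\<dots> = ennreal (M * \<delta> * D)"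
      using C M \<delta> by (simp add: D_def ennreal_mult ennreal_of_nat_eq_real_of_nat mult_ac)
    finally show ?thesis using M \<delta> D by (simp add: ennreal_le_iff)
  qed
  have intV: "set_integrable \<mu> (E i) (V v)" if "i < N" for i
    unfolding set_integrable_def
  proof (rule integrableI_bounded)
    have "(\<integral>\<^sup>+ y. ennreal (norm (indicator (E i) y *\<^sub>R V v y)) \<partial>\<mu>) \<le> (\<integral>\<^sup>+ y. ennreal b * indicator (E i) y \<partial>\<mu>)"
      by (intro nn_integral_mono) (auto simp: indicator_def b intro!: ennreal_leI)
    also have "\<dots> < \<infinity>" using Efin[OF that] by (simp add: nn_integral_cmult_indicator ennreal_mult_less_top)
    finally show "(\<integral>\<^sup>+ y. ennreal (norm (indicator (E i) y *\<^sub>R V v y)) \<partial>\<mu>) < \<infinity>" .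
  qed (simp add: measurable_haar)
  have intVK: "set_integrable \<mu> (E i) (\<lambda>y. V v y * K (- y + z))" for i z
    by (rule integrable_mult_indicator[folded set_integrable_def])
      (simp_all add: V_reproducing measurable_haar)
  have intT: "set_integrable \<mu> (E i) (\<lambda>y. T (\<pi> y u) * cnj (V v y))" for i
    by (rule integrable_mult_indicator[folded set_integrable_def]) (simp_all add: int)
  have intcV: "set_integrable \<mu> (E i) (\<lambda>y. cnj (V v y))" if "i < N" for i
    using integrable_cnj[OF intV[OF that, unfolded set_integrable_def]]
    by (simp add: set_integrable_def)
  \<comment> \<open>Each coefficient integrates \<open>V v\<close> over its piece, so only
    \<open>\<pi> y u\<close> is replaced by a fixed \<open>\<pi> (x i) u\<close>; all errors come
    from that replacement.\<close>
  define s where "s = (\<Sum>i<N. sc (LINT y:E i|\<mu>. V v y) (\<pi> (x i) u))"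
  have s: "s \<in> S" unfolding s_def by (intro S_sum S_scale S_rep_u)
  have V_s: "V s z - (LINT y:B|\<mu>. V v y * K (- y + z))
    = (\<Sum>i<N. LINT y:E i|\<mu>. V v y * (K (- x i + z) - K (- y + z)))" for z
  proof -
    have "(LINT y:B|\<mu>. V v y * K (- y + z)) = (\<Sum>i<N. LINT y:E i|\<mu>. V v y * K (- y + z))"
      unfolding E(3)[symmetric] by (intro set_integral_finite_Union E intVK) auto
    moreover have "(LINT y:E i|\<mu>. V v y * (K (- x i + z) - K (- y + z)))
        = (LINT y:E i|\<mu>. V v y) * K (- x i + z) - (LINT y:E i|\<mu>. V v y * K (- y + z))" if "i < N" for i
      unfolding right_diff_distrib using intV[OF that] intVK by (subst set_integral_diff) auto
    ultimately show ?thesis by (simp add: s_def V_sum V_scale V_rep sum_subtractf)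
  qed
  have T_s: "T s - (LINT y:B|\<mu>. T (\<pi> y u) * cnj (V v y))
    = (\<Sum>i<N. LINT y:E i|\<mu>. (T (\<pi> (x i) u) - T (\<pi> y u)) * cnj (V v y))"
  proof -
    have "T s = (\<Sum>i<N. T (sc (LINT y:E i|\<mu>. V v y) (\<pi> (x i) u)))"
      unfolding s_def by (intro antidual_sum[OF T] S_scale S_rep_u)
    also have "\<dots> = (\<Sum>i<N. (LINT y:E i|\<mu>. cnj (V v y)) * T (\<pi> (x i) u))"
    proof (rule sum.cong)
      fix i
      have "cnj (LINT y:E i|\<mu>. V v y) = (LINT y:E i|\<mu>. cnj (V v y))"
        unfolding set_lebesgue_integral_def using Bochner_Integration.integral_cnj[of \<mu> "\<lambda>y. indicator (E i) y *\<^sub>R V v y"] by simp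
      then show "T (sc (LINT y:E i|\<mu>. V v y) (\<pi> (x i) u)) = (LINT y:E i|\<mu>. cnj (V v y)) * T (\<pi> (x i) u)"
        by (simp add: antidual_scale[OF T S_rep_u])
    qed simp
    finally have 1: "T s = \<dots>" .
    have 2: "(LINT y:B|\<mu>. T (\<pi> y u) * cnj (V v y)) = (\<Sum>i<N. LINT y:E i|\<mu>. T (\<pi> y u) * cnj (V v y))"
      unfolding E(3)[symmetric] by (intro set_integral_finite_Union E intT) auto
    have "(LINT y:E i|\<mu>. (T (\<pi> (x i) u) - T (\<pi> y u)) * cnj (V v y))
        = (LINT y:E i|\<mu>. cnj (V v y)) * T (\<pi> (x i) u) - (LINT y:E i|\<mu>. T (\<pi> y u) * cnj (V v y))" if "i < N" for i
      unfolding left_diff_distrib using intcV[OF that] intT by (subst set_integral_diff) (auto simp: mult.commute)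
    then show ?thesis by (simp add: 1 2 sum_subtractf)
  qed
  have "Lnorm \<mu> p w (\<lambda>z. V s z - (LINT y:B|\<mu>. V v y * K (- y + z))) \<le> ennreal e" if p: "p \<in> P" for p
  proof -
    have p1: "1 < p" using p P by auto
    \<comment> \<open>A majorant of the error integrand. For each \<open>y\<close> at most one piece
      contributes, so the norm in \<open>z\<close> is that of a single increment of
      \<open>K\<close>.\<close>
    define \<Phi> where "\<Phi> y z = (\<Sum>i<N. indicator (E i) y * (ennreal b * (ennreal (w z) * ennreal (cmod (K (- x i + z) - K (- y + z))))))" for y z
    have "Lnorm \<mu> p w (\<lambda>z. V s z - (LINT y:B|\<mu>. V v y * K (- y + z))) \<le> pnorm \<mu> p (\<lambda>z. \<integral>\<^sup>+ y. \<Phi> y z \<partial>\<mu>)"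
      unfolding Lnorm_def wnorm_eq_pnorm
    proof (rule pnorm_mono)
      fix z
      have "ennreal (cmod (V s z - (LINT y:B|\<mu>. V v y * K (- y + z))))
         \<le> (\<Sum>i<N. ennreal (cmod (LINT y:E i|\<mu>. V v y * (K (- x i + z) - K (- y + z)))))"
        unfolding V_s by (simp add: sum_ennreal norm_sum ennreal_leI)
      also have "\<dots> \<le> (\<Sum>i<N. \<integral>\<^sup>+ y. indicator (E i) y * (ennreal b * ennreal (cmod (K (- x i + z) - K (- y + z)))) \<partial>\<mu>)"
      proof (rule sum_mono)
        fix i assume i: "i \<in> {..<N}"
        have "set_integrable \<mu> (E i) (\<lambda>y. V v y * (K (- x i + z) - K (- y + z)))"
          unfolding right_diff_distrib using intV intVK i by (intro set_integral_diff set_integrable_mult_left) auto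
        then have "ennreal (cmod (LINT y:E i|\<mu>. V v y * (K (- x i + z) - K (- y + z))))
          \<le> (\<integral>\<^sup>+ y. ennreal (norm (indicator (E i) y *\<^sub>R (V v y * (K (- x i + z) - K (- y + z))))) \<partial>\<mu>)"
          unfolding set_integrable_def set_lebesgue_integral_def by (rule integral_norm_bound_ennreal)
        also have "\<dots> \<le> (\<integral>\<^sup>+ y. indicator (E i) y * (ennreal b * ennreal (cmod (K (- x i + z) - K (- y + z)))) \<partial>\<mu>)"
          by (intro nn_integral_mono)
            (auto simp: indicator_def norm_mult b ennreal_mult[symmetric] intro!: ennreal_leI mult_right_mono)
        finally show "ennreal (cmod (LINT y:E i|\<mu>. V v y * (K (- x i + z) - K (- y + z))))
          \<le> (\<integral>\<^sup>+ y. indicator (E i) y * (ennreal b * ennreal (cmod (K (- x i + z) - K (- y + z)))) \<partial>\<mu>)" .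
      qed
      finally have "ennreal (w z) * ennreal (cmod (V s z - (LINT y:B|\<mu>. V v y * K (- y + z))))
        \<le> ennreal (w z) * (\<Sum>i<N. \<integral>\<^sup>+ y. indicator (E i) y * (ennreal b * ennreal (cmod (K (- x i + z) - K (- y + z)))) \<partial>\<mu>)"
        by (intro mult_left_mono) auto
      also have "\<dots> = (\<integral>\<^sup>+ y. \<Phi> y z \<partial>\<mu>)"
        unfolding \<Phi>_def
        by (subst nn_integral_sum) (auto simp: sum_distrib_left nn_integral_cmult[symmetric] measurable_haar mult_ac)
      finally show "ennreal (w z) * ennreal (cmod (V s z - (LINT y:B|\<mu>. V v y * K (- y + z)))) \<le> (\<integral>\<^sup>+ y. \<Phi> y z \<partial>\<mu>)" .
    qed (use p1 in simp)
    also have "\<dots> \<le> emeasure \<mu> B * ennreal (b * (M * \<delta>))"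
    proof (rule Minkowski_integral_bounded_support)
      show "(\<lambda>(y, z). \<Phi> y z) \<in> borel_measurable (\<mu> \<Otimes>\<^sub>M \<mu>)" unfolding \<Phi>_def by measurable
      show "\<Phi> y z = 0" if "y \<notin> B" for y z
        unfolding \<Phi>_def using EB that by (intro sum.neutral ballI) (auto simp: indicator_def)
      show "pnorm \<mu> p (\<Phi> y) \<le> ennreal (b * (M * \<delta>))" if y: "y \<in> B" for y
      proof -
        obtain j where j: "j < N" "y \<in> E j" using y E(3) by blast
        have "indicator (E i) y = (if i = j then 1 else 0 :: ennreal)" if "i < N" for i
          using that j E(1) by (auto simp: indicator_def disjoint_family_on_def)
        then have "\<Phi> y = (\<lambda>z. ennreal b * (ennreal (w z) * ennreal (cmod (K (- x j + z) - K (- y + z)))))"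
          unfolding \<Phi>_def using j(1) by (intro ext) (simp add: if_distrib[of "\<lambda>t. t * _"] cong: if_cong)
        then have "pnorm \<mu> p (\<Phi> y) = ennreal b * Lnorm \<mu> p w (\<lambda>z. K (- x j + z) - K (- y + z))"
          using p1 by (simp add: pnorm_cmult measurable_haar Lnorm_def wnorm_eq_pnorm)
        also have "\<dots> \<le> ennreal b * ennreal (M * \<delta>)" by (intro mult_left_mono close j p) auto
        finally show ?thesis using b M \<delta> by (simp add: ennreal_mult)
      qed
    qed (use borel_compact[OF B] p1 Bfin in auto)
    also have "\<dots> \<le> ennreal e"
      using small[of 1] b M \<delta> \<beta> D by (simp add: ennreal_mult[symmetric] ennreal_leI)
    finally show ?thesis .
  qed
  moreover have "cmod (T s - (LINT y:B|\<mu>. T (\<pi> y u) * cnj (V v y))) \<le> e"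
  proof -
    have "cmod (T s - (LINT y:B|\<mu>. T (\<pi> y u) * cnj (V v y)))
      \<le> (\<Sum>i<N. cmod (LINT y:E i|\<mu>. (T (\<pi> (x i) u) - T (\<pi> y u)) * cnj (V v y)))"
      unfolding T_s by (rule norm_sum)
    also have "\<dots> \<le> (\<Sum>i<N. (M * \<delta> * D * b) * measure \<mu> (E i))"
    proof (intro sum_mono norm_set_integral_le_measure)
      fix i assume i: "i \<in> {..<N}"
      show "set_integrable \<mu> (E i) (\<lambda>y. (T (\<pi> (x i) u) - T (\<pi> y u)) * cnj (V v y))"
        unfolding left_diff_distrib using intcV intT i by (intro set_integral_diff set_integrable_mult_right) auto
      show "cmod ((T (\<pi> (x i) u) - T (\<pi> y u)) * cnj (V v y)) \<le> M * \<delta> * D * b" if "y \<in> E i" for y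
        using close_T[of i y] b that i M \<delta> D unfolding norm_mult complex_mod_cnj by (intro mult_mono) auto
      show "E i \<in> sets \<mu>" "emeasure \<mu> (E i) < \<infinity>" using Efin i by auto
    qed
    also have "\<dots> = (M * \<delta> * D * b) * \<beta>"
    proof -
      have "(\<Sum>i<N. measure \<mu> (E i)) = \<beta>"
        unfolding \<beta>_def E(3)[symmetric] using E Efin
        by (intro measure_finite_Union[symmetric]) (auto simp: less_top)
      then show ?thesis by (simp add: sum_distrib_left[symmetric])
    qed
    also have "\<dots> \<le> e" using small[of D] D by (simp add: mult_ac)
    finally show ?thesis .
  qed
  ultimately show ?thesis using s by blast
qed

end

context coorbit begin

text \<open>Truncating the reproducing integral of \<open>V v\<close> to an exhaustion by compact sets converges in every
  \<open>L\<^bsub>p,w\<^esub>\<close>: the majorant \<open>\<bar>V v\<bar> * \<bar>K\<bar>\<close> lies in \<open>L\<^bsub>p,w\<^esub>\<close> by Young's inequality.\<close>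

lemma truncated_reproducing_tendsto:
  assumes v: "v \<in> S" and B: "\<And>n. B n \<in> sets borel" "incseq B" "(\<Union>n. B n) = UNIV" and p: "1 < p"
  shows "(\<lambda>n. Lnorm \<mu> p w (\<lambda>z. V v z - (LINT y:B n|\<mu>. V v y * K (- y + z)))) \<longlonglongrightarrow> 0"
proof -
  have [measurable]: "B n \<in> sets borel" for n by (rule B)
  let ?h = "\<lambda>n z. LINT y:B n|\<mu>. V v y * K (- y + z)"
  have int: "integrable \<mu> (\<lambda>y. V v y * K (- y + z))" for z by (rule V_reproducing)
  have set_int: "set_integrable \<mu> A (\<lambda>y. V v y * K (- y + z))" if "A \<in> sets borel" for A z
    using that by (intro integrable_mult_indicator[folded set_integrable_def] int) simp
  have diff: "V v z - ?h n z = (LINT y:- B n|\<mu>. V v y * K (- y + z))" for n z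
  proof -
    have "V v z = (LINT y:UNIV|\<mu>. V v y * K (- y + z))"
      by (simp add: V_reproducing set_lebesgue_integral_def)
    also have "(UNIV :: 'g set) = B n \<union> - B n" by auto
    also have "(LINT y:B n \<union> - B n|\<mu>. V v y * K (- y + z)) = ?h n z + (LINT y:- B n|\<mu>. V v y * K (- y + z))"
      by (intro set_integral_Un set_int) auto
    finally show ?thesis by simp
  qed
  have [measurable]: "?h n \<in> borel_measurable borel" for n
    unfolding set_lebesgue_integral_def measurable_haar[symmetric] by measurable
  \<comment> \<open>The convolution of the moduli of \<open>V v\<close> and \<open>K\<close>: it
    majorises the truncation error for every \<open>n\<close> at once.\<close>
  let ?g = "\<lambda>z. \<integral> y. cmod (V v y) * cmod (K (- y + z)) \<partial>\<mu>"
  have gm [measurable]: "?g \<in> borel_measurable borel"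
    unfolding measurable_haar[symmetric] by measurable
  have int_g: "integrable \<mu> (\<lambda>y. cmod (V v y) * cmod (K (- y + z)))" for z
    using integrable_norm[OF int[of z]] by (simp add: norm_mult)
  have "(\<lambda>n. pnorm \<mu> p (\<lambda>z. ennreal (w z * cmod (V v z - ?h n z)))) \<longlonglongrightarrow> 0"
  proof (rule dominated_pnorm_tendsto_0)
    show "(\<lambda>n. w z * cmod (V v z - ?h n z)) \<longlonglongrightarrow> 0" for z
    proof -
      have "(\<lambda>n. ?h n z) \<longlonglongrightarrow> (LINT y:(\<Union>n. B n)|\<mu>. V v y * K (- y + z))"
        using B by (intro set_integral_cont_up set_int) auto
      then have "(\<lambda>n. ?h n z) \<longlonglongrightarrow> V v z"
        by (simp add: B(3) V_reproducing set_lebesgue_integral_def)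
      then have "(\<lambda>n. w z * cmod (V v z - ?h n z)) \<longlonglongrightarrow> w z * cmod (V v z - V v z)"
        by (intro tendsto_intros)
      then show ?thesis by simp
    qed
    show "w z * cmod (V v z - ?h n z) \<le> w z * ?g z" for n z
    proof (rule mult_left_mono)
      have "cmod (V v z - ?h n z) \<le> (\<integral> y. cmod (indicator (- B n) y *\<^sub>R (V v y * K (- y + z))) \<partial>\<mu>)"
        unfolding diff unfolding set_lebesgue_integral_def by (rule integral_norm_bound)
      also have "\<dots> \<le> ?g z"
      proof (rule integral_mono[OF integrable_norm[OF set_int[unfolded set_integrable_def]] int_g])
        show "cmod (indicator (- B n) y *\<^sub>R (V v y * K (- y + z))) \<le> cmod (V v y) * cmod (K (- y + z))" for y
          by (auto simp: indicator_def norm_mult)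
      qed auto
      finally show "cmod (V v z - ?h n z) \<le> ?g z" .
    qed simp
    have "ennreal (w z * ?g z) = ennreal (w z) * (\<integral>\<^sup>+ y. ennreal (cmod (V v y) * cmod (K (- y + z))) \<partial>\<mu>)" for z
      by (subst nn_integral_eq_integral[OF int_g]) (auto intro!: ennreal_mult integral_nonneg)
    then show "pnorm \<mu> p (\<lambda>z. ennreal (w z * ?g z)) < \<infinity>"
      using Young_weighted[of "V v" K p] S_fin[OF v] K_fin p by (simp add: K_minus)
  qed (use p in \<open>auto simp: measurable_haar\<close>)
  then show ?thesis by (simp add: Lnorm_eq_pnorm)
qed

text \<open>The values \<open>T (s n)\<close> on Riemann sums over growing compact sets have two
  limits. The sums converge to \<open>v\<close> in the finitely many seminorms of \<open>P\<close>,
  which gives \<open>T v\<close>. They also follow the integrals over \<open>B n\<close>, which tend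
  to the full integral since the integrand is integrable.\<close>

lemma antidual_eq_integral:
  assumes T: "T \<in> antidual \<mu> sc ip \<pi> u w" and L: "Ve \<pi> u T \<in> Lspace \<mu> r m"
    and r: "1 < r" and m: "moderate w m" and v: "v \<in> S"
  shows "integrable \<mu> (\<lambda>y. Ve \<pi> u T y * cnj (V v y))" and "T v = (\<integral> y. Ve \<pi> u T y * cnj (V v y) \<partial>\<mu>)"
proof -
  have r': "1 < r / (r - 1)" using r by (simp add: field_simps)
  have "Lnorm \<mu> (r / (r - 1)) w (\<lambda>y. cnj (V v y)) < \<infinity>"
    using S_fin[OF v r'] by (simp add: Lnorm_def)
  then show int: "integrable \<mu> (\<lambda>y. Ve \<pi> u T y * cnj (V v y))"
    using L r m by (intro integrable_pairing) (auto simp: Lspace_def measurable_haar)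
  let ?F = "\<lambda>y. T (\<pi> y u) * cnj (V v y)"
  have intF: "integrable \<mu> ?F" using int by (simp add: Ve_def)
  obtain P C where P: "finite P" "P \<subseteq> {1<..}" and C: "0 \<le> C"
    and bound: "\<And>v. v \<in> S \<Longrightarrow> ennreal (cmod (T v)) \<le> ennreal C * (\<Sum>p\<in>P. Lnorm \<mu> p w (V v))"
    using antidual_bound[OF T] by blast
  obtain B :: "nat \<Rightarrow> 'g set" where B: "\<And>n. compact (B n)" "incseq B" "(\<Union>n. B n) = UNIV"
    using compact_exhaustion by blast
  have Bm [measurable]: "B n \<in> sets borel" for n using B(1) by (rule borel_compact)
  let ?h = "\<lambda>n z. LINT y:B n|\<mu>. V v y * K (- y + z)"
  have [measurable]: "?h n \<in> borel_measurable borel" for n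
    unfolding set_lebesgue_integral_def measurable_haar[symmetric] by measurable
  let ?e = "\<lambda>n. 1 / real (Suc n)"
  have "\<forall>n. \<exists>s. s \<in> S \<and> (\<forall>p\<in>P. Lnorm \<mu> p w (\<lambda>z. V s z - ?h n z) \<le> ennreal (?e n))
      \<and> cmod (T s - (LINT y:B n|\<mu>. ?F y)) \<le> ?e n"
    using Riemann_sum_approximation[OF T P C bound v B(1) _ intF, of "?e _"] by (simp add: Bex_def)
  from choice[OF this] obtain s where s_all: "\<forall>n. s n \<in> S \<and>
      (\<forall>p\<in>P. Lnorm \<mu> p w (\<lambda>z. V (s n) z - ?h n z) \<le> ennreal (?e n))
      \<and> cmod (T (s n) - (LINT y:B n|\<mu>. ?F y)) \<le> ?e n" ..
  have s: "s n \<in> S" "p \<in> P \<Longrightarrow> Lnorm \<mu> p w (\<lambda>z. V (s n) z - ?h n z) \<le> ennreal (?e n)"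
      "cmod (T (s n) - (LINT y:B n|\<mu>. ?F y)) \<le> ?e n" for n p
    using s_all by simp_all
  have e0: "?e \<longlonglongrightarrow> 0" by (rule LIMSEQ_Suc[OF lim_1_over_n])
  have lim1: "(\<lambda>n. LINT y:B n|\<mu>. ?F y) \<longlonglongrightarrow> (\<integral> y. ?F y \<partial>\<mu>)"
  proof -
    have "(\<lambda>n. LINT y:B n|\<mu>. ?F y) \<longlonglongrightarrow> (LINT y:(\<Union>n. B n)|\<mu>. ?F y)"
      using B(2,3) intF by (intro set_integral_cont_up) (auto simp: set_integrable_def)
    then show ?thesis by (simp add: B(3) set_lebesgue_integral_def)
  qed
  have "(\<lambda>n. T (s n) - (LINT y:B n|\<mu>. ?F y)) \<longlonglongrightarrow> 0"
    using s(3) by (intro Lim_null_comparison[OF _ e0]) auto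
  from tendsto_add[OF this lim1] have lim2: "(\<lambda>n. T (s n)) \<longlonglongrightarrow> (\<integral> y. ?F y \<partial>\<mu>)" by simp
  have "(\<lambda>n. ennreal (cmod (T v - T (s n)))) \<longlonglongrightarrow> 0"
  proof (rule tendsto_sandwich[OF _ _ tendsto_const])
    let ?b = "\<lambda>n. ennreal C * (\<Sum>p\<in>P. Lnorm \<mu> p w (\<lambda>z. V v z - ?h n z) + ennreal (?e n))"
    have "(\<lambda>n. \<Sum>p\<in>P. Lnorm \<mu> p w (\<lambda>z. V v z - ?h n z) + ennreal (?e n)) \<longlonglongrightarrow> (\<Sum>p\<in>P. 0 + ennreal 0)"
      using P(2) B Bm by (intro tendsto_sum tendsto_add truncated_reproducing_tendsto[OF v] tendsto_ennrealI e0) auto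
    then have "?b \<longlonglongrightarrow> ennreal C * 0" by (intro ennreal_tendsto_cmult) auto
    then show "?b \<longlonglongrightarrow> 0" by simp
    have "ennreal (cmod (T v - T (s n))) \<le> ?b n" for n
    proof -
      have "ennreal (cmod (T v - T (s n))) = ennreal (cmod (T (v - s n)))"
        using antidual_diff[OF T v s(1)] by simp
      also have "\<dots> \<le> ennreal C * (\<Sum>p\<in>P. Lnorm \<mu> p w (V (v - s n)))"
        by (intro bound S_diff v s)
      also have "\<dots> \<le> ?b n"
      proof (intro mult_left_mono sum_mono)
        fix p assume p: "p \<in> P"
        have "V (v - s n) = (\<lambda>z. (V v z - ?h n z) - (V (s n) z - ?h n z))" by (simp add: V_diff[abs_def])
        then have "Lnorm \<mu> p w (V (v - s n)) \<le> Lnorm \<mu> p w (\<lambda>z. V v z - ?h n z) + Lnorm \<mu> p w (\<lambda>z. V (s n) z - ?h n z)"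
          using p P(2) Lnorm_diff_le[of "\<lambda>z. V v z - ?h n z" \<mu> "\<lambda>z. V (s n) z - ?h n z" w p] by (auto simp: measurable_haar)
        also have "\<dots> \<le> Lnorm \<mu> p w (\<lambda>z. V v z - ?h n z) + ennreal (?e n)"
          by (intro add_left_mono s p)
        finally show "Lnorm \<mu> p w (V (v - s n)) \<le> \<dots>" .
      qed simp
      finally show ?thesis .
    qed
    then show "\<forall>\<^sub>F n in sequentially. ennreal (cmod (T v - T (s n))) \<le> ?b n" by simp
  qed simp
  then have "(\<lambda>n. cmod (T v - T (s n))) \<longlonglongrightarrow> 0"
    using tendsto_ennreal_iff[of "\<lambda>n. cmod (T v - T (s n))" sequentially 0] by simp
  then have "(\<lambda>n. T v - T (s n)) \<longlonglongrightarrow> 0" by (rule tendsto_norm_zero_cancel)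
  from tendsto_add[OF this lim2] have "(\<lambda>n. T v) \<longlonglongrightarrow> 0 + (\<integral> y. ?F y \<partial>\<mu>)" by simp
  then have "T v = (\<integral> y. ?F y \<partial>\<mu>)" using LIMSEQ_unique[OF tendsto_const] by simp
  then show "T v = (\<integral> y. Ve \<pi> u T y * cnj (V v y) \<partial>\<mu>)" by (simp add: Ve_def)
qed

text \<open>At \<open>v = \<pi> x u\<close> the integral formula for \<open>T\<close> is the
  convolution with \<open>K\<close>.\<close>

lemma Ve_in_Mspace:
  assumes "T \<in> antidual \<mu> sc ip \<pi> u w" "Ve \<pi> u T \<in> Lspace \<mu> r m" "1 < r" "moderate w m"
  shows "Ve \<pi> u T \<in> Mspace \<mu> K r m"
proof -
  have "conv \<mu> (Ve \<pi> u T) K x = Ve \<pi> u T x" for x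
  proof -
    have "Ve \<pi> u T x = T (\<pi> x u)" by (rule Ve_def)
    also have "\<dots> = (\<integral> y. Ve \<pi> u T y * cnj (V (\<pi> x u) y) \<partial>\<mu>)"
      by (rule antidual_eq_integral(2)[OF assms S_rep_u])
    also have "\<dots> = conv \<mu> (Ve \<pi> u T) K x" by (simp only: conv_def V_rep K_flip)
    finally show ?thesis ..
  qed
  then show ?thesis using assms(2) by (simp add: Mspace_def)
qed

text \<open>The functional with density \<open>f\<close>, used to invert \<open>Ve\<close>. The
  value 0 off \<open>S\<close> matches the encoding of the antidual, in which equality is equality
  of functions.\<close>

definition functional :: "('g \<Rightarrow> complex) \<Rightarrow> 'h \<Rightarrow> complex" where
  "functional f v = (if v \<in> S then \<integral> y. f y * cnj (V v y) \<partial>\<mu> else 0)"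

text \<open>Both sides are the same Bochner integral once the translate of \<open>K\<close> is
  conjugated.\<close>

lemma Ve_functional: "Ve \<pi> u (functional f) = conv \<mu> f K"
  by (rule ext) (simp only: Ve_def functional_def S_rep_u V_rep K_flip conv_def if_True)

context
  fixes r :: real and m :: "'g \<Rightarrow> real"
  assumes r: "1 < r" and m: "moderate w m"
begin

section \<open>Convolution with \<open>K\<close> on L_{r,m} through functionals\<close>

lemma conjugate_exponent_gt_1: "1 < r / (r - 1)"
  using r by (simp add: field_simps)

lemma Lspace_iff: "f \<in> Lspace \<mu> r m \<longleftrightarrow> f \<in> borel_measurable borel \<and> Lnorm \<mu> r m f < \<infinity>"
  by (auto simp: Lspace_def measurable_haar)

lemma integrable_functional:
  assumes f: "f \<in> Lspace \<mu> r m" and v: "v \<in> S"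
  shows "integrable \<mu> (\<lambda>y. f y * cnj (V v y))"
    and "ennreal (m 0 * cmod (\<integral> y. f y * cnj (V v y) \<partial>\<mu>)) \<le> Lnorm \<mu> r m f * Lnorm \<mu> (r / (r - 1)) w (V v)"
proof -
  have "Lnorm \<mu> (r / (r - 1)) w (\<lambda>y. cnj (V v y)) = Lnorm \<mu> (r / (r - 1)) w (V v)"
    by (simp add: Lnorm_def)
  then show "integrable \<mu> (\<lambda>y. f y * cnj (V v y))"
    "ennreal (m 0 * cmod (\<integral> y. f y * cnj (V v y) \<partial>\<mu>)) \<le> Lnorm \<mu> r m f * Lnorm \<mu> (r / (r - 1)) w (V v)"
    using integrable_pairing[of f "\<lambda>y. cnj (V v y)" m r] f m r S_fin[OF v conjugate_exponent_gt_1]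
    by (simp_all add: Lspace_iff)
qed

text \<open>A single seminorm suffices for continuity, the one with the conjugate exponent
  \<open>r / (r - 1)\<close>.\<close>

lemma functional_in_antidual:
  assumes f: "f \<in> Lspace \<mu> r m"
  shows "functional f \<in> antidual \<mu> sc ip \<pi> u w"
proof -
  have m0: "0 < m 0" by (rule moderate_pos[OF m])
  obtain F where F: "Lnorm \<mu> r m f = ennreal F" "0 \<le> F"
    using f by (cases "Lnorm \<mu> r m f") (auto simp: Lspace_iff)
  have "ennreal (cmod (functional f v)) \<le> ennreal (F / m 0) * (\<Sum>p\<in>{r / (r - 1)}. Lnorm \<mu> p w (V v))" if v: "v \<in> S" for v
  proof -
    have "ennreal (1 / m 0) * ennreal (m 0 * cmod (\<integral> y. f y * cnj (V v y) \<partial>\<mu>))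
       \<le> ennreal (1 / m 0) * (ennreal F * Lnorm \<mu> (r / (r - 1)) w (V v))"
      using integrable_functional(2)[OF f v] by (intro mult_left_mono) (auto simp: F)
    also have "\<dots> = ennreal (F / m 0) * Lnorm \<mu> (r / (r - 1)) w (V v)"
      using F m0 by (simp add: ennreal_mult[symmetric] mult.assoc[symmetric])
    finally show ?thesis
      using m0 v by (simp add: functional_def ennreal_mult[symmetric])
  qed
  then have "\<exists>P C. finite P \<and> P \<subseteq> {1<..} \<and> (\<forall>v\<in>S. ennreal (cmod (functional f v)) \<le> ennreal C * (\<Sum>p\<in>P. Lnorm \<mu> p w (V v)))"
    using conjugate_exponent_gt_1 by (intro exI[of _ "{r / (r - 1)}"] exI[of _ "F / m 0"]) auto
  moreover have "functional f (v + s) = functional f v + functional f s" if "v \<in> S" "s \<in> S" for v s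
    using that S_add[OF that] integrable_functional(1)[OF f]
    by (simp add: functional_def V_add distrib_left)
  moreover have "functional f (sc a v) = cnj a * functional f v" if "v \<in> S" for a v
    using that S_scale[OF that] by (simp add: functional_def V_scale mult.left_commute)
  ultimately show ?thesis unfolding antidual_def by (auto simp: functional_def)
qed

text \<open>\<open>conv \<mu> f K\<close> is \<open>Ve\<close> of \<open>functional f\<close>, and
  such transforms reproduce themselves. Idempotence thus comes from the antidual and not from
  exchanging integrals in an iterated convolution.\<close>

lemma conv_in_Mspace:
  assumes "f \<in> Lspace \<mu> r m" "conv \<mu> f K \<in> Lspace \<mu> r m"
  shows "conv \<mu> f K \<in> Mspace \<mu> K r m"
  using Ve_in_Mspace[OF functional_in_antidual[OF assms(1)] _ r m] assms(2) by (simp add: Ve_functional)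

lemma Mspace_Lspace: "f \<in> Mspace \<mu> K r m \<Longrightarrow> f \<in> Lspace \<mu> r m"
  and Mspace_conv: "f \<in> Mspace \<mu> K r m \<Longrightarrow> conv \<mu> f K = f"
  by (auto simp: Mspace_def)

lemma integrable_conv_kernel:
  assumes f: "f \<in> Lspace \<mu> r m"
  shows "integrable \<mu> (\<lambda>y. f y * K (- y + x))"
  using integrable_functional(1)[OF f S_rep_u[of x]] by (simp add: V_rep K_flip)

text \<open>Hoelder against \<open>V (\<pi> x u)\<close>, with a constant that depends on
  \<open>x\<close> but not on \<open>f\<close>. Such bounds convert norm decay of the Neumann terms
  into pointwise summability.\<close>

lemma conv_point_bound:
  obtains c where "0 \<le> c" "\<And>f. f \<in> Lspace \<mu> r m \<Longrightarrow> ennreal (cmod (conv \<mu> f K x)) \<le> ennreal c * Lnorm \<mu> r m f"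
proof -
  have m0: "0 < m 0" by (rule moderate_pos[OF m])
  obtain k where k: "Lnorm \<mu> (r / (r - 1)) w (V (\<pi> x u)) = ennreal k" "0 \<le> k"
    using S_fin[OF S_rep_u conjugate_exponent_gt_1, of x]
    by (cases "Lnorm \<mu> (r / (r - 1)) w (V (\<pi> x u))") auto
  have "ennreal (cmod (conv \<mu> f K x)) \<le> ennreal (k / m 0) * Lnorm \<mu> r m f" if f: "f \<in> Lspace \<mu> r m" for f
  proof -
    have "ennreal (1 / m 0) * ennreal (m 0 * cmod (conv \<mu> f K x)) \<le> ennreal (1 / m 0) * (Lnorm \<mu> r m f * ennreal k)"
      using integrable_functional(2)[OF f S_rep_u[of x]]
      by (intro mult_left_mono) (auto simp: k V_rep K_flip conv_def)
    then show ?thesis using m0 k by (simp add: ennreal_mult[symmetric] mult.left_commute mult.commute[of "ennreal (k / m 0)"] )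
  qed
  then show ?thesis using that[of "k / m 0"] k m0 by auto
qed

text \<open>\<open>f\<close> is \<open>Ve\<close> of a continuous functional, so its increments are
  bounded by moduli of \<open>K\<close>. Continuity is what makes the oscillation
  measurable.\<close>

lemma Mspace_continuous:
  assumes f: "f \<in> Mspace \<mu> K r m"
  shows "continuous_on UNIV f"
proof -
  let ?T = "functional f"
  have T: "?T \<in> antidual \<mu> sc ip \<pi> u w" using f by (intro functional_in_antidual Mspace_Lspace)
  have Tf: "?T (\<pi> x u) = f x" for x
    using Ve_functional[of f] Mspace_conv[OF f] by (simp add: Ve_def fun_eq_iff)
  obtain P C where P: "finite P" "P \<subseteq> {1<..}"
    and bound: "\<And>v. v \<in> S \<Longrightarrow> ennreal (cmod (?T v)) \<le> ennreal C * (\<Sum>p\<in>P. Lnorm \<mu> p w (V v))"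
    using antidual_bound[OF T] by metis
  have "(f \<longlongrightarrow> f y) (at y)" for y
  proof -
    have "((\<lambda>x. - y + x) \<longlongrightarrow> 0) (at y)"
    proof -
      have "continuous_on UNIV (\<lambda>x. - y + x)"
        by (intro continuous_group_add continuous_on_const continuous_on_id)
      then have "((\<lambda>x. - y + x) \<longlongrightarrow> - y + y) (at y)" unfolding continuous_on_def by blast
      then show ?thesis by (rule tendsto_eq_rhs) simp
    qed
    then have mod: "((\<lambda>x. K_modulus p (- y + x)) \<longlongrightarrow> 0) (at y)" if "p \<in> P" for p
      using filterlim_compose[OF K_modulus_tendsto, of p "\<lambda>x. - y + x" "at y"] that P(2) by auto
    let ?b = "\<lambda>x. ennreal C * (\<Sum>p\<in>P. ennreal (w y) * K_modulus p (- y + x))"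
    have "((\<lambda>x. \<Sum>p\<in>P. ennreal (w y) * K_modulus p (- y + x)) \<longlongrightarrow> (\<Sum>p\<in>P. ennreal (w y) * 0)) (at y)"
      by (intro tendsto_sum ennreal_tendsto_cmult mod) auto
    then have "(?b \<longlongrightarrow> ennreal C * (\<Sum>p\<in>P. ennreal (w y) * 0)) (at y)" by (intro ennreal_tendsto_cmult) auto
    then have b0: "(?b \<longlongrightarrow> 0) (at y)" by simp
    have le: "ennreal (cmod (f x - f y)) \<le> ?b x" for x
    proof -
      have "ennreal (cmod (f x - f y)) = ennreal (cmod (?T (\<pi> x u - \<pi> y u)))"
        using antidual_diff[OF T S_rep_u S_rep_u] by (simp add: Tf)
      also have "\<dots> \<le> ennreal C * (\<Sum>p\<in>P. Lnorm \<mu> p w (V (\<pi> x u - \<pi> y u)))"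
        by (intro bound S_diff S_rep_u)
      also have "\<dots> \<le> ?b x"
        using P(2) by (intro mult_left_mono sum_mono Lnorm_V_rep_diff_le) auto
      finally show ?thesis .
    qed
    have "((\<lambda>x. ennreal (cmod (f x - f y))) \<longlongrightarrow> 0) (at y)"
      by (rule tendsto_sandwich[OF _ _ tendsto_const b0]) (auto intro: always_eventually le)
    then have "((\<lambda>x. cmod (f x - f y)) \<longlongrightarrow> 0) (at y)"
      using tendsto_ennreal_iff[of "\<lambda>x. cmod (f x - f y)" "at y" 0] by simp
    then have "((\<lambda>x. f x - f y) \<longlongrightarrow> 0) (at y)" by (rule tendsto_norm_zero_cancel)
    then show ?thesis by (rule LIM_zero_cancel)
  qed
  then show ?thesis by (auto simp: continuous_on_def)
qed

end

end

section \<open>Sampling and synthesis\<close>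

text \<open>The sum is at most \<open>card A\<close> times its largest term. The crude constant does
  no harm, since \<open>A\<close> will be a set of overlapping cells of bounded cardinality.\<close>

lemma ennpow_sum_le:
  fixes a :: "'i \<Rightarrow> ennreal"
  assumes A: "finite A" and r: "0 < r"
  shows "ennpow (\<Sum>i\<in>A. a i) r \<le> ennpow (of_nat (card A)) r * (\<Sum>i\<in>A. ennpow (a i) r)"
proof (cases "A = {}")
  case False
  have "Max (a ` A) \<in> a ` A" using A False by (intro Max_in) auto
  then obtain j where j: "Max (a ` A) = a j" "j \<in> A" by (rule imageE)
  have "(\<Sum>i\<in>A. a i) \<le> of_nat (card A) * a j"
    using A Max_ge[of "a ` A"] by (intro sum_bounded_above) (auto simp: j(1)[symmetric])
  then have "ennpow (\<Sum>i\<in>A. a i) r \<le> ennpow (of_nat (card A)) r * ennpow (a j) r"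
    using r ennpow_mono[of "\<Sum>i\<in>A. a i" "of_nat (card A) * a j" r] by (simp add: ennpow_mult)
  also have "ennpow (a j) r \<le> (\<Sum>i\<in>A. ennpow (a i) r)"
    using A j(2) by (rule member_le_sum[rotated 2]) auto
  finally show ?thesis by (simp add: mult_left_mono)
qed simp

text \<open>Restricting to the indices that are nonzero at \<open>y\<close> makes this a finite sum
  for a BUPU, with no convergence condition on \<open>c\<close>.\<close>

definition synthesis :: "('i \<Rightarrow> 'g \<Rightarrow> real) \<Rightarrow> ('i \<Rightarrow> complex) \<Rightarrow> 'g \<Rightarrow> complex" where
  "synthesis \<psi> c y = (\<Sum>i | \<psi> i y \<noteq> 0. c i * of_real (\<psi> i y))"

text \<open>One admissible pair \<open>(r, m)\<close>. The number \<open>\<epsilon>\<close> stands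
  for the oscillation constant of U^{-1}, and \<open>small\<close> is the contraction
  condition.\<close>

locale coorbit_sampling = coorbit \<mu> w sc ip \<pi> u
  for \<mu> :: "'g::{group_add,t2_space,second_countable_topology} measure" and w
    and sc :: "complex \<Rightarrow> 'h::ab_group_add \<Rightarrow> 'h" and ip \<pi> u +
  fixes X :: "'i \<Rightarrow> 'g" and \<psi> :: "'i \<Rightarrow> 'g \<Rightarrow> real" and r :: real and m :: "'g \<Rightarrow> real"
    and U :: "'g set" and \<epsilon> :: real
  assumes r: "1 < r" and m: "moderate w m"
    and conv_Lspace: "f \<in> Lspace \<mu> r m \<Longrightarrow> conv \<mu> f K \<in> Lspace \<mu> r m"
    and U: "compact U" "unit_nbhd U"
    and \<epsilon>: "0 < \<epsilon>"
    and osc_le: "f \<in> Mspace \<mu> K r m \<Longrightarrow> wnorm \<mu> r m (osc (uminus ` U) f) \<le> ennreal \<epsilon> * Lnorm \<mu> r m f"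
    and small: "rc_opnorm \<mu> K r m * ennreal \<epsilon> < 1"
    and bupu: "bupu U X \<psi>"
begin

section \<open>Cells, overlaps and the partition of unity\<close>

lemma m_nonneg [simp]: "0 \<le> m x" and m_measurable [measurable]: "m \<in> borel_measurable borel"
  using moderate_pos[OF m, of x] moderate_measurable[OF m] by auto

definition cell :: "'i \<Rightarrow> 'g set" where "cell i = (\<lambda>q. X i + q) ` U"
definition active :: "'g \<Rightarrow> 'i set" where "active y = {i. y \<in> cell i}"

lemma active_iff: "i \<in> active y \<longleftrightarrow> y \<in> cell i"
  by (simp add: active_def)

lemma overlap_bound:
  obtains N :: nat where "\<And>y. finite (active y)" "\<And>y. card (active y) \<le> N"
proof -
  have "\<exists>N::nat. \<forall>y. finite (active y) \<and> card (active y) \<le> N"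
    using bupu U by (simp add: bupu_def rel_separated_def active_def cell_def)
  then show ?thesis using that by metis
qed

lemma finite_active [simp]: "finite (active y)"
  using overlap_bound by metis

lemma cell_compact: "compact (cell i)"
  unfolding cell_def using U(1)
  by (intro compact_continuous_image continuous_group_add continuous_on_const continuous_on_id)

lemma cell_measurable [measurable]: "cell i \<in> sets borel"
  using cell_compact by (rule borel_compact)

lemma emeasure_cell: "emeasure \<mu> (cell i) = emeasure \<mu> U"
  using haar borel_compact[OF U(1)] by (simp add: haar_measure_def cell_def)

lemma emeasure_U: "0 < emeasure \<mu> U" "emeasure \<mu> U < \<infinity>"
proof -
  have "0 < emeasure \<mu> (interior U)" using haar U(2) unfolding haar_measure_def unit_nbhd_def by auto
  also have "\<dots> \<le> emeasure \<mu> U" using borel_compact[OF U(1)] by (intro emeasure_mono interior_subset) simp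
  finally show "0 < emeasure \<mu> U" .
  show "emeasure \<mu> U < \<infinity>" by (rule emeasure_compact_finite[OF U(1)])
qed

text \<open>Every cell meets a countable dense set, and every point lies in finitely many cells.
  Countability gives measurability of syntheses and Fubini against the counting measure.\<close>

lemma countable_index: "countable (UNIV :: 'i set)"
proof -
  obtain D :: "'g set" where D: "countable D" "\<And>A. open A \<Longrightarrow> A \<noteq> {} \<Longrightarrow> \<exists>d\<in>D. d \<in> A"
    using countable_dense_setE by blast
  have "i \<in> (\<Union>d\<in>D. active d)" for i
  proof -
    have "open ((\<lambda>y. - X i + y) -` interior U)"
      by (intro open_vimage open_interior continuous_group_add continuous_on_const continuous_on_id)
    moreover have "X i \<in> (\<lambda>y. - X i + y) -` interior U" using U(2) by (simp add: unit_nbhd_def)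
    ultimately obtain d where d: "d \<in> D" "- X i + d \<in> interior U" using D(2) by blast
    then have "d = X i + (- X i + d)" "- X i + d \<in> U" using interior_subset by auto
    then have "d \<in> cell i" unfolding cell_def by blast
    then show ?thesis using d(1) by (auto simp: active_def)
  qed
  then have "UNIV \<subseteq> (\<Union>d\<in>D. active d)" by (rule subsetI)
  moreover have "countable (\<Union>d\<in>D. active d)" using D(1) by (intro countable_UN) (auto intro: countable_finite)
  ultimately show ?thesis by (rule countable_subset)
qed

text \<open>A point of a cell differs from its centre by an element of the compact \<open>U\<close>,
  on which \<open>w\<close> is at most \<open>M\<close>. Symmetry of \<open>w\<close> yields both
  directions.\<close>

lemma weight_bound:
  obtains M where "0 < M" "\<And>i y. i \<in> active y \<Longrightarrow> m (X i) \<le> M * m y" "\<And>i y. i \<in> active y \<Longrightarrow> m y \<le> M * m (X i)"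
proof -
  have "bounded (w ` U)" by (intro compact_imp_bounded compact_continuous_image w_cont U)
  then obtain M where M: "0 < M" "\<And>q. q \<in> U \<Longrightarrow> w q \<le> M"
    unfolding bounded_pos by (auto simp: abs_of_nonneg)
  show ?thesis
  proof (rule that[OF M(1)])
    fix i y assume "i \<in> active y"
    then obtain q where q: "q \<in> U" "y = X i + q" by (auto simp: active_def cell_def)
    have "m (X i) \<le> m y * w (- q)" using moderate_add[OF m, of y "- q"] by (simp add: q(2) add.assoc)
    also have "\<dots> \<le> m y * M" using M(2)[OF q(1)] by (intro mult_left_mono) auto
    finally show "m (X i) \<le> M * m y" by (simp add: mult.commute)
    have "m y \<le> m (X i) * w q" using moderate_add[OF m, of "X i" q] by (simp add: q(2))
    also have "\<dots> \<le> m (X i) * M" using M(2)[OF q(1)] by (intro mult_left_mono) auto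
    finally show "m y \<le> M * m (X i)" by (simp add: mult.commute)
  qed
qed

lemma psi_measurable [measurable]: "\<psi> i \<in> borel_measurable borel"
  and psi_nonneg [simp]: "0 \<le> \<psi> i y" and psi_le_1: "\<psi> i y \<le> 1"
  using bupu by (auto simp: bupu_def)

lemma psi_support: "{i. \<psi> i y \<noteq> 0} \<subseteq> active y"
proof
  fix i assume "i \<in> {i. \<psi> i y \<noteq> 0}"
  moreover have "y \<notin> (\<lambda>q. X i + q) ` U \<Longrightarrow> \<psi> i y = 0" using bupu by (simp add: bupu_def)
  ultimately show "i \<in> active y" by (auto simp: active_def cell_def)
qed

lemma finite_psi_support [simp]: "finite {i. \<psi> i y \<noteq> 0}"
  using finite_subset[OF psi_support] by simp

lemma psi_sum: "(\<Sum>i | \<psi> i y \<noteq> 0. \<psi> i y) = 1"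
proof -
  have "((\<lambda>i. \<psi> i y) has_sum 1) UNIV" using bupu by (simp add: bupu_def)
  then have "((\<lambda>i. \<psi> i y) has_sum 1) {i. \<psi> i y \<noteq> 0}"
    by (rule has_sum_cong_neutral[THEN iffD1, rotated 3]) auto
  then show ?thesis by (simp add: has_sum_finite_iff)
qed

lemma synthesis_measurable [measurable]: "synthesis \<psi> c \<in> borel_measurable borel"
proof -
  define A where "A n = from_nat_into (UNIV :: 'i set) ` {..n}" for n :: nat
  have fin: "finite (A n)" for n by (simp add: A_def)
  show ?thesis
  proof (rule borel_measurable_LIMSEQ_metric)
    show "(\<lambda>y. \<Sum>i\<in>A n. c i * of_real (\<psi> i y)) \<in> borel_measurable borel" for n by measurable
    show "(\<lambda>n. \<Sum>i\<in>A n. c i * of_real (\<psi> i y)) \<longlonglongrightarrow> synthesis \<psi> c y" for y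
    \<comment> \<open>At each \<open>y\<close> the partial sums are constant once the enumeration
      has passed the finitely many indices supported there.\<close>
    proof (rule tendsto_eventually)
      have "\<forall>i. \<exists>k. from_nat_into (UNIV :: 'i set) k = i"
        using from_nat_into_surj[OF countable_index] by blast
      then obtain k where k: "\<And>i. from_nat_into (UNIV :: 'i set) (k i) = i" by metis
      define n0 where "n0 = Max (insert 0 (k ` {i. \<psi> i y \<noteq> 0}))"
      have "(\<Sum>i\<in>A n. c i * of_real (\<psi> i y)) = synthesis \<psi> c y" if n: "n0 \<le> n" for n
      proof -
        have "{i. \<psi> i y \<noteq> 0} \<subseteq> A n"
        proof
          fix i assume i: "i \<in> {i. \<psi> i y \<noteq> 0}"
          then have "k i \<le> n0" unfolding n0_def by (intro Max_ge) auto
          then have "k i \<in> {..n}" using n by simp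
          then show "i \<in> A n" unfolding A_def using k[of i] by (metis image_eqI)
        qed
        then show ?thesis unfolding synthesis_def using fin
          by (intro sum.mono_neutral_right) auto
      qed
      then show "\<forall>\<^sub>F n in sequentially. (\<Sum>i\<in>A n. c i * of_real (\<psi> i y)) = synthesis \<psi> c y"
        unfolding eventually_sequentially by blast
    qed
  qed
qed

text \<open>Tonelli for counting measure and Haar measure. It is the bridge between sequence norms
  and function norms, in both directions.\<close>

lemma nn_integral_active_swap:
  fixes F :: "'i \<Rightarrow> 'g \<Rightarrow> ennreal"
  assumes F [measurable]: "\<And>i. F i \<in> borel_measurable borel"
  shows "(\<integral>\<^sup>+ i. (\<integral>\<^sup>+ y. F i y * indicator (cell i) y \<partial>\<mu>) \<partial>count_space UNIV) = (\<integral>\<^sup>+ y. (\<Sum>i\<in>active y. F i y) \<partial>\<mu>)"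
proof -
  interpret c: sigma_finite_measure "count_space (UNIV :: 'i set)"
    by (rule sigma_finite_measure_count_space_countable[OF countable_index])
  interpret p: pair_sigma_finite "count_space (UNIV :: 'i set)" \<mu> ..
  have "(\<integral>\<^sup>+ i. (\<integral>\<^sup>+ y. F i y * indicator (cell i) y \<partial>\<mu>) \<partial>count_space UNIV)
    = (\<integral>\<^sup>+ y. (\<integral>\<^sup>+ i. F i y * indicator (cell i) y \<partial>count_space UNIV) \<partial>\<mu>)"
  proof (rule p.Fubini'[symmetric])
    show "(\<lambda>(i, y). F i y * indicator (cell i) y) \<in> borel_measurable (count_space UNIV \<Otimes>\<^sub>M \<mu>)"
      by (intro measurable_pair_measure_countable1 countable_index) (simp add: measurable_haar)
  qed
  also have "\<dots> = (\<integral>\<^sup>+ y. (\<Sum>i\<in>active y. F i y) \<partial>\<mu>)"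
  proof (rule nn_integral_cong)
    fix y
    have "(\<integral>\<^sup>+ i. F i y * indicator (cell i) y \<partial>count_space UNIV) = (\<integral>\<^sup>+ i. F i y * indicator (active y) i \<partial>count_space UNIV)"
      by (intro nn_integral_cong) (simp add: indicator_def active_iff)
    also have "\<dots> = (\<Sum>i\<in>active y. F i y)"
      by (simp add: nn_integral_count_space_indicator[symmetric] nn_integral_count_space_finite)
    finally show "(\<integral>\<^sup>+ i. F i y * indicator (cell i) y \<partial>count_space UNIV) = (\<Sum>i\<in>active y. F i y)" .
  qed
  finally show ?thesis .
qed

section \<open>Comparison of sequence norms with function norms\<close>

lemma lnorm_power:
  "ennpow (lnorm r (\<lambda>i. m (X i)) c) r = (\<integral>\<^sup>+ i. ennpow (ennreal (m (X i)) * ennreal (cmod (c i))) r \<partial>count_space UNIV)"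
  using r by (simp add: lnorm_eq_pnorm pnorm_power)

lemma root_U:
  obtains b where "0 < b" "ennpow (ennreal b) r = emeasure \<mu> U"
proof -
  obtain \<beta> where \<beta>: "emeasure \<mu> U = ennreal \<beta>" "0 < \<beta>"
    using emeasure_U by (cases "emeasure \<mu> U") auto
  show ?thesis
  proof
    show "0 < \<beta> powr (1 / r)" using \<beta> by simp
    show "ennpow (ennreal (\<beta> powr (1 / r))) r = emeasure \<mu> U" using \<beta> r by (simp add: ennpow_ennreal powr_powr)
  qed
qed

text \<open>Spread \<open>c i\<close> as a constant over its cell, whose measure is that of
  \<open>U\<close>, and dominate it there by \<open>\<phi>\<close>. The constant
  \<open>n * M / b\<close> collects overlap, weight comparison and cell measure.\<close>

lemma sampling_le:
  obtains C where "0 \<le> C"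
    "\<And>c (\<phi> :: 'g \<Rightarrow> ennreal). \<phi> \<in> borel_measurable borel \<Longrightarrow> (\<And>i y. i \<in> active y \<Longrightarrow> ennreal (cmod (c i)) \<le> \<phi> y)
      \<Longrightarrow> lnorm r (\<lambda>i. m (X i)) c \<le> ennreal C * wnorm \<mu> r m \<phi>"
proof -
  obtain N :: nat where N: "\<And>y. card (active y) \<le> N" using overlap_bound by metis
  obtain M where M: "0 < M" "\<And>i y. i \<in> active y \<Longrightarrow> m (X i) \<le> M * m y" using weight_bound by metis
  obtain b where b: "0 < b" "ennpow (ennreal b) r = emeasure \<mu> U" using root_U .
  \<comment> \<open>The r-th root of the overlap bound, since at each point at most \<open>N\<close>
    equal r-th powers are added.\<close>
  define n where "n = real N powr (1 / r)"
  have n: "0 \<le> n" "ennpow (ennreal n) r = of_nat N"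
    using r by (simp_all add: n_def ennpow_ennreal powr_powr ennreal_of_nat_eq_real_of_nat)
  have "lnorm r (\<lambda>i. m (X i)) c \<le> ennreal (n * M / b) * wnorm \<mu> r m \<phi>"
    if [measurable]: "\<phi> \<in> borel_measurable borel" and le: "\<And>i y. i \<in> active y \<Longrightarrow> ennreal (cmod (c i)) \<le> \<phi> y" for c and \<phi> :: "'g \<Rightarrow> ennreal"
  proof -
    let ?a = "\<lambda>i. ennpow (ennreal (m (X i)) * ennreal (cmod (c i))) r"
    let ?L = "lnorm r (\<lambda>i. m (X i)) c"
    have "ennpow (ennreal b * ?L) r = emeasure \<mu> U * ennpow ?L r" by (simp add: ennpow_mult b)
    also have "\<dots> = (\<integral>\<^sup>+ i. emeasure \<mu> U * ?a i \<partial>count_space UNIV)"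
      unfolding lnorm_power by (rule nn_integral_cmult[symmetric]) simp
    also have "\<dots> = (\<integral>\<^sup>+ i. (\<integral>\<^sup>+ y. ?a i * indicator (cell i) y \<partial>\<mu>) \<partial>count_space UNIV)"
      by (intro nn_integral_cong, subst nn_integral_cmult_indicator) (simp_all add: emeasure_cell mult.commute)
    also have "\<dots> = (\<integral>\<^sup>+ y. (\<Sum>i\<in>active y. ?a i) \<partial>\<mu>)"
      by (rule nn_integral_active_swap) simp
    also have "\<dots> \<le> (\<integral>\<^sup>+ y. of_nat N * ennpow (ennreal M * (ennreal (m y) * \<phi> y)) r \<partial>\<mu>)"
    proof (rule nn_integral_mono)
      fix y
      have "(\<Sum>i\<in>active y. ?a i) \<le> of_nat (card (active y)) * ennpow (ennreal M * (ennreal (m y) * \<phi> y)) r"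
      proof (rule sum_bounded_above)
        fix i assume i: "i \<in> active y"
        have "ennreal (m (X i)) * ennreal (cmod (c i)) \<le> ennreal (M * m y) * \<phi> y"
          by (intro mult_mono ennreal_leI M le i) auto
        then show "?a i \<le> ennpow (ennreal M * (ennreal (m y) * \<phi> y)) r"
          using r M(1) by (intro ennpow_mono) (auto simp: ennreal_mult mult.assoc)
      qed
      also have "\<dots> \<le> of_nat N * ennpow (ennreal M * (ennreal (m y) * \<phi> y)) r"
        using N by (intro mult_right_mono) auto
      finally show "(\<Sum>i\<in>active y. ?a i) \<le> \<dots>" .
    qed
    also have "\<dots> = ennpow (ennreal n * (ennreal M * wnorm \<mu> r m \<phi>)) r"
      using r by (simp add: ennpow_mult n nn_integral_cmult wnorm_eq_pnorm pnorm_power)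
    finally have "ennreal b * ?L \<le> ennreal n * (ennreal M * wnorm \<mu> r m \<phi>)"
      using r by (simp add: ennpow_le_cancel)
    then have "ennreal (1 / b) * (ennreal b * ?L) \<le> ennreal (1 / b) * (ennreal n * (ennreal M * wnorm \<mu> r m \<phi>))"
      by (rule mult_left_mono) simp
    then show ?thesis
      using b n M by (simp add: mult.assoc[symmetric] ennreal_mult[symmetric])
  qed
  moreover have "0 \<le> n * M / b" using n M b by simp
  ultimately show ?thesis using that by metis
qed

text \<open>At each \<open>y\<close> at most \<open>N\<close> coefficients contribute, each with a
  factor at most 1. The constant is overlap times weight comparison times the r-th root of the cell
  measure.\<close>

lemma synthesis_le:
  obtains C where "0 \<le> C" "\<And>c. Lnorm \<mu> r m (synthesis \<psi> c) \<le> ennreal C * lnorm r (\<lambda>i. m (X i)) c"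
proof -
  obtain N :: nat where N: "\<And>y. card (active y) \<le> N" using overlap_bound by metis
  obtain M where M: "0 < M" "\<And>i y. i \<in> active y \<Longrightarrow> m y \<le> M * m (X i)" using weight_bound by metis
  obtain b where b: "0 < b" "ennpow (ennreal b) r = emeasure \<mu> U" using root_U .
  have "Lnorm \<mu> r m (synthesis \<psi> c) \<le> ennreal (real N * M * b) * lnorm r (\<lambda>i. m (X i)) c" for c
  proof -
    let ?a = "\<lambda>i. ennreal (m (X i)) * ennreal (cmod (c i))"
    have pt: "ennreal (m y) * ennreal (cmod (synthesis \<psi> c y)) \<le> (\<Sum>i\<in>active y. ennreal M * ?a i)" for y
    proof -
      have "cmod (synthesis \<psi> c y) \<le> (\<Sum>i | \<psi> i y \<noteq> 0. cmod (c i))"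
        unfolding synthesis_def
        by (intro order_trans[OF norm_sum] sum_mono) (simp add: norm_mult mult_left_le psi_le_1)
      also have "\<dots> \<le> (\<Sum>i\<in>active y. cmod (c i))"
        by (intro sum_mono2 psi_support) auto
      finally have "m y * cmod (synthesis \<psi> c y) \<le> (\<Sum>i\<in>active y. m y * cmod (c i))"
        by (simp add: sum_distrib_left[symmetric] mult_left_mono)
      also have "\<dots> \<le> (\<Sum>i\<in>active y. M * (m (X i) * cmod (c i)))"
        by (intro sum_mono) (simp add: mult.assoc[symmetric] mult_right_mono M)
      finally have "ennreal (m y * cmod (synthesis \<psi> c y)) \<le> ennreal (\<Sum>i\<in>active y. M * (m (X i) * cmod (c i)))"
        by (rule ennreal_leI)
      then show ?thesis using M(1) by (simp add: sum_ennreal[symmetric] ennreal_mult)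
    qed
    have "ennpow (Lnorm \<mu> r m (synthesis \<psi> c)) r = (\<integral>\<^sup>+ y. ennpow (ennreal (m y) * ennreal (cmod (synthesis \<psi> c y))) r \<partial>\<mu>)"
      using r by (simp add: Lnorm_def wnorm_eq_pnorm pnorm_power)
    also have "\<dots> \<le> (\<integral>\<^sup>+ y. (\<Sum>i\<in>active y. ennpow (of_nat N * ennreal M) r * ennpow (?a i) r) \<partial>\<mu>)"
    proof (rule nn_integral_mono)
      fix y
      have "ennpow (ennreal (m y) * ennreal (cmod (synthesis \<psi> c y))) r \<le> ennpow (\<Sum>i\<in>active y. ennreal M * ?a i) r"
        using r pt by (intro ennpow_mono) auto
      also have "\<dots> \<le> ennpow (of_nat (card (active y))) r * (\<Sum>i\<in>active y. ennpow (ennreal M * ?a i) r)"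
        using r by (intro ennpow_sum_le) auto
      also have "\<dots> \<le> ennpow (of_nat N) r * (\<Sum>i\<in>active y. ennpow (ennreal M * ?a i) r)"
        using r N by (intro mult_right_mono ennpow_mono) auto
      also have "\<dots> = (\<Sum>i\<in>active y. ennpow (of_nat N * ennreal M) r * ennpow (?a i) r)"
        by (simp add: ennpow_mult sum_distrib_left mult.assoc)
      finally show "ennpow (ennreal (m y) * ennreal (cmod (synthesis \<psi> c y))) r \<le> \<dots>" .
    qed
    also have "\<dots> = (\<integral>\<^sup>+ i. (\<integral>\<^sup>+ y. (ennpow (of_nat N * ennreal M) r * ennpow (?a i) r) * indicator (cell i) y \<partial>\<mu>) \<partial>count_space UNIV)"
      by (rule nn_integral_active_swap[symmetric]) simp
    also have "\<dots> = (\<integral>\<^sup>+ i. (ennpow (of_nat N * ennreal M) r * emeasure \<mu> U) * ennpow (?a i) r \<partial>count_space UNIV)"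
      by (intro nn_integral_cong, subst nn_integral_cmult_indicator) (simp_all add: emeasure_cell mult_ac)
    also have "\<dots> = ennpow (of_nat N * ennreal M) r * emeasure \<mu> U * ennpow (lnorm r (\<lambda>i. m (X i)) c) r"
      by (simp add: nn_integral_cmult lnorm_power)
    also have "\<dots> = ennpow (of_nat N * ennreal M * ennreal b * lnorm r (\<lambda>i. m (X i)) c) r"
      by (simp add: ennpow_mult b)
    also have "of_nat N * ennreal M * ennreal b = ennreal (real N * M * b)"
      using M b by (simp add: ennreal_mult ennreal_of_nat_eq_real_of_nat)
    finally show ?thesis using r by (simp add: ennpow_le_cancel)
  qed
  moreover have "0 \<le> real N * M * b" using M b by simp
  ultimately show ?thesis using that by metis
qed

text \<open>The supremum runs over a possibly uncountable set, but \<open>f\<close> is continuous,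
  so the oscillation is lower semicontinuous: its superlevel sets are unions of open sets.\<close>

lemma osc_measurable:
  assumes f: "f \<in> Mspace \<mu> K r m"
  shows "osc A f \<in> borel_measurable borel"
proof (rule borel_measurableI_greater)
  fix a :: ennreal
  have cont: "continuous_on UNIV f" by (rule Mspace_continuous[OF r m f])
  have "{y \<in> space borel. a < osc A f y} = (\<Union>q\<in>A. {y. a < ennreal (cmod (f (y + q) - f y))})"
    by (auto simp: osc_def less_SUP_iff)
  also have "\<dots> \<in> sets borel"
  proof (intro borel_open open_UN ballI open_Collect_less continuous_on_const)
    fix q
    have "continuous_on UNIV (\<lambda>y. f (y + q))"
      by (rule continuous_on_compose2[OF cont continuous_group_add[OF continuous_on_id continuous_on_const]]) auto
    then show "continuous_on UNIV (\<lambda>y. ennreal (cmod (f (y + q) - f y)))"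
      by (intro continuous_on_ennreal continuous_on_norm continuous_on_diff cont)
  qed
  finally show "{y \<in> space borel. a < osc A f y} \<in> sets borel" .
qed

text \<open>From \<open>y = X i + q\<close> follows \<open>X i = y + - q\<close>, which is why the
  right oscillation is taken over U^{-1}.\<close>

lemma diff_le_osc:
  assumes i: "i \<in> active y"
  shows "ennreal (cmod (f (X i) - f y)) \<le> osc (uminus ` U) f y"
proof -
  obtain q where q: "q \<in> U" "y = X i + q" using i by (auto simp: active_def cell_def)
  have "X i = y + - q" by (simp add: q(2) add.assoc)
  then show ?thesis unfolding osc_def using q(1) by (intro SUP_upper2[of "- q"]) auto
qed

lemma Mspace_iff: "f \<in> Mspace \<mu> K r m \<longleftrightarrow> f \<in> borel_measurable borel \<and> Lnorm \<mu> r m f < \<infinity> \<and> conv \<mu> f K = f"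
  by (auto simp: Mspace_def Lspace_iff[OF r m])

text \<open>A sample is at most \<open>cmod (f y)\<close> plus the oscillation at any
  \<open>y\<close> of its cell, so \<open>sampling_le\<close> applies with this sum as majorant. The
  two terms give the factor \<open>1 + \<epsilon>\<close>.\<close>

lemma samples_le:
  obtains C where "0 \<le> C" "\<And>f. f \<in> Mspace \<mu> K r m \<Longrightarrow> lnorm r (\<lambda>i. m (X i)) (\<lambda>i. f (X i)) \<le> ennreal C * Lnorm \<mu> r m f"
proof -
  obtain C where C: "0 \<le> C"
    "\<And>c (\<phi> :: 'g \<Rightarrow> ennreal). \<phi> \<in> borel_measurable borel \<Longrightarrow> (\<And>i y. i \<in> active y \<Longrightarrow> ennreal (cmod (c i)) \<le> \<phi> y)
      \<Longrightarrow> lnorm r (\<lambda>i. m (X i)) c \<le> ennreal C * wnorm \<mu> r m \<phi>"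
    using sampling_le by blast
  have "lnorm r (\<lambda>i. m (X i)) (\<lambda>i. f (X i)) \<le> ennreal (C * (1 + \<epsilon>)) * Lnorm \<mu> r m f" if f: "f \<in> Mspace \<mu> K r m" for f
  proof -
    have [measurable]: "f \<in> borel_measurable borel" "osc (uminus ` U) f \<in> borel_measurable borel"
      using f osc_measurable[OF f] by (auto simp: Mspace_iff)
    let ?\<phi> = "\<lambda>y. ennreal (cmod (f y)) + osc (uminus ` U) f y"
    have "lnorm r (\<lambda>i. m (X i)) (\<lambda>i. f (X i)) \<le> ennreal C * wnorm \<mu> r m ?\<phi>"
    proof (rule C(2))
      fix i y assume i: "i \<in> active y"
      have "cmod (f (X i)) \<le> cmod (f y) + cmod (f (X i) - f y)"
        by (metis add.commute norm_triangle_sub)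
      then have "ennreal (cmod (f (X i))) \<le> ennreal (cmod (f y)) + ennreal (cmod (f (X i) - f y))"
        by (simp add: ennreal_plus[symmetric] del: ennreal_plus)
      also have "\<dots> \<le> ?\<phi> y" by (intro add_left_mono diff_le_osc i)
      finally show "ennreal (cmod (f (X i))) \<le> ?\<phi> y" .
    qed measurable
    also have "wnorm \<mu> r m ?\<phi> \<le> Lnorm \<mu> r m f + wnorm \<mu> r m (osc (uminus ` U) f)"
      unfolding Lnorm_def wnorm_eq_pnorm distrib_left using r
      by (intro Minkowski_pnorm) (auto simp: measurable_haar)
    also have "\<dots> \<le> Lnorm \<mu> r m f + ennreal \<epsilon> * Lnorm \<mu> r m f"
      by (intro add_left_mono osc_le f)
    also have "\<dots> = ennreal (1 + \<epsilon>) * Lnorm \<mu> r m f"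
      using \<epsilon> by (simp add: ennreal_plus distrib_right)
    finally show ?thesis using C(1) \<epsilon> by (simp add: ennreal_mult mult.assoc mult_left_mono)
  qed
  moreover have "0 \<le> C * (1 + \<epsilon>)" using C \<epsilon> by simp
  ultimately show ?thesis using that by metis
qed

text \<open>The \<open>\<psi> i\<close> sum to 1, so the difference at \<open>y\<close> is an
  average of the \<open>f y - f (X i)\<close> over cells containing \<open>y\<close>, each at most
  the oscillation.\<close>

lemma diff_synthesis_le:
  assumes f: "f \<in> Mspace \<mu> K r m"
  shows "Lnorm \<mu> r m (\<lambda>y. f y - synthesis \<psi> (\<lambda>i. f (X i)) y) \<le> ennreal \<epsilon> * Lnorm \<mu> r m f"
proof -
  have "ennreal (cmod (f y - synthesis \<psi> (\<lambda>i. f (X i)) y)) \<le> osc (uminus ` U) f y" for y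
  proof -
    let ?I = "{i. \<psi> i y \<noteq> 0}"
    have "f y = (\<Sum>i\<in>?I. f y * of_real (\<psi> i y))"
      unfolding sum_distrib_left[symmetric] of_real_sum[symmetric] psi_sum by simp
    then have "f y - synthesis \<psi> (\<lambda>i. f (X i)) y = (\<Sum>i\<in>?I. (f y - f (X i)) * of_real (\<psi> i y))"
      by (simp add: synthesis_def left_diff_distrib sum_subtractf)
    also have "cmod \<dots> \<le> (\<Sum>i\<in>?I. cmod (f (X i) - f y) * \<psi> i y)"
      by (rule order_trans[OF norm_sum]) (simp add: norm_mult norm_minus_commute)
    finally have "ennreal (cmod (f y - synthesis \<psi> (\<lambda>i. f (X i)) y)) \<le> ennreal (\<Sum>i\<in>?I. cmod (f (X i) - f y) * \<psi> i y)"
      by (rule ennreal_leI)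
    also have "\<dots> = (\<Sum>i\<in>?I. ennreal (cmod (f (X i) - f y)) * ennreal (\<psi> i y))"
      by (simp add: sum_ennreal[symmetric] ennreal_mult)
    also have "\<dots> \<le> (\<Sum>i\<in>?I. osc (uminus ` U) f y * ennreal (\<psi> i y))"
      using psi_support by (intro sum_mono mult_right_mono diff_le_osc) auto
    also have "\<dots> = osc (uminus ` U) f y * ennreal (\<Sum>i\<in>?I. \<psi> i y)"
      by (simp add: sum_distrib_left[symmetric])
    also have "\<dots> = osc (uminus ` U) f y" unfolding psi_sum by simp
    finally show ?thesis .
  qed
  then have "Lnorm \<mu> r m (\<lambda>y. f y - synthesis \<psi> (\<lambda>i. f (X i)) y) \<le> wnorm \<mu> r m (osc (uminus ` U) f)"
    unfolding Lnorm_def wnorm_eq_pnorm using r by (intro pnorm_mono mult_left_mono) auto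
  also have "\<dots> \<le> ennreal \<epsilon> * Lnorm \<mu> r m f" by (rule osc_le[OF f])
  finally show ?thesis .
qed

text \<open>An infinite norm times the positive \<open>\<epsilon>\<close> would be infinite, against
  \<open>small\<close>.\<close>

lemma rc_opnorm_finite: "rc_opnorm \<mu> K r m < \<infinity>"
  using small \<epsilon> by (cases "rc_opnorm \<mu> K r m") (auto simp: ennreal_top_mult)

lemma Lnorm_conv_le:
  assumes f: "f \<in> Lspace \<mu> r m"
  shows "Lnorm \<mu> r m (conv \<mu> f K) \<le> rc_opnorm \<mu> K r m * Lnorm \<mu> r m f"
proof (cases "Lnorm \<mu> r m f = 0")
  \<comment> \<open>The supremum in \<open>rc_opnorm\<close> ranges over nonzero norms. For
    \<open>f\<close> of norm 0 the bounded point evaluations force the convolution to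
    vanish.\<close>
  case True
  have "conv \<mu> f K x = 0" for x
  proof -
    obtain c where "ennreal (cmod (conv \<mu> f K x)) \<le> ennreal c * Lnorm \<mu> r m f"
      using conv_point_bound[OF r m, of x] f by metis
    then show ?thesis by (simp add: True)
  qed
  then show ?thesis by (simp add: Lnorm_def wnorm_eq_pnorm)
next
  case False
  have fin: "Lnorm \<mu> r m f < \<infinity>" using f by (simp add: Lspace_def)
  have "Lnorm \<mu> r m (conv \<mu> f K) / Lnorm \<mu> r m f \<le> rc_opnorm \<mu> K r m"
    unfolding rc_opnorm_def using f False by (intro SUP_upper) auto
  then have "Lnorm \<mu> r m (conv \<mu> f K) / Lnorm \<mu> r m f * Lnorm \<mu> r m f \<le> rc_opnorm \<mu> K r m * Lnorm \<mu> r m f"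
    by (rule mult_right_mono) simp
  then show ?thesis using False fin
    by (simp add: ennreal_divide_times mult_divide_eq_ennreal less_top)
qed

end

section \<open>Neumann series\<close>

definition residual where
  "residual \<mu> K X \<psi> f x = f x - conv \<mu> (synthesis \<psi> (\<lambda>i. f (X i))) K x"

text \<open>The Neumann series is summed pointwise so that the operator does not mention \<open>(r, m)\<close>.\<close>

definition reconstruction where
  "reconstruction \<mu> K X \<psi> c x = (\<Sum>n. (residual \<mu> K X \<psi> ^^ n) (conv \<mu> (synthesis \<psi> c) K) x)"

context coorbit_sampling begin

abbreviation "M \<equiv> Mspace \<mu> K r m"
abbreviation "L \<equiv> Lspace \<mu> r m"
abbreviation "\<Lambda> \<equiv> lspace r (\<lambda>i. m (X i))"
abbreviation "Res \<equiv> residual \<mu> K X \<psi>"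
abbreviation "nrm \<equiv> Lnorm \<mu> r m"

section \<open>Linearity and invariance of the reproducing space\<close>

lemma Lnorm_lincomb:
  assumes "f \<in> borel_measurable borel" "g \<in> borel_measurable borel"
  shows "nrm (\<lambda>x. a * f x + b * g x) \<le> ennreal (cmod a) * nrm f + ennreal (cmod b) * nrm g"
  using Lnorm_add_le[of "\<lambda>x. a * f x" \<mu> "\<lambda>x. b * g x" m r] Lnorm_cmult[of r f \<mu> m a] Lnorm_cmult[of r g \<mu> m b] assms r
  by (simp add: measurable_haar)

lemma Lspace_lincomb:
  assumes "f \<in> L" "g \<in> L"
  shows "(\<lambda>x. a * f x + b * g x) \<in> L"
  using assms le_less_trans[OF Lnorm_lincomb[of f g a b]]
  by (auto simp: Lspace_iff[OF r m] ennreal_mult_less_top)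

lemma conv_lincomb:
  assumes "f \<in> L" "g \<in> L"
  shows "conv \<mu> (\<lambda>x. a * f x + b * g x) K = (\<lambda>x. a * conv \<mu> f K x + b * conv \<mu> g K x)"
proof
  fix x
  have "(\<lambda>y. (a * f y + b * g y) * K (- y + x)) = (\<lambda>y. a * (f y * K (- y + x)) + b * (g y * K (- y + x)))"
    by (auto simp: distrib_right mult.assoc)
  then show "conv \<mu> (\<lambda>x. a * f x + b * g x) K x = a * conv \<mu> f K x + b * conv \<mu> g K x"
    using integrable_conv_kernel[OF r m assms(1)] integrable_conv_kernel[OF r m assms(2)]
    by (simp add: conv_def)
qed

lemma Mspace_subset: "f \<in> M \<Longrightarrow> f \<in> L"
  by (simp add: Mspace_def)

lemma conv_Mspace: "f \<in> L \<Longrightarrow> conv \<mu> f K \<in> M"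
  by (rule conv_in_Mspace[OF r m _ conv_Lspace])

lemma Mspace_conv_eq: "f \<in> M \<Longrightarrow> conv \<mu> f K = f"
  by (simp add: Mspace_iff)

lemma synthesis_lincomb: "synthesis \<psi> (\<lambda>i. a * c i + b * d i) = (\<lambda>y. a * synthesis \<psi> c y + b * synthesis \<psi> d y)"
  by (rule ext) (simp add: synthesis_def sum_distrib_left sum.distrib distrib_right mult.assoc)

lemma synthesis_Lspace: "c \<in> \<Lambda> \<Longrightarrow> synthesis \<psi> c \<in> L"
proof -
  assume c: "c \<in> \<Lambda>"
  obtain C where "nrm (synthesis \<psi> c) \<le> ennreal C * lnorm r (\<lambda>i. m (X i)) c" using synthesis_le by metis
  also have "\<dots> < \<infinity>" using c by (simp add: lspace_def ennreal_mult_less_top)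
  finally show ?thesis by (simp add: Lspace_iff[OF r m])
qed

lemma samples_lspace: "f \<in> M \<Longrightarrow> (\<lambda>i. f (X i)) \<in> \<Lambda>"
proof -
  assume f: "f \<in> M"
  obtain C where "lnorm r (\<lambda>i. m (X i)) (\<lambda>i. f (X i)) \<le> ennreal C * nrm f" using samples_le f by metis
  also have "\<dots> < \<infinity>" using f by (simp add: Mspace_iff ennreal_mult_less_top)
  finally show ?thesis by (simp add: lspace_def)
qed

text \<open>Since \<open>f\<close> is its own convolution with \<open>K\<close>, the convolution can
  be pulled over the whole difference, to which the oscillation estimate applies.\<close>

lemma residual_eq_conv:
  assumes f: "f \<in> M"
  shows "Res f = conv \<mu> (\<lambda>y. f y - synthesis \<psi> (\<lambda>i. f (X i)) y) K"
    and "(\<lambda>y. f y - synthesis \<psi> (\<lambda>i. f (X i)) y) \<in> L"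
  using conv_lincomb[OF Mspace_subset[OF f] synthesis_Lspace[OF samples_lspace[OF f]], of 1 "-1"]
    Lspace_lincomb[OF Mspace_subset[OF f] synthesis_Lspace[OF samples_lspace[OF f]], of 1 "-1"] Mspace_conv_eq[OF f]
  by (simp_all add: residual_def[abs_def])

lemma residual_Mspace: "f \<in> M \<Longrightarrow> Res f \<in> M"
  by (simp add: residual_eq_conv conv_Mspace)

lemma residual_lincomb:
  assumes "f \<in> M" "g \<in> M"
  shows "Res (\<lambda>x. a * f x + b * g x) = (\<lambda>x. a * Res f x + b * Res g x)"
  by (rule ext) (simp add: residual_def synthesis_lincomb conv_lincomb synthesis_Lspace samples_lspace assms algebra_simps)

lemma residual_iterate_Mspace: "f \<in> M \<Longrightarrow> (Res ^^ n) f \<in> M"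
  by (induction n) (auto intro: residual_Mspace)

lemma residual_iterate_lincomb:
  assumes "f \<in> M" "g \<in> M"
  shows "(Res ^^ n) (\<lambda>x. a * f x + b * g x) = (\<lambda>x. a * (Res ^^ n) f x + b * (Res ^^ n) g x)"
  by (induction n) (simp_all add: residual_lincomb residual_iterate_Mspace assms)

section \<open>Geometric decay of the iterates and their sum\<close>

definition \<rho> :: real where "\<rho> = enn2real (rc_opnorm \<mu> K r m)"
definition \<gamma> :: real where "\<gamma> = \<rho> * \<epsilon>"

lemma rho: "0 \<le> \<rho>" "rc_opnorm \<mu> K r m = ennreal \<rho>"
  using rc_opnorm_finite by (auto simp: \<rho>_def)

lemma gamma: "0 \<le> \<gamma>" "\<gamma> < 1"
proof -
  show "0 \<le> \<gamma>" using rho(1) \<epsilon> by (simp add: \<gamma>_def)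
  have "ennreal \<gamma> < ennreal 1" using small rho \<epsilon> by (simp add: \<gamma>_def ennreal_mult)
  then show "\<gamma> < 1" by (subst (asm) ennreal_less_iff) (use \<open>0 \<le> \<gamma>\<close> in auto)
qed

lemma Lnorm_residual_le: "f \<in> M \<Longrightarrow> nrm (Res f) \<le> ennreal \<gamma> * nrm f"
proof -
  assume f: "f \<in> M"
  have "nrm (Res f) \<le> ennreal \<rho> * nrm (\<lambda>y. f y - synthesis \<psi> (\<lambda>i. f (X i)) y)"
    using Lnorm_conv_le[OF residual_eq_conv(2)[OF f]] by (simp add: residual_eq_conv(1)[OF f] rho)
  also have "\<dots> \<le> ennreal \<rho> * (ennreal \<epsilon> * nrm f)" by (intro mult_left_mono diff_synthesis_le f) simp
  also have "\<dots> = ennreal \<gamma> * nrm f" using rho(1) \<epsilon> by (simp add: \<gamma>_def ennreal_mult mult.assoc)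
  finally show ?thesis .
qed

lemma Lnorm_residual_iterate_le: "f \<in> M \<Longrightarrow> nrm ((Res ^^ n) f) \<le> ennreal (\<gamma> ^ n) * nrm f"
proof (induction n)
  case (Suc n)
  have "nrm ((Res ^^ Suc n) f) \<le> ennreal \<gamma> * nrm ((Res ^^ n) f)"
    using Lnorm_residual_le[OF residual_iterate_Mspace[OF Suc.prems]] by simp
  also have "\<dots> \<le> ennreal \<gamma> * (ennreal (\<gamma> ^ n) * nrm f)" by (intro mult_left_mono Suc) simp
  also have "\<dots> = ennreal (\<gamma> ^ Suc n) * nrm f" using gamma by (simp add: ennreal_mult mult.assoc)
  finally show ?case .
qed simp

lemma Mspace_norm_real:
  assumes "f \<in> M"
  obtains G where "0 \<le> G" "nrm f = ennreal G"
  using assms by (cases "nrm f") (auto simp: Mspace_iff)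

text \<open>Every iterate lies in \<open>M\<close> and equals its own convolution, so the bounded
  point evaluation transfers the geometric decay of the norms to values at \<open>x\<close>.\<close>

lemma residual_iterate_point_bound:
  assumes f: "f \<in> M"
  obtains B where "0 \<le> B" "\<And>n. cmod ((Res ^^ n) f x) \<le> B * \<gamma> ^ n"
proof -
  obtain c where c: "0 \<le> c" "\<And>f. f \<in> L \<Longrightarrow> ennreal (cmod (conv \<mu> f K x)) \<le> ennreal c * nrm f"
    using conv_point_bound[OF r m, of x] by metis
  obtain G where G: "0 \<le> G" "nrm f = ennreal G" using Mspace_norm_real[OF f] .
  have "cmod ((Res ^^ n) f x) \<le> c * G * \<gamma> ^ n" for n
  proof -
    note h = residual_iterate_Mspace[OF f, of n]
    have "ennreal (cmod ((Res ^^ n) f x)) \<le> ennreal c * nrm ((Res ^^ n) f)"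
      using c(2)[OF Mspace_subset[OF h]] by (simp add: Mspace_conv_eq[OF h])
    also have "\<dots> \<le> ennreal c * (ennreal (\<gamma> ^ n) * nrm f)" by (intro mult_left_mono Lnorm_residual_iterate_le f) simp
    also have "\<dots> = ennreal (c * G * \<gamma> ^ n)" using c G gamma by (simp add: ennreal_mult mult_ac)
    finally show ?thesis using c G gamma by (simp add: ennreal_le_iff)
  qed
  then show ?thesis using that[of "c * G"] c G by simp
qed

lemma summable_residual_iterates: "f \<in> M \<Longrightarrow> summable (\<lambda>n. (Res ^^ n) f x)"
proof -
  assume f: "f \<in> M"
  obtain B where B: "\<And>n. cmod ((Res ^^ n) f x) \<le> B * \<gamma> ^ n" using residual_iterate_point_bound[OF f] by metis
  have "summable (\<lambda>n. B * \<gamma> ^ n)" using gamma by (intro summable_mult summable_geometric) simp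
  then show ?thesis using B by (rule summable_comparison_test'[where N = 0])
qed

text \<open>Minkowski bounds the partial sums by a geometric sum, and Fatou passes the bound to the
  pointwise limit.\<close>

lemma Neumann_series_Lnorm_le:
  assumes f: "f \<in> M"
  shows "(\<lambda>x. \<Sum>n. (Res ^^ n) f x) \<in> L" and "nrm (\<lambda>x. \<Sum>n. (Res ^^ n) f x) \<le> ennreal (1 / (1 - \<gamma>)) * nrm f"
proof -
  let ?s = "\<lambda>n x. \<Sum>k<n. (Res ^^ k) f x"
  have hm [measurable]: "(Res ^^ n) f \<in> borel_measurable borel" for n
    using residual_iterate_Mspace[OF f, of n] by (simp add: Mspace_iff)
  obtain G where G: "0 \<le> G" "nrm f = ennreal G" using Mspace_norm_real[OF f] .
  have s_le: "nrm (?s n) \<le> ennreal ((\<Sum>k<n. \<gamma> ^ k) * G)" for n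
  proof (induction n)
    case 0
    then show ?case by (simp add: Lnorm_def wnorm_eq_pnorm)
  next
    case (Suc n)
    have "nrm (?s (Suc n)) \<le> nrm (?s n) + nrm ((Res ^^ n) f)"
      using Lnorm_add_le[of "?s n" \<mu> "(Res ^^ n) f" m r] r by (simp add: measurable_haar)
    also have "\<dots> \<le> ennreal ((\<Sum>k<n. \<gamma> ^ k) * G) + ennreal (\<gamma> ^ n) * ennreal G"
      using Lnorm_residual_iterate_le[OF f, of n] by (intro add_mono Suc) (simp add: G)
    also have "\<dots> = ennreal ((\<Sum>k<Suc n. \<gamma> ^ k) * G)"
      using gamma G by (simp add: distrib_right ennreal_mult sum_nonneg ennreal_plus)
    finally show ?case .
  qed
  have "(\<Sum>k<n. \<gamma> ^ k) \<le> 1 / (1 - \<gamma>)" for n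
  proof -
    have "(\<Sum>k<n. \<gamma> ^ k) \<le> (\<Sum>k. \<gamma> ^ k)"
      using gamma by (intro sum_le_suminf summable_geometric) auto
    also have "\<dots> = 1 / (1 - \<gamma>)" using gamma by (intro suminf_geometric) simp
    finally show ?thesis .
  qed
  then have s_le': "nrm (?s n) \<le> ennreal (1 / (1 - \<gamma>) * G)" for n
    using G by (intro order_trans[OF s_le] ennreal_leI mult_right_mono)
  have "pnorm \<mu> r (\<lambda>x. ennreal (m x * cmod (\<Sum>n. (Res ^^ n) f x))) \<le> ennreal (1 / (1 - \<gamma>) * G)"
  proof (rule Fatou_pnorm)
    show "(\<lambda>n. m x * cmod (?s n x)) \<longlonglongrightarrow> m x * cmod (\<Sum>n. (Res ^^ n) f x)" for x
      by (intro tendsto_intros summable_LIMSEQ summable_residual_iterates f)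
    show "pnorm \<mu> r (\<lambda>x. ennreal (m x * cmod (?s n x))) \<le> ennreal (1 / (1 - \<gamma>) * G)" for n
      using s_le'[of n] by (simp add: Lnorm_eq_pnorm)
  qed (use r in \<open>auto simp: measurable_haar\<close>)
  then have le: "nrm (\<lambda>x. \<Sum>n. (Res ^^ n) f x) \<le> ennreal (1 / (1 - \<gamma>) * G)"
    by (simp add: Lnorm_eq_pnorm)
  then show "nrm (\<lambda>x. \<Sum>n. (Res ^^ n) f x) \<le> ennreal (1 / (1 - \<gamma>)) * nrm f"
    using gamma G by (simp add: ennreal_mult[symmetric])
  show "(\<lambda>x. \<Sum>n. (Res ^^ n) f x) \<in> L"
    unfolding Lspace_iff[OF r m]
  proof
    show "(\<lambda>x. \<Sum>n. (Res ^^ n) f x) \<in> borel_measurable borel"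
      by (rule borel_measurable_suminf) measurable
    show "nrm (\<lambda>x. \<Sum>n. (Res ^^ n) f x) < \<infinity>" using le by (rule le_less_trans) simp
  qed
qed

section \<open>The reconstruction operator on sequences\<close>

lemma synthesis_conv_Mspace: "c \<in> \<Lambda> \<Longrightarrow> conv \<mu> (synthesis \<psi> c) K \<in> M"
  by (intro conv_Mspace synthesis_Lspace)

lemma reconstruction_Lspace: "c \<in> \<Lambda> \<Longrightarrow> reconstruction \<mu> K X \<psi> c \<in> L"
  using Neumann_series_Lnorm_le(1)[OF synthesis_conv_Mspace] by (simp add: reconstruction_def[abs_def])

lemma reconstruction_lincomb:
  assumes c: "c \<in> \<Lambda>" and d: "d \<in> \<Lambda>"
  shows "reconstruction \<mu> K X \<psi> (\<lambda>i. a * c i + b * d i)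
    = (\<lambda>x. a * reconstruction \<mu> K X \<psi> c x + b * reconstruction \<mu> K X \<psi> d x)"
proof
  fix x
  let ?c = "conv \<mu> (synthesis \<psi> c) K" and ?d = "conv \<mu> (synthesis \<psi> d) K"
  have "conv \<mu> (synthesis \<psi> (\<lambda>i. a * c i + b * d i)) K = (\<lambda>x. a * ?c x + b * ?d x)"
    unfolding synthesis_lincomb by (intro conv_lincomb synthesis_Lspace c d)
  then have "reconstruction \<mu> K X \<psi> (\<lambda>i. a * c i + b * d i) x = (\<Sum>n. a * (Res ^^ n) ?c x + b * (Res ^^ n) ?d x)"
    by (simp add: reconstruction_def residual_iterate_lincomb synthesis_conv_Mspace c d)
  also have "\<dots> = (\<Sum>n. a * (Res ^^ n) ?c x) + (\<Sum>n. b * (Res ^^ n) ?d x)"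
    by (intro suminf_add[symmetric] summable_mult summable_residual_iterates synthesis_conv_Mspace c d)
  also have "\<dots> = a * reconstruction \<mu> K X \<psi> c x + b * reconstruction \<mu> K X \<psi> d x"
    unfolding reconstruction_def
    by (subst (1 2) suminf_mult) (auto intro!: summable_residual_iterates synthesis_conv_Mspace c d)
  finally show "reconstruction \<mu> K X \<psi> (\<lambda>i. a * c i + b * d i) x
    = a * reconstruction \<mu> K X \<psi> c x + b * reconstruction \<mu> K X \<psi> d x" .
qed

text \<open>For samples of \<open>f\<close> the initial term is \<open>f - Res f\<close>, so the
  series telescopes; the remainder tends to 0 as the general term of a summable series.\<close>

lemma reconstruction_samples:
  assumes f: "f \<in> M"
  shows "reconstruction \<mu> K X \<psi> (\<lambda>i. f (X i)) = f"
proof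
  fix x
  let ?g = "conv \<mu> (synthesis \<psi> (\<lambda>i. f (X i))) K"
  have g: "?g = (\<lambda>x. 1 * f x + (- 1) * Res f x)" by (rule ext) (simp add: residual_def)
  have "(Res ^^ n) ?g = (\<lambda>x. 1 * (Res ^^ n) f x + (- 1) * (Res ^^ n) (Res f) x)" for n
    unfolding g by (rule residual_iterate_lincomb[OF f residual_Mspace[OF f]])
  then have "(Res ^^ n) ?g x = (Res ^^ n) f x - (Res ^^ Suc n) f x" for n by (simp add: funpow_swap1)
  moreover have "(\<lambda>n. (Res ^^ n) f x) \<longlonglongrightarrow> 0"
    by (rule summable_LIMSEQ_zero[OF summable_residual_iterates[OF f]])
  then have "(\<lambda>n. (Res ^^ n) f x - (Res ^^ Suc n) f x) sums ((Res ^^ 0) f x - 0)"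
    by (rule telescope_sums')
  ultimately show "reconstruction \<mu> K X \<psi> (\<lambda>i. f (X i)) x = f x"
    unfolding reconstruction_def by (simp add: sums_iff)
qed

lemma functional_lincomb:
  assumes "f \<in> L" "g \<in> L"
  shows "functional (\<lambda>x. a * f x + b * g x) = (\<lambda>v. a * functional f v + b * functional g v)"
proof
  fix v
  show "functional (\<lambda>x. a * f x + b * g x) v = a * functional f v + b * functional g v"
  proof (cases "v \<in> S")
    case True
    have "(\<lambda>y. (a * f y + b * g y) * cnj (V v y)) = (\<lambda>y. a * (f y * cnj (V v y)) + b * (g y * cnj (V v y)))"
      by (auto simp: distrib_right mult.assoc)
    then show ?thesis
      using True integrable_functional(1)[OF r m assms(1) True] integrable_functional(1)[OF r m assms(2) True]
      by (simp add: functional_def)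
  qed (simp add: functional_def)
qed

section \<open>Transfer to the coorbit space\<close>

abbreviation "CoLrm \<equiv> Co \<mu> sc ip \<pi> u w r m"
abbreviation "R c \<equiv> functional (reconstruction \<mu> K X \<psi> c)"

lemma Co_iff: "T \<in> CoLrm \<longleftrightarrow> T \<in> antidual \<mu> sc ip \<pi> u w \<and> Ve \<pi> u T \<in> L"
  by (simp add: Co_def)

lemma Ve_Mspace: "T \<in> CoLrm \<Longrightarrow> Ve \<pi> u T \<in> M"
  using Ve_in_Mspace r m by (simp add: Co_iff)

lemma functional_Co: "f \<in> L \<Longrightarrow> functional f \<in> CoLrm"
  unfolding Co_iff by (simp add: functional_in_antidual[OF r m] Ve_functional conv_Lspace)

text \<open>On \<open>S\<close> this is the integral formula for \<open>T\<close>; off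
  \<open>S\<close> both sides are 0. It lifts the reconstruction identity from functions to
  functionals.\<close>

lemma functional_Ve:
  assumes T: "T \<in> CoLrm"
  shows "functional (Ve \<pi> u T) = T"
proof
  fix v
  show "functional (Ve \<pi> u T) v = T v"
    using T antidual_eq_integral(2)[OF _ _ r m, of T v] antidual_off[of T v]
    by (cases "v \<in> S") (auto simp: Co_iff functional_def)
qed

theorem sampling_properties:
  "(\<forall>f\<in>CoLrm. (\<lambda>i. Ve \<pi> u f (X i)) \<in> \<Lambda>) \<and>
   (\<exists>C::real. \<forall>f\<in>CoLrm. lnorm r (\<lambda>i. m (X i)) (\<lambda>i. Ve \<pi> u f (X i)) \<le> ennreal C * Conorm \<mu> \<pi> u r m f) \<and>
   (\<forall>c\<in>\<Lambda>. R c \<in> CoLrm) \<and>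
   (\<forall>c\<in>\<Lambda>. \<forall>d\<in>\<Lambda>. R (\<lambda>i. c i + d i) = (\<lambda>v. R c v + R d v)) \<and>
   (\<forall>a. \<forall>c\<in>\<Lambda>. R (\<lambda>i. a * c i) = (\<lambda>v. a * R c v)) \<and>
   (\<exists>C::real. \<forall>c\<in>\<Lambda>. Conorm \<mu> \<pi> u r m (R c) \<le> ennreal C * lnorm r (\<lambda>i. m (X i)) c) \<and>
   (\<forall>f\<in>CoLrm. R (\<lambda>i. Ve \<pi> u f (X i)) = f)"
proof (intro conjI)
  have R_lincomb: "R (\<lambda>i. a * c i + b * d i) = (\<lambda>v. a * R c v + b * R d v)" if "c \<in> \<Lambda>" "d \<in> \<Lambda>" for a b c d
    unfolding reconstruction_lincomb[OF that] by (intro functional_lincomb reconstruction_Lspace that)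
  show "\<forall>f\<in>CoLrm. (\<lambda>i. Ve \<pi> u f (X i)) \<in> \<Lambda>" using samples_lspace[OF Ve_Mspace] by blast
  show "\<exists>C::real. \<forall>f\<in>CoLrm. lnorm r (\<lambda>i. m (X i)) (\<lambda>i. Ve \<pi> u f (X i)) \<le> ennreal C * Conorm \<mu> \<pi> u r m f"
    unfolding Conorm_def using samples_le Ve_Mspace by metis
  show "\<forall>c\<in>\<Lambda>. R c \<in> CoLrm" by (intro ballI functional_Co reconstruction_Lspace)
  show "\<forall>c\<in>\<Lambda>. \<forall>d\<in>\<Lambda>. R (\<lambda>i. c i + d i) = (\<lambda>v. R c v + R d v)"
    using R_lincomb[where a = 1 and b = 1] by simp
  show "\<forall>a. \<forall>c\<in>\<Lambda>. R (\<lambda>i. a * c i) = (\<lambda>v. a * R c v)"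
    using R_lincomb[where b = 0] by force
  show "\<forall>f\<in>CoLrm. R (\<lambda>i. Ve \<pi> u f (X i)) = f"
    by (simp add: reconstruction_samples Ve_Mspace functional_Ve)
  obtain C where C: "0 \<le> C" "\<And>c. nrm (synthesis \<psi> c) \<le> ennreal C * lnorm r (\<lambda>i. m (X i)) c"
    using synthesis_le by metis
  \<comment> \<open>Read from the right, the constant comes from synthesis, convolution with
    \<open>K\<close>, the Neumann series, and the further convolution that appears because
    \<open>Ve\<close> of \<open>functional f\<close> is \<open>conv \<mu> f K\<close>.\<close>
  have "Conorm \<mu> \<pi> u r m (R c) \<le> ennreal (\<rho> * (1 / (1 - \<gamma>)) * \<rho> * C) * lnorm r (\<lambda>i. m (X i)) c" if c: "c \<in> \<Lambda>" for c
  proof -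
    have "Conorm \<mu> \<pi> u r m (R c) \<le> ennreal \<rho> * nrm (reconstruction \<mu> K X \<psi> c)"
      unfolding Conorm_def Ve_functional using Lnorm_conv_le[OF reconstruction_Lspace[OF c]] by (simp add: rho)
    also have "\<dots> \<le> ennreal \<rho> * (ennreal (1 / (1 - \<gamma>)) * nrm (conv \<mu> (synthesis \<psi> c) K))"
      using Neumann_series_Lnorm_le(2)[OF synthesis_conv_Mspace[OF c]]
      by (intro mult_left_mono) (simp_all add: reconstruction_def[abs_def])
    also have "\<dots> \<le> ennreal \<rho> * (ennreal (1 / (1 - \<gamma>)) * (ennreal \<rho> * nrm (synthesis \<psi> c)))"
      using Lnorm_conv_le[OF synthesis_Lspace[OF c]] by (intro mult_left_mono) (simp_all add: rho)
    also have "\<dots> \<le> ennreal \<rho> * (ennreal (1 / (1 - \<gamma>)) * (ennreal \<rho> * (ennreal C * lnorm r (\<lambda>i. m (X i)) c)))"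
      by (intro mult_left_mono C) simp_all
    also have "\<dots> = ennreal (\<rho> * (1 / (1 - \<gamma>)) * \<rho> * C) * lnorm r (\<lambda>i. m (X i)) c"
    proof -
      have "0 \<le> 1 / (1 - \<gamma>)" using gamma by simp
      then show ?thesis using rho(1) C(1) by (simp only: ennreal_mult mult_nonneg_nonneg mult.assoc)
    qed
    finally show ?thesis .
  qed
  then show "\<exists>C::real. \<forall>c\<in>\<Lambda>. Conorm \<mu> \<pi> u r m (R c) \<le> ennreal C * lnorm r (\<lambda>i. m (X i)) c" by blast
qed

end

text \<open>Inversion is a homeomorphism fixing the identity, so U^{-1} is again a unit
  neighbourhood; it lies in \<open>U0\<close>, and its oscillation constant serves as
  \<open>\<epsilon>\<close>.\<close>

lemma (in coorbit) sampling_hyps_imp_locale: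
  assumes "sampling_hyps \<mu> K w X \<psi> r m"
  obtains U \<epsilon> where "coorbit_sampling \<mu> w sc ip \<pi> u X \<psi> r m U \<epsilon>"
proof -
  obtain U0 C U where *: "\<forall>W. unit_nbhd W \<and> W \<subseteq> U0 \<longrightarrow> C W > 0 \<and>
      (\<forall>f\<in>Mspace \<mu> K r m. wnorm \<mu> r m (osc W f) \<le> ennreal (C W) * Lnorm \<mu> r m f)"
    and U: "compact U" "unit_nbhd U" "U \<subseteq> uminus ` U0" "rc_opnorm \<mu> K r m * ennreal (C (uminus ` U)) < 1" "bupu U X \<psi>"
    using assms unfolding sampling_hyps_def by blast
  have "0 \<in> interior (uminus ` U)"
  proof (rule interiorI)
    show "open (uminus -` interior U)"
      by (intro open_vimage open_interior continuous_group_minus continuous_on_id)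
    show "0 \<in> uminus -` interior U" using U(2) by (simp add: unit_nbhd_def)
    show "uminus -` interior U \<subseteq> uminus ` U"
    proof
      fix x :: 'g assume "x \<in> uminus -` interior U"
      then have "- x \<in> U" using interior_subset by auto
      then show "x \<in> uminus ` U" by (metis image_eqI minus_minus)
    qed
  qed
  moreover have "uminus ` U \<subseteq> U0" using U(3) by force
  ultimately have C: "C (uminus ` U) > 0"
    "\<forall>f\<in>Mspace \<mu> K r m. wnorm \<mu> r m (osc (uminus ` U) f) \<le> ennreal (C (uminus ` U)) * Lnorm \<mu> r m f"
    using * by (auto simp: unit_nbhd_def)
  have "coorbit_sampling \<mu> w sc ip \<pi> u X \<psi> r m U (C (uminus ` U))"
  proof (unfold_locales)
    show "1 < r" "moderate w m" "\<And>f. f \<in> Lspace \<mu> r m \<Longrightarrow> conv \<mu> f K \<in> Lspace \<mu> r m"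
      using assms by (simp_all add: sampling_hyps_def)
  qed (use U C in auto)
  then show ?thesis by (rule that)
qed

theorem mainTheorem3:
  fixes \<mu> :: "'g::{group_add,t2_space,second_countable_topology} measure"
    and sc :: "complex \<Rightarrow> 'h::ab_group_add \<Rightarrow> 'h"
    and ip :: "'h \<Rightarrow> 'h \<Rightarrow> complex"
    and \<pi> :: "'g \<Rightarrow> 'h \<Rightarrow> 'h"
    and u :: 'h
    and w :: "'g \<Rightarrow> real"
    and X :: "'i \<Rightarrow> 'g"
    and \<psi> :: "'i \<Rightarrow> 'g \<Rightarrow> real"
  assumes "lcsc_group TYPE('g)"
    and "haar_measure \<mu>"
    and "weight w"
    and "hilbert_space sc ip"
    and "unitary_rep sc ip \<pi>"
    and "admissible \<mu> ip \<pi> u"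
    and "\<forall>p>1. voice ip \<pi> u u \<in> Lspace \<mu> p w"
  shows "\<exists>R :: ('i \<Rightarrow> complex) \<Rightarrow> ('h \<Rightarrow> complex).
    \<forall>r m. sampling_hyps \<mu> (voice ip \<pi> u u) w X \<psi> r m \<longrightarrow>
      \<comment> \<open>Samp_{X,Co} is well defined and bounded Co(L_{r,m}) -> l_{r,m_X}\<close>
      (\<forall>f\<in>Co \<mu> sc ip \<pi> u w r m. (\<lambda>i. Ve \<pi> u f (X i)) \<in> lspace r (\<lambda>i. m (X i))) \<and>
      (\<exists>C::real. \<forall>f\<in>Co \<mu> sc ip \<pi> u w r m.
          lnorm r (\<lambda>i. m (X i)) (\<lambda>i. Ve \<pi> u f (X i)) \<le> ennreal C * Conorm \<mu> \<pi> u r m f) \<and>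
      \<comment> \<open>R is a bounded linear operator l_{r,m_X} -> Co(L_{r,m})\<close>
      (\<forall>c\<in>lspace r (\<lambda>i. m (X i)). R c \<in> Co \<mu> sc ip \<pi> u w r m) \<and>
      (\<forall>c\<in>lspace r (\<lambda>i. m (X i)). \<forall>d\<in>lspace r (\<lambda>i. m (X i)). R (\<lambda>i. c i + d i) = (\<lambda>v. R c v + R d v)) \<and>
      (\<forall>a. \<forall>c\<in>lspace r (\<lambda>i. m (X i)). R (\<lambda>i. a * c i) = (\<lambda>v. a * R c v)) \<and>
      (\<exists>C::real. \<forall>c\<in>lspace r (\<lambda>i. m (X i)).
          Conorm \<mu> \<pi> u r m (R c) \<le> ennreal C * lnorm r (\<lambda>i. m (X i)) c) \<and>
      \<comment> \<open>R o Samp = id on Co(L_{r,m})\<close>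
      (\<forall>f\<in>Co \<mu> sc ip \<pi> u w r m. R (\<lambda>i. Ve \<pi> u f (X i)) = f)"
proof -
  interpret coorbit \<mu> w sc ip \<pi> u
    using assms by unfold_locales
  show ?thesis
  \<comment> \<open>The witness depends only on \<open>K\<close>, \<open>X\<close> and
    \<open>\<psi>\<close> besides the ambient data, so it can be chosen before
    \<open>(r, m)\<close>; this is the independence of the operator from the pair.\<close>
  proof (rule exI[of _ "\<lambda>c. functional (reconstruction \<mu> K X \<psi> c)"], intro allI impI, goal_cases)
    case (1 r m)
    then obtain U \<epsilon> where "coorbit_sampling \<mu> w sc ip \<pi> u X \<psi> r m U \<epsilon>"
      by (rule sampling_hyps_imp_locale)
    then interpret coorbit_sampling \<mu> w sc ip \<pi> u X \<psi> r m U \<epsilon> .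
    show ?case by (rule sampling_properties)
  qed
qed

end
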